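(* Let $(A,I)$ be a finite simple graph. If $(A,I)$ is a transitive forest, then the graph group $\mathbb{G}(A,I)$ is knapsack tame.
   Context: For a finite simple graph $(A,I)$, the graph group is $\mathbb{G}(A,I) = \langle A \mid ab = ba\ ((a,b)\in I)\rangle$. The comparability graph of a (finite, rooted) tree $t$ is the simple graph with the same vertices as $t$ that has an edge between two vertices whenever one is a descendant of the other in $t$. A graph is a transitive forest if it is a disjoint union of comparability graphs of trees. Semilinear sets. For $x\in\mathbb{Z}^k$ let $\|x\|=\max_i |x_i|$. For $T\subseteq\mathbb{N}^k$ let $T^\oplus$ be the smallest subset of $\mathbb{N}^k$ that contains $0$ and $T$ and is closed under addition. A linear set is a set $x+F^\oplus$ with $x\in\mathbb{N}^k$ and $F\subseteq\mathbb{N}^k$ finite; a semilinear set is a finite union of linear sets. If $S=\bigcup_{i=1}^n (x_i+F_i^\oplus)$ with $x_i\in\mathbb{N}^k$ and $F_i\subseteq\mathbb{N}^k$ finite, then $(x_1,F_1,\dots,x_n,F_n)$ is a semilinear representation of $S$, whose magnitude is the maximum of $\|y\|$ over all $y\in\bigcup_{i=1}^n(\{x_i\}\cup F_i)$. The magnitude of a semilinear set is the smallest magnitude of a semilinear representation of it. Exponent equations. Let $G$ be a group with finite generating set $A$. An exponent equation over $G$ is an equation $h_0 g_1^{\mathsf{x}_1} h_1 g_2^{\mathsf{x}_2} h_2\cdots g_k^{\mathsf{x}_k}h_k=1$ with $g_i,h_i\in G$ and variables $\mathsf{x}_i$; its size is $\sum_{i=0}^k|h_i|+\sum_{i=1}^k|g_i|$,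 where $|g|$ is the length of a shortest word over $A\cup A^{-1}$ representing $g$. If the variables are pairwise distinct, its set of solutions is the set of all $(x_1,\dots,x_k)\in\mathbb{N}^k$ such that $h_0 g_1^{x_1}h_1\cdots g_k^{x_k}h_k=1$ holds in $G$. A (finitely generated) group $G$ is knapsack tame if there is a polynomial $p$ such that for every exponent equation $h_0g_1^{\mathsf{x}_1}h_1\cdots g_k^{\mathsf{x}_k}h_k=1$ over $G$ of size $n$ with pairwise distinct variables, the set $S\subseteq\mathbb{N}^k$ of solutions is semilinear of magnitude at most $p(n)$. (This does not depend on the chosen finite generating set.) *)

theory Defs
  imports
    "HOL-Algebra.Generated_Groups"
    "HOL-Computational_Algebra.Polynomial"
    "HOL-Library.Disjoint_Sets"
    "HOL-Library.Function_Algebras"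
begin

section \<open>Graphs\<close>

definition finite_simple_graph :: "'a set \<Rightarrow> ('a \<times> 'a) set \<Rightarrow> bool" where
  "finite_simple_graph A I \<longleftrightarrow> finite A \<and> I \<subseteq> A \<times> A \<and> sym I \<and> irrefl I"

text \<open>
  A finite rooted tree has vertex set \<open>V\<close> and edge set \<open>E\<close>; \<open>(u, v) \<in> E\<close> means that \<open>u\<close> is the
  parent of \<open>v\<close>. Hence \<open>(u, v) \<in> E\<^sup>+\<close> says that \<open>v\<close> is a proper descendant of \<open>u\<close>.
\<close>

definition rooted_tree :: "'a set \<Rightarrow> ('a \<times> 'a) set \<Rightarrow> bool" where
  "rooted_tree V E \<longleftrightarrow> finite V \<and> E \<subseteq> V \<times> V \<and>
     (\<exists>r\<in>V. (\<forall>v\<in>V. (r, v) \<in> E\<^sup>*) \<and> (\<nexists>u. (u, r) \<in> E) \<and> (\<forall>v\<in>V - {r}. \<exists>!u. (u, v) \<in> E))"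

definition comparability_edges :: "('a \<times> 'a) set \<Rightarrow> ('a \<times> 'a) set" where
  "comparability_edges E = E\<^sup>+ \<union> (E\<^sup>+)\<inverse>"

definition transitive_forest :: "'a set \<Rightarrow> ('a \<times> 'a) set \<Rightarrow> bool" where
  "transitive_forest A I \<longleftrightarrow> (\<exists>T :: ('a set \<times> ('a \<times> 'a) set) set.
     (\<forall>(V, E)\<in>T. rooted_tree V E) \<and> disjoint_family_on fst T \<and>
     A = (\<Union>(V, E)\<in>T. V) \<and> I = (\<Union>(V, E)\<in>T. comparability_edges E))"


section \<open>Group presentations and graph groups\<close>

text \<open>
  Words over \<open>A \<union> A\<inverse>\<close>: the letter \<open>(a, True)\<close> stands for \<open>a\<close> and \<open>(a, False)\<close> for its formal inverse.
\<close>

abbreviation signed_words :: "'a set \<Rightarrow> ('a \<times> bool) list set" where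
  "signed_words A \<equiv> lists (A \<times> UNIV)"

inductive_set pres_cong ::
  "'a set \<Rightarrow> (('a \<times> bool) list \<times> ('a \<times> bool) list) set \<Rightarrow>
     (('a \<times> bool) list \<times> ('a \<times> bool) list) set"
  for A R where
    refl: "w \<in> signed_words A \<Longrightarrow> (w, w) \<in> pres_cong A R"
  | sym: "(u, v) \<in> pres_cong A R \<Longrightarrow> (v, u) \<in> pres_cong A R"
  | trans: "(u, v) \<in> pres_cong A R \<Longrightarrow> (v, w) \<in> pres_cong A R \<Longrightarrow> (u, w) \<in> pres_cong A R"
  | mult: "(u, u') \<in> pres_cong A R \<Longrightarrow> (v, v') \<in> pres_cong A R \<Longrightarrow> (u @ v, u' @ v') \<in> pres_cong A R"
  | cancel: "a \<in> A \<Longrightarrow> ([(a, b), (a, \<not> b)], []) \<in> pres_cong A R"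
  | rel: "(u, v) \<in> R \<Longrightarrow> u \<in> signed_words A \<Longrightarrow> v \<in> signed_words A \<Longrightarrow> (u, v) \<in> pres_cong A R"

definition presented_group ::
  "'a set \<Rightarrow> (('a \<times> bool) list \<times> ('a \<times> bool) list) set \<Rightarrow> ('a \<times> bool) list set monoid" where
  "presented_group A R =
     \<lparr>carrier = signed_words A // pres_cong A R,
      monoid.mult = (\<lambda>X Y. \<Union>u\<in>X. \<Union>v\<in>Y. pres_cong A R `` {u @ v}),
      one = pres_cong A R `` {[]}\<rparr>"

definition graph_group :: "'a set \<Rightarrow> ('a \<times> 'a) set \<Rightarrow> ('a \<times> bool) list set monoid" where
  "graph_group A I =
     presented_group A {([(a, True), (b, True)], [(b, True), (a, True)]) | a b. (a, b) \<in> I}"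

lemma pres_cong_words:
  "(u, v) \<in> pres_cong A R \<Longrightarrow> u \<in> signed_words A \<and> v \<in> signed_words A"
  by (induction rule: pres_cong.induct) auto

lemma equiv_pres_cong: "equiv (signed_words A) (pres_cong A R)"
proof (rule equivI)
  show "pres_cong A R \<subseteq> signed_words A \<times> signed_words A"
    by (rule subrelI, drule pres_cong_words) (blast intro: SigmaI)
  show "refl_on (signed_words A) (pres_cong A R)"
    by (auto intro: refl_onI pres_cong.refl)
  show "sym (pres_cong A R)"
    by (auto intro: symI pres_cong.sym)
  show "trans (pres_cong A R)"
    by (auto intro: transI pres_cong.trans)
qed

lemma mult_presented_group:
  assumes "u \<in> signed_words A" "v \<in> signed_words A"
  shows "pres_cong A R `` {u} \<otimes>\<^bsub>presented_group A R\<^esub> pres_cong A R `` {v} = pres_cong A R `` {u @ v}"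
proof -
  have "congruent2 (pres_cong A R) (pres_cong A R) (\<lambda>u v. pres_cong A R `` {u @ v})"
    by (rule congruent2I')
       (metis equiv_class_eq equiv_pres_cong pres_cong.mult)
  then show ?thesis
    using UN_equiv_class2[OF equiv_pres_cong equiv_pres_cong _ assms]
    by (simp add: presented_group_def)
qed

lemma pres_cong_inverse:
  "w \<in> signed_words A \<Longrightarrow> (rev (map (apsnd Not) w) @ w, []) \<in> pres_cong A R"
proof (induction w)
  case Nil
  then show ?case by (simp add: pres_cong.refl)
next
  case (Cons x w)
  obtain a b where x: "x = (a, b)" by force
  let ?v = "rev (map (apsnd Not) w)"
  have w: "w \<in> signed_words A" and a: "a \<in> A" using Cons.prems x by auto
  then have v: "?v \<in> signed_words A" by (fastforce simp: in_lists_conv_set)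
  have "(?v @ ([(a, \<not> b), (a, \<not> \<not> b)] @ w), ?v @ ([] @ w)) \<in> pres_cong A R"
    by (intro pres_cong.mult pres_cong.refl pres_cong.cancel a v w)
  with Cons.IH[OF w] show ?case
    by (auto simp: x intro: pres_cong.trans)
qed

lemma group_presented_group: "group (presented_group A R)"
proof (rule groupI)
  let ?G = "presented_group A R" and ?c = "\<lambda>w. pres_cong A R `` {w}"
  have car: "carrier ?G = ?c ` signed_words A"
    by (auto simp: presented_group_def quotient_def)
  have one: "\<one>\<^bsub>?G\<^esub> = ?c []" by (simp add: presented_group_def)
  show "\<one>\<^bsub>?G\<^esub> \<in> carrier ?G" by (auto simp: car one)
  fix x assume "x \<in> carrier ?G"
  then obtain w where w: "w \<in> signed_words A" "x = ?c w" by (auto simp: car)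
  show "\<one>\<^bsub>?G\<^esub> \<otimes>\<^bsub>?G\<^esub> x = x"
    using mult_presented_group[OF lists.Nil w(1)] by (simp add: w one)
  {
    fix y assume "y \<in> carrier ?G"
    then obtain u where u: "u \<in> signed_words A" "y = ?c u" by (auto simp: car)
    have wu: "w @ u \<in> signed_words A" using w u by simp
    have xy: "x \<otimes>\<^bsub>?G\<^esub> y = ?c (w @ u)"
      unfolding w u using w u by (intro mult_presented_group)
    with wu show "x \<otimes>\<^bsub>?G\<^esub> y \<in> carrier ?G" unfolding car by blast
    fix z assume "z \<in> carrier ?G"
    then obtain v where v: "v \<in> signed_words A" "z = ?c v" by (auto simp: car)
    have uv: "u @ v \<in> signed_words A" using u v by simp
    show "x \<otimes>\<^bsub>?G\<^esub> y \<otimes>\<^bsub>?G\<^esub> z = x \<otimes>\<^bsub>?G\<^esub> (y \<otimes>\<^bsub>?G\<^esub> z)"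
      unfolding xy unfolding w(2) u(2) v(2) mult_presented_group[OF wu v(1)]
        mult_presented_group[OF u(1) v(1)] mult_presented_group[OF w(1) uv] by simp
  }
  let ?v = "rev (map (apsnd Not) w)"
  have v: "?v \<in> signed_words A" using w by (fastforce simp: in_lists_conv_set)
  have "?c ?v \<otimes>\<^bsub>?G\<^esub> x = \<one>\<^bsub>?G\<^esub>"
    unfolding w(2) one mult_presented_group[OF v w(1)]
    by (rule equiv_class_eq[OF equiv_pres_cong pres_cong_inverse[OF w(1)]])
  moreover have "?c ?v \<in> carrier ?G" unfolding car using v by blast
  ultimately show "\<exists>y\<in>carrier ?G. y \<otimes>\<^bsub>?G\<^esub> x = \<one>\<^bsub>?G\<^esub>" by blast
qed


section \<open>Semilinear sets\<close>

text \<open>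
  A vector \<open>(x\<^sub>1, \<dots>, x\<^sub>k) \<in> \<nat>\<^sup>k\<close> is the function with value \<open>x\<^sub>i\<close> at \<open>i \<in> {1..k}\<close> and \<open>0\<close> elsewhere, so
  that the pointwise \<open>+\<close> and \<open>0\<close> on functions are those of \<open>\<nat>\<^sup>k\<close>.
\<close>

definition nat_vectors :: "nat \<Rightarrow> (nat \<Rightarrow> nat) set" where
  "nat_vectors k = {x. \<forall>i. i \<notin> {1..k} \<longrightarrow> x i = 0}"

definition max_norm :: "nat \<Rightarrow> (nat \<Rightarrow> nat) \<Rightarrow> nat" where
  "max_norm k x = Max (insert 0 (x ` {1..k}))"

inductive_set add_closure :: "(nat \<Rightarrow> nat) set \<Rightarrow> (nat \<Rightarrow> nat) set" for T where
    zero: "0 \<in> add_closure T"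
  | incl: "x \<in> T \<Longrightarrow> x \<in> add_closure T"
  | add: "x \<in> add_closure T \<Longrightarrow> y \<in> add_closure T \<Longrightarrow> x + y \<in> add_closure T"

definition linear_set :: "(nat \<Rightarrow> nat) \<Rightarrow> (nat \<Rightarrow> nat) set \<Rightarrow> (nat \<Rightarrow> nat) set" where
  "linear_set x F = (\<lambda>y. x + y) ` add_closure F"

type_synonym semilinear_rep = "((nat \<Rightarrow> nat) \<times> (nat \<Rightarrow> nat) set) list"

definition semilinear_representation ::
  "nat \<Rightarrow> (nat \<Rightarrow> nat) set \<Rightarrow> semilinear_rep \<Rightarrow> bool" where
  "semilinear_representation k S \<rho> \<longleftrightarrow>
     (\<forall>(x, F)\<in>set \<rho>. x \<in> nat_vectors k \<and> finite F \<and> F \<subseteq> nat_vectors k) \<and>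
     S = (\<Union>(x, F)\<in>set \<rho>. linear_set x F)"

text \<open>The magnitude of the empty representation (of the empty set) is \<open>0\<close>.\<close>

definition rep_magnitude :: "nat \<Rightarrow> semilinear_rep \<Rightarrow> nat" where
  "rep_magnitude k \<rho> = Max (insert 0 (max_norm k ` (\<Union>(x, F)\<in>set \<rho>. insert x F)))"

definition semilinear :: "nat \<Rightarrow> (nat \<Rightarrow> nat) set \<Rightarrow> bool" where
  "semilinear k S \<longleftrightarrow> (\<exists>\<rho>. semilinear_representation k S \<rho>)"

text \<open>Meaningful only for semilinear \<open>S\<close>.\<close>

definition magnitude :: "nat \<Rightarrow> (nat \<Rightarrow> nat) set \<Rightarrow> nat" where
  "magnitude k S = (LEAST m. \<exists>\<rho>. semilinear_representation k S \<rho> \<and> rep_magnitude k \<rho> = m)"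


section \<open>Exponent equations and knapsack tameness\<close>

definition finite_generating_set :: "('g, 'm) monoid_scheme \<Rightarrow> 'g set \<Rightarrow> bool" where
  "finite_generating_set G X \<longleftrightarrow> finite X \<and> X \<subseteq> carrier G \<and> generate G X = carrier G"

definition word_length :: "('g, 'm) monoid_scheme \<Rightarrow> 'g set \<Rightarrow> 'g \<Rightarrow> nat" where
  "word_length G X g =
     (LEAST n. \<exists>w. set w \<subseteq> X \<union> m_inv G ` X \<and> length w = n \<and> foldr (\<otimes>\<^bsub>G\<^esub>) w \<one>\<^bsub>G\<^esub> = g)"

text \<open>
  The equation \<open>h 0 \<cdot> g 1 ^ x 1 \<cdot> h 1 \<cdot> \<dots> \<cdot> g k ^ x k \<cdot> h k = 1\<close> with pairwise distinct variables is given by \<open>k\<close> and the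
  functions \<open>h\<close> on \<open>{0..k}\<close> and \<open>g\<close> on \<open>{1..k}\<close>; other values of \<open>h\<close> and \<open>g\<close> are irrelevant.
\<close>

primrec exponent_product ::
  "('g, 'm) monoid_scheme \<Rightarrow> (nat \<Rightarrow> 'g) \<Rightarrow> (nat \<Rightarrow> 'g) \<Rightarrow> (nat \<Rightarrow> nat) \<Rightarrow> nat \<Rightarrow> 'g" where
  "exponent_product G h g x 0 = h 0"
| "exponent_product G h g x (Suc k) =
     exponent_product G h g x k \<otimes>\<^bsub>G\<^esub> g (Suc k) [^]\<^bsub>G\<^esub> x (Suc k) \<otimes>\<^bsub>G\<^esub> h (Suc k)"

definition exponent_solutions ::
  "('g, 'm) monoid_scheme \<Rightarrow> nat \<Rightarrow> (nat \<Rightarrow> 'g) \<Rightarrow> (nat \<Rightarrow> 'g) \<Rightarrow> (nat \<Rightarrow> nat) set" where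
  "exponent_solutions G k h g = {x \<in> nat_vectors k. exponent_product G h g x k = \<one>\<^bsub>G\<^esub>}"

definition equation_size ::
  "('g, 'm) monoid_scheme \<Rightarrow> 'g set \<Rightarrow> nat \<Rightarrow> (nat \<Rightarrow> 'g) \<Rightarrow> (nat \<Rightarrow> 'g) \<Rightarrow> nat" where
  "equation_size G X k h g =
     (\<Sum>i=0..k. word_length G X (h i)) + (\<Sum>i=1..k. word_length G X (g i))"

definition knapsack_tame_wrt :: "('g, 'm) monoid_scheme \<Rightarrow> 'g set \<Rightarrow> bool" where
  "knapsack_tame_wrt G X \<longleftrightarrow> (\<exists>p :: nat poly. \<forall>k h g.
     h ` {0..k} \<subseteq> carrier G \<longrightarrow> g ` {1..k} \<subseteq> carrier G \<longrightarrow>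
     semilinear k (exponent_solutions G k h g) \<and>
     magnitude k (exponent_solutions G k h g) \<le> poly p (equation_size G X k h g))"

text \<open>
  Tameness does not depend on the finite generating set; the definition asks for it with respect to
  all of them, and separately that one exists.
\<close>

definition knapsack_tame :: "('g, 'm) monoid_scheme \<Rightarrow> bool" where
  "knapsack_tame G \<longleftrightarrow> group G \<and> (\<exists>X. finite_generating_set G X) \<and>
     (\<forall>X. finite_generating_set G X \<longrightarrow> knapsack_tame_wrt G X)"

end

theory Submission
  imports Defs "HOL-Library.Multiset"
begin

text \<open>
  A transitive forest is built from the empty graph by disjoint unions and by adding a vertex that is
  adjacent to all others, so it suffices that tameness survives free products and direct products
  with the integers.

  Semilinearity with magnitude at most \<open>M\<close> is used pointwise: every solution lies in a linear subset of
  the solution set whose base and periods are bounded by \<open>M\<close>. This form passes to arbitrary unions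
  and to sums.

  A factor \<open>\<int>\<close> adds one linear equation \<open>c + \<lambda>(x) = 0\<close>. A multiset of boundedly many values of periods
  whose sum is small falls apart into zero-sum blocks and a small rest: if many positive and many
  negative values occur, then some \<open>u > 0\<close> and some \<open>- v < 0\<close> are frequent, and \<open>v\<close> copies of \<open>u\<close> cancel \<open>u\<close>
  copies of \<open>- v\<close>. The blocks are the new periods and the rest goes into the new base.

  In a free product, cyclic reduction turns a power \<open>g\<^sup>x\<close> into a conjugate of the power of a syllable or
  into a conjugate of a stretch of a periodic word whose infixes are reduced. A word is trivial if and only if
  its syllables split into noncrossing blocks, each with trivial product in its factor. A block has at most one
  syllable from each periodic stretch, so it is an exponent equation over a factor, of polynomial
  size. Removing the block of the first syllable cuts the equation into pieces with fewer atoms, in which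
  periodic stretches may reappear at both sides of a cut. The only case without progress is a block that
  consists of the first and the last syllable; a maximal run of such blocks is eventually periodic, which
  yields one more period.
\<close>

section \<open>Words and pointwise semilinearity\<close>

text \<open>The bound stays polynomial because pieces of an equation are never substituted into each
  other. After a cut the pieces have disjoint variables, or they share one variable whose value is
  the sum of its values in the pieces plus one for the cut syllable. So solution vectors are added,
  and their bounds are added with them. Working at one given solution fixes the places of all cuts
  beforehand.

  An equation of weight \<open>w\<close> gets the budget \<open>C * (w - 3)\<close>. A proper cut
  inside a periodic atom copies this atom, so the pieces weigh \<open>w + 2\<close> in total, but
  the offset is now subtracted twice: (w + 2) - 6 is one less than w - 3. The spare \<open>C\<close>
  pays for the equation of the block, for the cut syllables and for the period of a run. A block of
  the first and the last syllable leaves an equation of the same weight in which only exponents have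
  dropped; no budget is freed there, and a separate argument by periodicity is required.

  Polynomials are composed only when two subgraphs are joined or a universal vertex is added, so
  their degrees depend on the graph alone.\<close>

definition comm_rels :: "('a \<times> 'a) set \<Rightarrow> (('a \<times> bool) list \<times> ('a \<times> bool) list) set" where
  "comm_rels I = {([(a, True), (b, True)], [(b, True), (a, True)]) | a b. (a, b) \<in> I}"

definition winv :: "('a \<times> bool) list \<Rightarrow> ('a \<times> bool) list" where
  "winv w = rev (map (apsnd Not) w)"

definition wpow :: "'l list \<Rightarrow> nat \<Rightarrow> 'l list" where
  "wpow w n = concat (replicate n w)"

lemma wpow_0 [simp]: "wpow w 0 = []"
  and wpow_Suc [simp]: "wpow w (Suc n) = w @ wpow w n"
  by (simp_all add: wpow_def)

lemma wpow_Nil [simp]: "wpow [] n = []"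
  by (induction n) auto

lemma wpow_add: "wpow w (m + n) = wpow w m @ wpow w n"
  by (induction m) auto

lemma set_wpow: "set (wpow w n) \<subseteq> set w"
  by (induction n) auto

lemma winv_Nil [simp]: "winv [] = []"
  and winv_append [simp]: "winv (u @ v) = winv v @ winv u"
  and length_winv [simp]: "length (winv w) = length w"
  by (simp_all add: winv_def)

lemma winv_winv [simp]: "winv (winv w) = w"
  by (simp add: winv_def rev_map comp_def apsnd_def map_prod_def case_prod_beta)

lemma set_winv_subset: "set w \<subseteq> S \<times> UNIV \<Longrightarrow> set (winv w) \<subseteq> S \<times> UNIV"
  by (auto simp: winv_def)

section \<open>Words modulo the relations of a graph group\<close>

locale graph =
  fixes I :: "('a \<times> 'a) set"
begin

definition eqv :: "('a \<times> bool) list \<Rightarrow> ('a \<times> bool) list \<Rightarrow> bool" (infix "\<approx>" 50) where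
  "u \<approx> v \<longleftrightarrow> (u, v) \<in> pres_cong UNIV (comm_rels I)"

abbreviation triv :: "('a \<times> bool) list \<Rightarrow> bool" where
  "triv w \<equiv> w \<approx> []"

lemma eqv_refl [simp]: "w \<approx> w"
  by (simp add: eqv_def pres_cong.refl)

lemma eqv_sym: "u \<approx> v \<Longrightarrow> v \<approx> u"
  by (auto simp: eqv_def intro: pres_cong.sym)

lemma eqv_trans [trans]: "u \<approx> v \<Longrightarrow> v \<approx> w \<Longrightarrow> u \<approx> w"
  by (auto simp: eqv_def intro: pres_cong.trans)

lemma eqv_append: "u \<approx> u' \<Longrightarrow> v \<approx> v' \<Longrightarrow> u @ v \<approx> u' @ v'"
  by (auto simp: eqv_def intro: pres_cong.mult)

lemma eqv_triv: "u \<approx> v \<Longrightarrow> triv u \<longleftrightarrow> triv v"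
  by (metis eqv_sym eqv_trans)

lemma eqv_insert: "triv v \<Longrightarrow> x @ v @ y \<approx> x @ y"
  using eqv_append[OF eqv_refl eqv_append[OF _ eqv_refl], of v "[]"] by simp

lemma triv_insert: "triv v \<Longrightarrow> triv (x @ v @ y) \<longleftrightarrow> triv (x @ y)"
  by (rule eqv_triv, rule eqv_insert)

lemma triv_append_left: "triv v \<Longrightarrow> triv (v @ y) \<longleftrightarrow> triv y"
  using triv_insert[of v "[]" y] by simp

lemma triv_append_right: "triv v \<Longrightarrow> triv (x @ v) \<longleftrightarrow> triv x"
  using triv_insert[of v x "[]"] by simp

lemma triv_winv_left [simp]: "triv (winv w @ w)"
  using pres_cong_inverse[of w UNIV "comm_rels I"] by (simp add: eqv_def winv_def)

lemma triv_winv_right [simp]: "triv (w @ winv w)"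
  using triv_winv_left[of "winv w"] by simp

lemma eqv_wpow: "u \<approx> v \<Longrightarrow> wpow u n \<approx> wpow v n"
  by (induction n) (auto intro: eqv_append)

lemma wpow_conj: "wpow (c @ u @ winv c) n \<approx> c @ wpow u n @ winv c"
proof (induction n)
  case 0
  then show ?case by (simp add: eqv_sym)
next
  case (Suc n)
  have "wpow (c @ u @ winv c) (Suc n) \<approx> (c @ u @ winv c) @ c @ wpow u n @ winv c"
    using Suc.IH by (simp add: eqv_append del: append_assoc)
  also have "(c @ u @ winv c) @ c @ wpow u n @ winv c = (c @ u) @ (winv c @ c) @ wpow u n @ winv c"
    by simp
  also have "\<dots> \<approx> (c @ u) @ wpow u n @ winv c"
    by (rule eqv_insert) simp
  finally show ?case by simp
qed

end


section \<open>Pointwise semilinearity with bounded periods\<close>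

text \<open>The dimension does not appear: a linear set inside \<open>S\<close> inherits the support
  of \<open>S\<close>. The divisibility by \<open>m i\<close> keeps coordinate \<open>i\<close> in
  the residue class of \<open>s i\<close>, which later keeps the cut places of periodic words
  intact.\<close>

definition good_at :: "(nat \<Rightarrow> nat) \<Rightarrow> nat \<Rightarrow> (nat \<Rightarrow> nat) set \<Rightarrow> (nat \<Rightarrow> nat) \<Rightarrow> bool" where
  "good_at m M S s \<longleftrightarrow> (\<exists>x F. finite F \<and> (\<forall>i. x i \<le> M) \<and>
     (\<forall>f\<in>F. \<forall>i. f i \<le> M \<and> m i dvd f i) \<and> s \<in> linear_set x F \<and> linear_set x F \<subseteq> S)"

lemma add_closure_eq: "add_closure F = {sum_list fs | fs. set fs \<subseteq> F}"
proof
  show "add_closure F \<subseteq> {sum_list fs | fs. set fs \<subseteq> F}"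
  proof
    fix x assume "x \<in> add_closure F"
    then show "x \<in> {sum_list fs | fs. set fs \<subseteq> F}"
    proof induction
      case zero
      then show ?case by (auto intro!: exI[of _ "[]"])
    next
      case (incl x)
      then show ?case by (auto intro!: exI[of _ "[x]"])
    next
      case (add x y)
      then obtain f g where "x = sum_list f" "set f \<subseteq> F" "y = sum_list g" "set g \<subseteq> F" by blast
      then show ?case by (auto intro!: exI[of _ "f @ g"])
    qed
  qed
  have "set fs \<subseteq> F \<Longrightarrow> sum_list fs \<in> add_closure F" for fs
    by (induction fs) (auto intro: add_closure.intros)
  then show "{sum_list fs | fs. set fs \<subseteq> F} \<subseteq> add_closure F" by auto
qed

lemma linear_set_iff: "s \<in> linear_set x F \<longleftrightarrow> (\<exists>fs. set fs \<subseteq> F \<and> s = x + sum_list fs)"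
  by (auto simp: linear_set_def add_closure_eq)

lemma linear_set_base: "x \<in> linear_set x F"
  by (auto simp: linear_set_iff intro!: exI[of _ "[]"])

lemma linear_set_add_period:
  assumes "y \<in> linear_set x F" "f \<in> F"
  shows "y + f \<in> linear_set x F"
proof -
  obtain fs where fs: "set fs \<subseteq> F" "y = x + sum_list fs"
    using assms(1) unfolding linear_set_iff by blast
  have "set (fs @ [f]) \<subseteq> F" "y + f = x + sum_list (fs @ [f])"
    using fs assms(2) by (auto simp: add.assoc)
  then show ?thesis unfolding linear_set_iff by blast
qed

lemma dvd_sum_list_fun:
  fixes d :: nat
  assumes "\<forall>f\<in>set fs. d dvd f i"
  shows "d dvd (sum_list fs :: nat \<Rightarrow> nat) i"
  using assms by (induction fs) auto

text \<open>This is what the divisibility of the periods is for: all members of the linear set agree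
  modulo \<open>m\<close>.\<close>

lemma linear_set_cong:
  fixes m :: "nat \<Rightarrow> nat"
  assumes "y \<in> linear_set x F" "s \<in> linear_set x F" "\<forall>f\<in>F. \<forall>i. m i dvd f i"
  shows "y i mod m i = s i mod m i"
proof -
  have "z i mod m i = x i mod m i" if z: "z \<in> linear_set x F" for z
  proof -
    obtain fs where fs: "set fs \<subseteq> F" "z = x + sum_list fs"
      using z unfolding linear_set_iff by blast
    have "m i dvd sum_list fs i" using fs(1) assms(3) by (intro dvd_sum_list_fun) blast
    then show ?thesis by (auto simp: fs(2) elim!: dvdE)
  qed
  then show ?thesis using assms by metis
qed

lemma linear_set_Un:
  assumes "y \<in> linear_set (x + x') (F \<union> F')"
  shows "\<exists>y1\<in>linear_set x F. \<exists>y2\<in>linear_set x' F'. y = y1 + y2"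
proof -
  obtain fs where fs: "set fs \<subseteq> F \<union> F'" "y = (x + x') + sum_list fs"
    using assms unfolding linear_set_iff by blast
  have "\<exists>fs1 fs2. set fs1 \<subseteq> F \<and> set fs2 \<subseteq> F' \<and> sum_list fs = sum_list fs1 + sum_list fs2"
    using fs(1)
  proof (induction fs)
    case Nil
    then show ?case by (intro exI[of _ "[]"]) auto
  next
    case (Cons f fs)
    then obtain fs1 fs2 where IH: "set fs1 \<subseteq> F" "set fs2 \<subseteq> F'" "sum_list fs = sum_list fs1 + sum_list fs2"
      by (metis insert_subset list.simps(15))
    show ?case
    proof (cases "f \<in> F")
      case True
      then show ?thesis using IH
        by (intro exI[of _ "f # fs1"] exI[of _ fs2]) (auto simp: add.assoc)
    next
      case False
      then show ?thesis using IH Cons.prems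
        by (intro exI[of _ fs1] exI[of _ "f # fs2"]) (auto simp: add.left_commute)
    qed
  qed
  then obtain fs1 fs2 where "set fs1 \<subseteq> F" "set fs2 \<subseteq> F'" "sum_list fs = sum_list fs1 + sum_list fs2"
    by blast
  then show ?thesis
    by (intro bexI[of _ "x + sum_list fs1"] bexI[of _ "x' + sum_list fs2"])
      (auto simp: linear_set_iff fs(2) add.assoc add.left_commute)
qed

lemma linear_set_plus:
  assumes "y1 \<in> linear_set x F" "y2 \<in> linear_set x' F'"
  shows "y1 + y2 \<in> linear_set (x + x') (F \<union> F')"
proof -
  obtain f1 f2 where "set f1 \<subseteq> F" "set f2 \<subseteq> F'" "y1 = x + sum_list f1" "y2 = x' + sum_list f2"
    using assms unfolding linear_set_iff by blast
  then show ?thesis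
    by (auto simp: linear_set_iff add.assoc add.left_commute intro!: exI[of _ "f1 @ f2"])
qed

text \<open>The sum of two linear sets is linear. The closure condition has to be checked only for
  vectors congruent to \<open>s1\<close> and \<open>s2\<close> modulo \<open>m\<close>; cuts of
  periodic atoms are sound only for those.\<close>

lemma good_at_plus:
  assumes "good_at m M1 S1 s1" "good_at m M2 S2 s2"
    and "\<And>y1 y2. y1 \<in> S1 \<Longrightarrow> y2 \<in> S2 \<Longrightarrow> \<forall>i. y1 i mod m i = s1 i mod m i \<Longrightarrow>
           \<forall>i. y2 i mod m i = s2 i mod m i \<Longrightarrow> y1 + y2 \<in> S"
    and "M1 + M2 \<le> M" "s = s1 + s2"
  shows "good_at m M S s"
proof -
  obtain x F where 1: "finite F" "\<forall>i. x i \<le> M1" "\<forall>f\<in>F. \<forall>i. f i \<le> M1 \<and> m i dvd f i"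
      "s1 \<in> linear_set x F" "linear_set x F \<subseteq> S1"
    using assms(1) by (auto simp: good_at_def)
  obtain x' F' where 2: "finite F'" "\<forall>i. x' i \<le> M2" "\<forall>f\<in>F'. \<forall>i. f i \<le> M2 \<and> m i dvd f i"
      "s2 \<in> linear_set x' F'" "linear_set x' F' \<subseteq> S2"
    using assms(2) by (auto simp: good_at_def)
  have "(x + x') i \<le> M" for i using 1(2) 2(2) assms(4) by (metis add_mono le_trans plus_fun_apply)
  moreover have "f i \<le> M" if "f \<in> F \<union> F'" for f i
    using that 1(3) 2(3) assms(4) by (metis UnE add_leE le_trans)
  moreover have "linear_set (x + x') (F \<union> F') \<subseteq> S"
  proof
    fix y assume "y \<in> linear_set (x + x') (F \<union> F')"
    then obtain y1 y2 where y: "y1 \<in> linear_set x F" "y2 \<in> linear_set x' F'" "y = y1 + y2"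
      using linear_set_Un by blast
    have "\<forall>i. y1 i mod m i = s1 i mod m i" "\<forall>i. y2 i mod m i = s2 i mod m i"
      using linear_set_cong[OF y(1) 1(4)] linear_set_cong[OF y(2) 2(4)] 1(3) 2(3) by auto
    then show "y \<in> S" using assms(3)[of y1 y2] y 1(5) 2(5) by blast
  qed
  moreover have "s \<in> linear_set (x + x') (F \<union> F')"
    using linear_set_plus[OF 1(4) 2(4)] assms(5) by simp
  moreover have "\<forall>f\<in>F \<union> F'. \<forall>i. m i dvd f i" using 1 2 by blast
  ultimately show ?thesis
    unfolding good_at_def using 1(1) 2(1) by (intro exI[of _ "x + x'"] exI[of _ "F \<union> F'"]) auto
qed

lemma good_at_mono: "good_at m M S s \<Longrightarrow> M \<le> M' \<Longrightarrow> S \<subseteq> S' \<Longrightarrow> good_at m M' S' s"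
  unfolding good_at_def
  by (elim exE conjE, rule_tac x = x in exI, rule_tac x = F in exI) (fastforce intro: order_trans)

lemma good_at_const:
  assumes "\<forall>i. s i \<le> M" "s \<in> S"
  shows "good_at m M S s"
proof -
  have "linear_set s {} = {s}" by (auto simp: linear_set_iff)
  then show ?thesis using assms unfolding good_at_def by (intro exI[of _ s] exI[of _ "{}"]) auto
qed

text \<open>Periods of a subset of \<open>S\<close> vanish wherever all members of \<open>S\<close> do, so that the divisibility
  requirement is void at these coordinates.\<close>

lemma good_at_change_modulus:
  assumes "good_at (\<lambda>_. 1) M S s" "\<And>y i. y \<in> S \<Longrightarrow> m i \<noteq> 1 \<Longrightarrow> y i = 0"
  shows "good_at m M S s"
proof -
  obtain x F where F: "finite F" "\<forall>i. x i \<le> M" "\<forall>f\<in>F. \<forall>i. f i \<le> M"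
      "s \<in> linear_set x F" "linear_set x F \<subseteq> S"
    using assms(1) by (auto simp: good_at_def)
  have "m i dvd f i" if "f \<in> F" for f i
  proof (cases "m i = 1")
    case False
    have "x + f \<in> S" using F(5) linear_set_add_period[OF linear_set_base that] by blast
    then have "(x + f) i = 0" using False by (rule assms(2))
    then show ?thesis by simp
  qed simp
  then show ?thesis unfolding good_at_def using F by (intro exI[of _ x] exI[of _ F]) auto
qed

section \<open>Reduced syllable lists in a free product\<close>

definition sval :: "('t \<times> 'l list) list \<Rightarrow> 'l list" where
  "sval W = concat (map snd W)"

lemma sval_simps [simp]:
  "sval [] = []" "sval (x # W) = snd x @ sval W" "sval (V @ W) = sval V @ sval W"
  by (simp_all add: sval_def)

locale free_pair = graph I for I :: "('a \<times> 'a) set" +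
  fixes B1 B2 :: "'a set"
  assumes disjoint: "B1 \<inter> B2 = {}"
    and no_edges: "(a, b) \<in> I \<Longrightarrow> \<not> (a \<in> B1 \<and> b \<in> B2) \<and> \<not> (a \<in> B2 \<and> b \<in> B1)"
begin

definition words :: "bool \<Rightarrow> ('a \<times> bool) list set" where
  "words t = {w. set w \<subseteq> (if t then B1 else B2) \<times> UNIV}"

lemma words_Nil [simp]: "[] \<in> words t"
  and words_append [simp]: "u @ v \<in> words t \<longleftrightarrow> u \<in> words t \<and> v \<in> words t"
  by (auto simp: words_def)

definition syls :: "(bool \<times> ('a \<times> bool) list) set" where
  "syls = {x. snd x \<in> words (fst x)}"

definition red :: "(bool \<times> ('a \<times> bool) list) list \<Rightarrow> bool" where
  "red N \<longleftrightarrow> (\<forall>x\<in>set N. \<not> triv (snd x)) \<and> successively (\<lambda>x y. fst x \<noteq> fst y) N"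

text \<open>Van der Waerden's argument: the letters act on reduced syllable lists, and the defining
  relations act trivially up to equality of the syllables in the group.\<close>

definition act where
  "act t w N = (case N of [] \<Rightarrow> if triv w then [] else [(t, w)]
     | x # R \<Rightarrow> if fst x = t then (if triv (w @ snd x) then R else (t, w @ snd x) # R)
               else if triv w then N else (t, w) # N)"

definition lact where
  "lact l N = (if fst l \<in> B1 then act True [l] N else if fst l \<in> B2 then act False [l] N else N)"

definition nf_eq (infix "\<simeq>" 50) where
  "N \<simeq> N' \<longleftrightarrow> list_all2 (\<lambda>x y. fst x = fst y \<and> snd x \<approx> snd y) N N'"

lemma nf_eq_refl [simp]: "N \<simeq> N"
  by (auto simp: nf_eq_def intro: list.rel_refl)

lemma nf_eq_sym: "N \<simeq> N' \<Longrightarrow> N' \<simeq> N"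
  unfolding nf_eq_def by (auto simp: list_all2_conv_all_nth eqv_sym)

lemma nf_eq_trans [trans]: "N \<simeq> N' \<Longrightarrow> N' \<simeq> N'' \<Longrightarrow> N \<simeq> N''"
  unfolding nf_eq_def by (rule list_all2_trans) (auto intro: eqv_trans)

lemma red_Nil [simp]: "red []"
  by (simp add: red_def)

lemma red_Cons: "red (x # N) \<longleftrightarrow> \<not> triv (snd x) \<and> (N \<noteq> [] \<longrightarrow> fst x \<noteq> fst (hd N)) \<and> red N"
  by (cases N) (auto simp: red_def)

lemma act_red: "red N \<Longrightarrow> red (act t w N)"
  by (cases N) (auto simp: act_def red_Cons)

lemma lact_red: "red N \<Longrightarrow> red (lact l N)"
  by (auto simp: lact_def act_red)

lemma act_cong:
  assumes "w \<approx> w'" "N \<simeq> N'"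
  shows "act t w N \<simeq> act t w' N'"
proof (cases N)
  case Nil
  then show ?thesis using assms eqv_triv[OF assms(1)] by (auto simp: act_def nf_eq_def)
next
  case (Cons x R)
  then obtain y R' where N': "N' = y # R'" "fst x = fst y" "snd x \<approx> snd y" "R \<simeq> R'"
    using assms(2) by (auto simp: nf_eq_def list_all2_Cons1)
  have e: "w @ snd x \<approx> w' @ snd y" using assms(1) N'(3) by (rule eqv_append)
  show ?thesis
    using N' assms e eqv_triv[OF e] eqv_triv[OF assms(1)] by (auto simp: Cons act_def nf_eq_def)
qed

lemma act_triv: "triv w \<Longrightarrow> red N \<Longrightarrow> act t w N \<simeq> N"
  by (cases N) (auto simp: act_def red_Cons triv_append_left nf_eq_def eqv_insert[of w "[]", simplified]
      intro: list.rel_refl)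

lemma act_append:
  assumes "red N"
  shows "act t (u @ v) N \<simeq> act t u (act t v N)"
proof (cases N)
  case Nil
  then show ?thesis
    by (auto simp: act_def triv_append_right nf_eq_def eqv_insert[of v u "[]", simplified])
next
  case (Cons x R)
  show ?thesis
  proof (cases "fst x = t")
    case True
    show ?thesis
    proof (cases "triv (v @ snd x)")
      case tr: True
      \<comment> \<open>Here \<open>v\<close> cancels the first syllable. Since \<open>N\<close> is
        reduced, \<open>R\<close> starts with the other type, so \<open>u\<close> is put in front of
        it, and it equals \<open>u @ v @ snd x\<close> in the group.\<close>
      have e: "u @ v @ snd x \<approx> u" using eqv_insert[OF tr, of u "[]"] by simp
      show ?thesis
        using assms True tr e eqv_triv[OF e]
        by (cases R) (auto simp: Cons act_def red_Cons nf_eq_def intro: list.rel_refl)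
    next
      case False
      then show ?thesis using True by (auto simp: Cons act_def)
    qed
  next
    case False
    then show ?thesis
      using assms
      by (auto simp: Cons act_def triv_append_right nf_eq_def eqv_insert[of v u "[]", simplified]
          intro: list.rel_refl)
  qed
qed

lemma foldr_lact_red: "red N \<Longrightarrow> red (foldr lact w N)"
  by (induction w) (auto intro: lact_red)

lemma foldr_lact_cong: "N \<simeq> N' \<Longrightarrow> foldr lact w N \<simeq> foldr lact w N'"
  by (induction w) (auto simp: lact_def act_cong)

lemma foldr_lact_eqv:
  assumes "u \<approx> v" "red N"
  shows "foldr lact u N \<simeq> foldr lact v N"
proof -
  have two: "act t [x] (act t [y] M) \<simeq> act t w M" if "[x, y] \<approx> w" "red M" for t x y w M
  proof -
    have "act t [x] (act t [y] M) \<simeq> act t ([x] @ [y]) M"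
      using act_append[OF that(2)] by (rule nf_eq_sym)
    also have "\<dots> \<simeq> act t w M" using that(1) by (intro act_cong) auto
    finally show ?thesis .
  qed
  show ?thesis
    using assms unfolding eqv_def
  proof (induction arbitrary: N rule: pres_cong.induct)
    case (sym u v)
    then show ?case by (auto intro: nf_eq_sym)
  next
    case (trans u v w)
    then show ?case by (blast intro: nf_eq_trans)
  next
    case (mult u u' v v')
    have "foldr lact u (foldr lact v N) \<simeq> foldr lact u (foldr lact v' N)"
      by (intro foldr_lact_cong mult)
    also have "\<dots> \<simeq> foldr lact u' (foldr lact v' N)"
      by (intro mult foldr_lact_red)
    finally show ?case by simp
  next
    case (cancel a b)
    have tr: "triv [(a, b), (a, \<not> b)]"
      unfolding eqv_def using cancel(1) by (rule pres_cong.cancel)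
    have "act t [(a, b)] (act t [(a, \<not> b)] N) \<simeq> N" for t
      using two[OF tr cancel(2)] act_triv[OF eqv_refl cancel(2)] by (rule nf_eq_trans)
    then show ?case by (auto simp: lact_def)
  next
    case (rel u v)
    then obtain a b where ab: "u = [(a, True), (b, True)]" "v = [(b, True), (a, True)]" "(a, b) \<in> I"
      by (auto simp: comm_rels_def)
    have uv: "u \<approx> v" unfolding eqv_def using rel by (intro pres_cong.rel) auto
    have "act t [(a, True)] (act t [(b, True)] N) \<simeq> act t [(b, True)] (act t [(a, True)] N)" for t
    proof -
      have "act t [(a, True)] (act t [(b, True)] N) \<simeq> act t v N"
        using uv rel(4) unfolding ab by (rule two)
      also have "\<dots> \<simeq> act t [(b, True)] (act t [(a, True)] N)"
        using act_append[OF rel(4), of t "[(b, True)]" "[(a, True)]"] by (simp add: ab)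
      finally show ?thesis .
    qed
    \<comment> \<open>By \<open>no_edges\<close> the two letters never act on different factors; a
      letter outside both factors acts as the identity.\<close>
    then show ?case using no_edges[OF ab(3)] by (auto simp: ab lact_def)
  qed simp
qed

lemma lact_word: "set [l] \<subseteq> (if t then B1 else B2) \<times> UNIV \<Longrightarrow> lact l N = act t [l] N"
  using disjoint by (auto simp: lact_def split: if_splits)

lemma foldr_lact_words:
  assumes "w \<in> words t" "red N"
  shows "foldr lact w N \<simeq> act t w N"
  using assms(1)
proof (induction w)
  case Nil
  then show ?case using act_triv[OF eqv_refl assms(2)] by (auto intro: nf_eq_sym)
next
  case (Cons l w)
  have "foldr lact (l # w) N = act t [l] (foldr lact w N)"
    using Cons.prems by (simp add: words_def lact_word)
  also have "\<dots> \<simeq> act t [l] (act t w N)"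
    using Cons by (intro act_cong) (auto simp: words_def)
  also have "\<dots> \<simeq> act t ([l] @ w) N" using act_append[OF assms(2)] by (rule nf_eq_sym)
  finally show ?case by simp
qed

lemma foldr_lact_sval:
  assumes "red N" "set N \<subseteq> syls"
  shows "foldr lact (sval N) [] \<simeq> N"
  using assms
proof (induction N)
  case (Cons x R)
  have R: "red R" "set R \<subseteq> syls" and x: "snd x \<in> words (fst x)"
    using Cons.prems by (auto simp: red_Cons syls_def)
  have "foldr lact (snd x) (foldr lact (sval R) []) \<simeq> foldr lact (snd x) R"
    using Cons.IH[OF R] by (rule foldr_lact_cong)
  also have "\<dots> \<simeq> act (fst x) (snd x) R" using x R(1) by (rule foldr_lact_words)
  also have "act (fst x) (snd x) R = x # R"
    using Cons.prems by (cases x; cases R) (auto simp: act_def red_Cons)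
  finally show ?case by simp
qed simp

text \<open>Acting with the letters of \<open>sval N\<close> on the empty list rebuilds
  \<open>N\<close>, whereas a trivial word acts as the identity.\<close>

theorem red_triv:
  assumes "red N" "set N \<subseteq> syls" "triv (sval N)"
  shows "N = []"
proof -
  have "N \<simeq> foldr lact (sval N) []" using foldr_lact_sval[OF assms(1,2)] by (rule nf_eq_sym)
  also have "\<dots> \<simeq> []" using foldr_lact_eqv[OF assms(3) red_Nil] by simp
  finally show ?thesis by (simp add: nf_eq_def)
qed

text \<open>One block of a noncrossing partition of the syllables: the syllables that are kept are its members,
  the trivial stretches between them are partitioned further.\<close>

inductive seg for t where
  seg_end: "triv (sval V) \<Longrightarrow> seg t [] V"
| seg_step: "triv (sval V) \<Longrightarrow> seg t k W \<Longrightarrow> seg t (a @ k) (V @ (t, a) # W)"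

text \<open>Only the outermost blocks are recorded, in order and with alternating types once
  \<open>N\<close> is reduced. Then \<open>N\<close> is the normal form of \<open>W\<close>, and the
  inside of trivial stretches stays unanalysed.\<close>

inductive decomp where
  decomp_Nil: "triv (sval V) \<Longrightarrow> decomp [] V"
| decomp_Cons: "seg t k V \<Longrightarrow> decomp N W \<Longrightarrow> decomp ((t, k) # N) (V @ W)"

lemma seg_eqv: "seg t k W \<Longrightarrow> sval W \<approx> k"
proof (induction rule: seg.induct)
  case (seg_step V k W a)
  have "sval V @ a @ sval W \<approx> a @ sval W" using eqv_insert[of "sval V" "[]"] seg_step by simp
  also have "\<dots> \<approx> a @ k" by (intro eqv_append seg_step) simp
  finally show ?case by simp
qed

lemma decomp_eqv: "decomp N W \<Longrightarrow> sval W \<approx> sval N"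
  by (induction rule: decomp.induct) (auto intro: eqv_append seg_eqv)

lemma seg_absorb_left: "seg t k W \<Longrightarrow> triv (sval U) \<Longrightarrow> seg t k (U @ W)"
proof (induction rule: seg.induct)
  case (seg_end V)
  then show ?case by (intro seg.seg_end) (simp add: triv_append_left)
next
  case (seg_step V k W a)
  then show ?case using seg.seg_step[of "U @ V" t k W a] by (simp add: triv_append_left)
qed

lemma seg_absorb_right: "seg t k W \<Longrightarrow> triv (sval U) \<Longrightarrow> seg t k (W @ U)"
proof (induction rule: seg.induct)
  case (seg_end V)
  then show ?case by (intro seg.seg_end) (simp add: triv_append_left)
next
  case (seg_step V k W a)
  then show ?case using seg.seg_step[of V t k "W @ U" a] by simp
qed

lemma decomp_absorb: "decomp N W \<Longrightarrow> triv (sval U) \<Longrightarrow> decomp N (U @ W)"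
proof (induction rule: decomp.induct)
  case (decomp_Nil V)
  then show ?case by (intro decomp.decomp_Nil) (simp add: triv_append_left)
next
  case (decomp_Cons t k V N W)
  then show ?case using decomp.decomp_Cons[OF seg_absorb_left] by fastforce
qed

text \<open>The normal form is built from the right. A new syllable starts a block or joins the
  first block of its own type; a block that becomes trivial is swallowed by the leading trivial
  stretch of what follows.\<close>

lemma decomp_exists:
  "set W \<subseteq> syls \<Longrightarrow> \<exists>N. red N \<and> set N \<subseteq> syls \<and> decomp N W"
proof (induction W)
  case Nil
  then show ?case by (intro exI[of _ "[]"]) (auto intro: decomp_Nil)
next
  case (Cons x W)
  obtain t a where x: "x = (t, a)" by force
  obtain N where N: "red N" "set N \<subseteq> syls" "decomp N W" using Cons by auto
  have a: "a \<in> words t" using Cons.prems by (auto simp: x syls_def)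
  have single: "seg t a [(t, a)]" using seg_step[of "[]" t "[]" "[]" a] by (simp add: seg_end)
  have new: ?case if "N \<noteq> [] \<longrightarrow> fst (hd N) \<noteq> t"
  proof (cases "triv a")
    case True
    then show ?thesis using decomp_absorb[OF N(3), of "[x]"] N x by auto
  next
    case False
    then show ?thesis
      using that N a decomp_Cons[OF single N(3)]
      by (intro exI[of _ "(t, a) # N"]) (auto simp: x red_Cons syls_def)
  qed
  show ?case
  proof (cases "N \<noteq> [] \<and> fst (hd N) = t")
    case True
    then obtain k R where NR: "N = (t, k) # R" by (cases N) auto
    obtain V V' where V: "seg t k V" "decomp R V'" "W = V @ V'"
      using N(3) unfolding NR by (auto elim: decomp.cases)
    have s: "seg t (a @ k) (x # V)" using seg_step[of "[]" t k V a] V(1) x by simp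
    show ?thesis
    proof (cases "triv (a @ k)")
      case True
      then have "triv (sval (x # V))" using seg_eqv[OF s] eqv_triv by blast
      then show ?thesis
        using decomp_absorb[OF V(2), of "x # V"] N by (intro exI[of _ R]) (auto simp: NR V(3) red_Cons)
    next
      case False
      then show ?thesis
        using N a decomp_Cons[OF s V(2)]
        by (intro exI[of _ "(t, a @ k) # R"]) (auto simp: NR V(3) red_Cons syls_def)
    qed
  qed (use new in blast)
qed

text \<open>The normal form of \<open>W\<close> must be cancelled by the single syllable
  \<open>a\<close>. So it is empty or one block of type \<open>t\<close>; in any other case a
  nonempty reduced list would have a trivial value.\<close>

theorem triv_Cons_seg:
  assumes "set W \<subseteq> syls" "a \<in> words t" "triv (a @ sval W)"
  shows "\<exists>k. seg t k W \<and> triv (a @ k)"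
proof -
  obtain N where N: "red N" "set N \<subseteq> syls" "decomp N W" using decomp_exists[OF assms(1)] by blast
  have tr: "triv (a @ sval N)"
    using eqv_triv[OF eqv_append[OF eqv_refl decomp_eqv[OF N(3)]]] assms(3) by blast
  show ?thesis
  proof (cases N)
    case Nil
    then have "triv (sval W)" using decomp_eqv[OF N(3)] by simp
    then show ?thesis using tr Nil by (intro exI[of _ "[]"]) (auto intro: seg_end)
  next
    case (Cons x R)
    have "fst x = t"
    proof (rule ccontr)
      assume ne: "fst x \<noteq> t"
      show False
      proof (cases "triv a")
        case True
        then have "triv (sval N)" using tr triv_append_left by blast
        then show False using red_triv N Cons by blast
      next
        case False
        then have "red ((t, a) # N)" using N(1) ne Cons by (auto simp: red_Cons)
        then show False using red_triv[of "(t, a) # N"] N assms(2) tr by (auto simp: syls_def)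
      qed
    qed
    then obtain k where x: "x = (t, k)" by (cases x) auto
    have ak: "triv (a @ k)"
    proof (rule ccontr)
      assume "\<not> triv (a @ k)"
      then have "red ((t, a @ k) # R)" using N(1) Cons x by (auto simp: red_Cons)
      then show False
        using red_triv[of "(t, a @ k) # R"] N assms(2) tr Cons x by (auto simp: syls_def)
    qed
    then have "triv (sval R)" using tr Cons x triv_append_left[of "a @ k"] by simp
    then have R: "R = []" using red_triv[of R] N Cons by (auto simp: red_Cons)
    obtain V V' where V: "seg t k V" "decomp R V'" "W = V @ V'"
      using N(3) unfolding Cons x by (auto elim: decomp.cases)
    have "triv (sval V')" using decomp_eqv[OF V(2)] R by simp
    then show ?thesis using seg_absorb_right[OF V(1)] ak V(3) by blast
  qed
qed

end

section \<open>Exponent equations as words of atoms\<close>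

text \<open>Constants and powers may follow each other in any order, so that equations can be cut
  and concatenated freely.\<close>

datatype 'l item = Con (iword: "'l list") | Var nat (iword: "'l list")

primrec ieval :: "(nat \<Rightarrow> nat) \<Rightarrow> 'l item \<Rightarrow> 'l list" where
  "ieval y (Con w) = w"
| "ieval y (Var i w) = wpow w (y i)"

primrec ivars :: "'l item \<Rightarrow> nat list" where
  "ivars (Con w) = []"
| "ivars (Var i w) = [i]"

definition eval :: "(nat \<Rightarrow> nat) \<Rightarrow> 'l item list \<Rightarrow> 'l list" where
  "eval y es = concat (map (ieval y) es)"

definition evars :: "'l item list \<Rightarrow> nat list" where
  "evars es = concat (map ivars es)"

text \<open>The summand 1 makes the size bound the number of items as well.\<close>

definition esize :: "'l item list \<Rightarrow> nat" where
  "esize es = (\<Sum>e\<leftarrow>es. length (iword e) + 1)"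

definition supported :: "nat list \<Rightarrow> (nat \<Rightarrow> nat) \<Rightarrow> bool" where
  "supported xs y \<longleftrightarrow> (\<forall>i. i \<notin> set xs \<longrightarrow> y i = 0)"

lemma eval_simps [simp]:
  "eval y [] = []" "eval y (e # es) = ieval y e @ eval y es" "eval y (es @ fs) = eval y es @ eval y fs"
  by (simp_all add: eval_def)

lemma evars_simps [simp]:
  "evars [] = []" "evars (e # es) = ivars e @ evars es" "evars (es @ fs) = evars es @ evars fs"
  by (simp_all add: evars_def)

lemma esize_simps [simp]:
  "esize [] = 0" "esize (e # es) = length (iword e) + 1 + esize es" "esize (es @ fs) = esize es + esize fs"
  by (simp_all add: esize_def)

lemma ieval_cong: "\<forall>i\<in>set (ivars e). y i = y' i \<Longrightarrow> ieval y e = ieval y' e"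
  by (cases e) auto

lemma eval_cong: "\<forall>i\<in>set (evars es). y i = y' i \<Longrightarrow> eval y es = eval y' es"
  by (induction es) (auto intro: ieval_cong)

lemma supported_plus: "supported xs y \<Longrightarrow> supported ys z \<Longrightarrow> set xs \<union> set ys \<subseteq> set zs \<Longrightarrow> supported zs (y + z)"
  by (auto simp: supported_def)

definition res :: "nat list \<Rightarrow> (nat \<Rightarrow> nat) \<Rightarrow> nat \<Rightarrow> nat" where
  "res xs s = (\<lambda>i. if i \<in> set xs then s i else 0)"

lemma res_in [simp]: "i \<in> set xs \<Longrightarrow> res xs s i = s i"
  and res_notin [simp]: "i \<notin> set xs \<Longrightarrow> res xs s i = 0"
  by (auto simp: res_def)

lemma supported_res [simp]: "supported xs (res xs s)"
  by (auto simp: supported_def)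

context graph
begin

definition sols :: "('a \<times> bool) item list \<Rightarrow> (nat \<Rightarrow> nat) set" where
  "sols es = {y. supported (evars es) y \<and> triv (eval y es)}"

text \<open>The inductive form of tameness: it speaks of words instead of group elements, of single
  solutions instead of representations, and modulus 1 imposes no divisibility.\<close>

definition tame_on :: "'a set \<Rightarrow> bool" where
  "tame_on B \<longleftrightarrow> (\<exists>p :: nat poly. \<forall>es. (\<forall>e\<in>set es. set (iword e) \<subseteq> B \<times> UNIV) \<longrightarrow> distinct (evars es) \<longrightarrow>
     (\<forall>y\<in>sols es. good_at (\<lambda>_. 1) (poly p (esize es)) (sols es) y))"

end

text \<open>The variable of a periodic atom \<open>Per i u a\<close> counts syllables, not periods: the atom stands for the
  stretch of length \<open>y i\<close> of the infinite word \<open>u u u \<dots>\<close> that starts at position \<open>a\<close>. Thus an atom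
  can be cut at any place, and the condition that the number of syllables is a multiple of the
  length of \<open>u\<close> is kept by letting all periods be such multiples.\<close>

datatype 'l atom = At bool "'l item" | Per nat "(bool \<times> 'l list) list" nat

definition per :: "'x list \<Rightarrow> nat \<Rightarrow> 'x" where
  "per us l = us ! (l mod length us)"

primrec ex :: "(nat \<Rightarrow> nat) \<Rightarrow> 'l atom \<Rightarrow> (bool \<times> 'l list) list" where
  "ex y (At t e) = [(t, ieval y e)]"
| "ex y (Per i us a) = map (per us) [a..<a + y i]"

primrec avars :: "'l atom \<Rightarrow> nat list" where
  "avars (At t e) = ivars e"
| "avars (Per i us a) = [i]"

text \<open>An equation of weight \<open>w\<close> will cost \<open>w - 3\<close> units of magnitude. Cutting at the members of a block uses up
  the ordinary atoms and duplicates the periodic ones; with weights 4 and 2 the pieces of a proper cut cost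
  less in total than the equation.\<close>

primrec awt :: "'l atom \<Rightarrow> nat" where
  "awt (At t e) = 4"
| "awt (Per i us a) = 2"

definition exs :: "(nat \<Rightarrow> nat) \<Rightarrow> 'l atom list \<Rightarrow> (bool \<times> 'l list) list" where
  "exs y as = concat (map (ex y) as)"

definition vars :: "'l atom list \<Rightarrow> nat list" where
  "vars as = concat (map avars as)"

definition wt :: "'l atom list \<Rightarrow> nat" where
  "wt as = sum_list (map awt as)"

lemma exs_simps [simp]:
  "exs y [] = []" "exs y (A # as) = ex y A @ exs y as" "exs y (as @ bs) = exs y as @ exs y bs"
  by (simp_all add: exs_def)

lemma vars_simps [simp]:
  "vars [] = []" "vars (A # as) = avars A @ vars as" "vars (as @ bs) = vars as @ vars bs"
  by (simp_all add: vars_def)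

lemma wt_simps [simp]:
  "wt [] = 0" "wt (A # as) = awt A + wt as" "wt (as @ bs) = wt as + wt bs"
  by (simp_all add: wt_def)

lemma wt_ge_2: "as \<noteq> [] \<Longrightarrow> wt as \<ge> 2"
  by (cases as; cases "hd as") auto

lemma ex_cong: "\<forall>i\<in>set (avars A). y i = y' i \<Longrightarrow> ex y A = ex y' A"
  by (cases A) (auto simp: ieval_cong)

lemma exs_cong: "\<forall>i\<in>set (vars as). y i = y' i \<Longrightarrow> exs y as = exs y' as"
proof (induction as)
  case (Cons A as)
  then show ?case using ex_cong[of A y y'] by auto
qed simp

lemma per_shift:
  assumes "a mod length us = b mod length us"
  shows "map (per us) [a..<a + n] = map (per us) [b..<b + n]"
proof (rule nth_equalityI)
  fix i assume "i < length (map (per us) [a..<a + n])"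
  moreover have "(a + i) mod length us = (b + i) mod length us"
    using assms by (rule mod_add_cong) simp
  ultimately show "map (per us) [a..<a + n] ! i = map (per us) [b..<b + n] ! i"
    by (simp add: per_def)
qed simp

text \<open>A syllable of the expanded word is an entire ordinary atom or lies at offset
  \<open>l\<close> in a periodic stretch, whose variable then splits as
  \<open>l + 1 + (s i - l - 1)\<close>.\<close>

lemma exs_split:
  assumes "exs s as = v @ (t, a) # W"
  shows "(\<exists>as1 e as2. as = as1 @ At t e # as2 \<and> a = ieval s e \<and> v = exs s as1 \<and> W = exs s as2) \<or>
    (\<exists>as1 i us b as2 l. as = as1 @ Per i us b # as2 \<and> l < s i \<and> (t, a) = per us (b + l) \<and>
       v = exs s as1 @ map (per us) [b..<b + l] \<and> W = map (per us) [b + l + 1..<b + s i] @ exs s as2)"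
  using assms
proof (induction as arbitrary: v)
  case (Cons A as)
  obtain u where u: "ex s A = v @ u \<and> u @ exs s as = (t, a) # W \<or> v = ex s A @ u \<and> exs s as = u @ (t, a) # W"
    using Cons.prems unfolding exs_simps append_eq_append_conv2 by metis
  consider v' where "v = ex s A @ v'" "exs s as = v' @ (t, a) # W"
    | W' where "ex s A = v @ (t, a) # W'" "W = W' @ exs s as"
  proof (cases u)
    case Nil
    then show ?thesis using u that(1)[of "[]"] by auto
  next
    case (Cons x u')
    then show ?thesis using u that by auto
  qed
  then show ?case
  proof cases
    case 1
    from Cons.IH[OF 1(2)] show ?thesis
    proof (elim disjE exE conjE)
      fix as1 e as2
      assume "as = as1 @ At t e # as2" "a = ieval s e" "v' = exs s as1" "W = exs s as2"
      then show ?thesis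
        using 1(1) by (intro disjI1 exI[of _ "A # as1"] exI[of _ e] exI[of _ as2]) auto
    next
      fix as1 i us b as2 l
      assume "as = as1 @ Per i us b # as2" "l < s i" "(t, a) = per us (b + l)"
        "v' = exs s as1 @ map (per us) [b..<b + l]" "W = map (per us) [b + l + 1..<b + s i] @ exs s as2"
      then show ?thesis
        using 1(1) by (intro disjI2 exI[of _ "A # as1"] exI[of _ i] exI[of _ us] exI[of _ b]
            exI[of _ as2] exI[of _ l]) auto
    qed
  next
    case 2
    show ?thesis
    proof (cases A)
      case (At t' e)
      then show ?thesis
        using 2 by (intro disjI1 exI[of _ "[]"] exI[of _ e] exI[of _ as]) (auto simp: Cons_eq_append_conv)
    next
      case (Per i us b)
      let ?l = "length v"
      have eq: "map (per us) [b..<b + s i] = v @ (t, a) # W'" using 2 Per by simp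
      have l: "?l < s i" using arg_cong[OF eq, of length] by simp
      have "v = map (per us) [b..<b + ?l]"
        using arg_cong[OF eq, of "take ?l"] l by (simp add: take_map)
      moreover have "(t, a) = per us (b + ?l)"
        using arg_cong[OF eq, of "\<lambda>x. x ! ?l"] l by simp
      moreover have "W' = map (per us) [b + ?l + 1..<b + s i]"
        using arg_cong[OF eq, of "drop (?l + 1)"] l by (simp add: drop_map)
      ultimately show ?thesis
        using 2(2) l Per by (intro disjI2 exI[of _ "[]"] exI[of _ i] exI[of _ us] exI[of _ b]
            exI[of _ as] exI[of _ ?l]) auto
    qed
  qed
qed simp

definition unit :: "nat \<Rightarrow> nat \<Rightarrow> nat" where
  "unit i = (\<lambda>j. if j = i then 1 else 0)"

lemma good_at_shift:
  assumes "good_at m M S s" "\<forall>i. d i \<le> D" "M + D \<le> M'" "\<And>y. y \<in> S \<Longrightarrow> \<forall>i. y i mod m i = s i mod m i \<Longrightarrow> y + d \<in> S'"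
    "s' = s + d"
  shows "good_at m M' S' s'"
proof (rule good_at_plus[OF assms(1)])
  show "good_at m D {d} d" using assms(2) by (intro good_at_const) auto
  show "M + D \<le> M'" by fact
  show "s' = s + d" by fact
  fix y1 y2 assume "y1 \<in> S" "y2 \<in> {d}" "\<forall>i. y1 i mod m i = s i mod m i"
  then show "y1 + y2 \<in> S'" using assms(4) by blast
qed

section \<open>Cutting an equation at one syllable\<close>

context free_pair
begin

text \<open>Quantifying over all positions of the infinite word makes the types alternate also
  across the border between two copies of \<open>us\<close>, so every infix is reduced.\<close>

definition cycred :: "(bool \<times> ('a \<times> bool) list) list \<Rightarrow> bool" where
  "cycred us \<longleftrightarrow> length us \<ge> 2 \<and> set us \<subseteq> syls \<and> (\<forall>x\<in>set us. \<not> triv (snd x)) \<and>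
     (\<forall>l. fst (per us l) \<noteq> fst (per us (Suc l)))"

lemma per_in: "us \<noteq> [] \<Longrightarrow> per us l \<in> set us"
  by (auto simp: per_def)

lemma cycred_red: "cycred us \<Longrightarrow> red (map (per us) [a..<b])"
proof (induction "b - a" arbitrary: a)
  case (Suc n)
  have "a < b" using Suc.hyps(2) by simp
  then have eq: "[a..<b] = a # [Suc a..<b]" by (rule upt_conv_Cons)
  have us: "us \<noteq> []" and nt: "\<And>x. x \<in> set us \<Longrightarrow> \<not> triv (snd x)"
    using Suc.prems unfolding cycred_def by fastforce+
  have "red (map (per us) [Suc a..<b])" using Suc.hyps Suc.prems by simp
  moreover have "\<not> triv (snd (per us a))" using nt per_in[OF us] .
  moreover have "fst (per us a) \<noteq> fst (hd (map (per us) [Suc a..<b]))" if "Suc a < b"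
    unfolding upt_conv_Cons[OF that] list.map list.sel using Suc.prems unfolding cycred_def by blast
  ultimately show ?case by (simp add: eq red_Cons)
qed simp

text \<open>This is why a periodic stretch contributes at most one syllable to a block: between two
  members there would be a nonempty trivial infix, or the members would be neighbours of different
  types.\<close>

lemma cycred_triv:
  assumes "cycred us" "triv (sval (map (per us) [a..<b]))"
  shows "b \<le> a"
proof -
  have "us \<noteq> []" "set us \<subseteq> syls" using assms(1) unfolding cycred_def by fastforce+
  then have "set (map (per us) [a..<b]) \<subseteq> syls"
    using per_in[of us] by auto
  then have "map (per us) [a..<b] = []"
    using red_triv cycred_red[OF assms(1)] assms(2) by blast
  then show ?thesis by auto
qed

text \<open>\<open>Z\<close> holds the members of the current block that have been passed already;
  \<open>as\<close> is the part of the equation to the right of them.\<close>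

definition bsols :: "('a \<times> bool) item list \<Rightarrow> ('a \<times> bool) atom list \<Rightarrow> (nat \<Rightarrow> nat) set" where
  "bsols Z as = {y. supported (evars Z @ vars as) y \<and> triv (eval y Z @ sval (exs y as))}"

text \<open>The next member of the block is the ordinary atom \<open>e\<close>. The stretch
  \<open>as1\<close> before it is trivial by itself and has its own variables, so it is split off,
  and \<open>e\<close> moves into \<open>Z\<close>.\<close>

lemma good_at_At:
  assumes "good_at m M1 (bsols [] as1) (res (vars as1) s)"
    and "good_at m M2 (bsols (Z @ [e]) as2) (res (evars Z @ ivars e @ vars as2) s)"
    and "M1 + M2 \<le> M" "distinct (evars Z @ vars (as1 @ At t e # as2))"
    and "supported (evars Z @ vars (as1 @ At t e # as2)) s"
  shows "good_at m M (bsols Z (as1 @ At t e # as2)) s"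
proof (rule good_at_plus[OF assms(1,2) _ assms(3)])
  show "s = res (vars as1) s + res (evars Z @ ivars e @ vars as2) s"
    using assms(4,5) by (auto simp: supported_def res_def fun_eq_iff)
  fix y1 y2 assume y: "y1 \<in> bsols [] as1" "y2 \<in> bsols (Z @ [e]) as2"
  let ?y = "y1 + y2"
  have 1: "exs ?y as1 = exs y1 as1"
    using y(2) assms(4) by (intro exs_cong) (auto simp: bsols_def supported_def)
  have "?y i = y2 i" if "i \<in> set (evars Z @ ivars e @ vars as2)" for i
    using that y(1) assms(4) by (auto simp: bsols_def supported_def)
  then have 2: "exs ?y as2 = exs y2 as2" "eval ?y Z = eval y2 Z" "ieval ?y e = ieval y2 e"
    by (intro exs_cong eval_cong ieval_cong ballI; simp)+
  have "triv (sval (exs y1 as1))" "triv (eval y2 Z @ ieval y2 e @ sval (exs y2 as2))"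
    using y by (auto simp: bsols_def)
  then have "triv (eval y2 Z @ sval (exs y1 as1) @ ieval y2 e @ sval (exs y2 as2))"
    by (simp add: triv_insert)
  moreover have "supported (evars Z @ vars (as1 @ At t e # as2)) ?y"
    using y by (intro supported_plus) (auto simp: bsols_def)
  ultimately show "?y \<in> bsols Z (as1 @ At t e # as2)"
    by (simp add: bsols_def 1 2)
qed

text \<open>The next member is the syllable at offset \<open>l\<close> of a periodic atom. Both
  pieces keep the variable \<open>i\<close>. Replacing \<open>l\<close> by a congruent count leaves
  the cut syllable and the phase of the right stretch unchanged; this is where the modulus
  enters.\<close>

lemma good_at_Per:
  assumes "good_at m M1 (bsols [] (as1 @ [Per i us b])) ((res (vars as1) s)(i := l))"
    and "good_at m M2 (bsols (Z @ [Con a]) (Per i us (b + l + 1) # as2))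
           ((res (evars Z @ vars as2) s)(i := s i - l - 1))"
    and "M1 + M2 + 1 \<le> M" "distinct (evars Z @ vars (as1 @ Per i us b # as2))"
    and "supported (evars Z @ vars (as1 @ Per i us b # as2)) s"
    and "l < s i" "(t, a) = per us (b + l)" "m i = length us"
  shows "good_at m M (bsols Z (as1 @ Per i us b # as2)) s"
proof -
  let ?S1 = "bsols [] (as1 @ [Per i us b])"
  let ?S2 = "bsols (Z @ [Con a]) (Per i us (b + l + 1) # as2)"
  \<comment> \<open>The unit vector restores the cut syllable in the count of \<open>i\<close>; it
    costs the 1 in the bound.\<close>
  have 0: "good_at m (M2 + 1) ((\<lambda>y. y + unit i) ` ?S2) ((res (evars Z @ vars as2) s)(i := s i - l - 1) + unit i)"
    by (rule good_at_shift[OF assms(2), of "unit i" 1]) (auto simp: unit_def)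
  show ?thesis
  proof (rule good_at_plus[OF assms(1) 0])
    show "M1 + (M2 + 1) \<le> M" using assms(3) by simp
    show "s = (res (vars as1) s)(i := l) + ((res (evars Z @ vars as2) s)(i := s i - l - 1) + unit i)"
      using assms(4,5,6) by (auto simp: supported_def res_def fun_eq_iff unit_def)
    fix y1 y2' assume y: "y1 \<in> ?S1" "y2' \<in> (\<lambda>y. y + unit i) ` ?S2"
      and "\<forall>j. y1 j mod m j = ((res (vars as1) s)(i := l)) j mod m j"
    then have mod: "y1 i mod length us = l mod length us" using assms(8) by (auto dest: spec[of _ i])
    obtain y2 where y2: "y2 \<in> ?S2" "y2' = y2 + unit i" using y by blast
    let ?y = "y1 + y2'"
    have 1: "exs ?y as1 = exs y1 as1"
      using y2 assms(4) by (intro exs_cong) (auto simp: bsols_def supported_def unit_def)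
    have "?y j = y2 j" if "j \<in> set (evars Z @ vars as2)" for j
      using that y(1) assms(4) by (auto simp: bsols_def supported_def y2(2) unit_def)
    then have 2: "exs ?y as2 = exs y2 as2" "eval ?y Z = eval y2 Z"
      by (intro exs_cong eval_cong ballI; simp)+
    have yi: "?y i = y1 i + (1 + y2 i)" by (simp add: y2 unit_def)
    have "ex ?y (Per i us b) = map (per us) [b..<b + y1 i] @ map (per us) [b + y1 i..<(b + y1 i) + (1 + y2 i)]"
      using upt_add_eq_append[of b "b + y1 i" "1 + y2 i"]
      unfolding ex.simps yi map_append[symmetric] by (simp only: add.assoc le_add1)
    also have "map (per us) [b + y1 i..<(b + y1 i) + (1 + y2 i)] = map (per us) [b + l..<(b + l) + (1 + y2 i)]"
      using mod by (intro per_shift mod_add_cong) auto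
    also have "\<dots> = (t, a) # map (per us) [b + l + 1..<b + l + 1 + y2 i]"
      using assms(7) by (simp add: upt_conv_Cons del: upt_Suc)
    finally have 3: "ex ?y (Per i us b) = map (per us) [b..<b + y1 i] @ (t, a) # map (per us) [b + l + 1..<b + l + 1 + y2 i]" .
    have t1: "triv (sval (exs y1 as1) @ sval (map (per us) [b..<b + y1 i]))"
      and t2: "triv (eval y2 Z @ a @ sval (map (per us) [b + l + 1..<b + l + 1 + y2 i]) @ sval (exs y2 as2))"
      using y(1) y2(1) by (auto simp: bsols_def)
    have "triv (eval y2 Z @ (sval (exs y1 as1) @ sval (map (per us) [b..<b + y1 i])) @
        (a @ sval (map (per us) [b + l + 1..<b + l + 1 + y2 i]) @ sval (exs y2 as2)))"
      unfolding triv_insert[OF t1] by (rule t2)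
    moreover have "supported (evars Z @ vars (as1 @ Per i us b # as2)) ?y"
      using y(1) y2 by (auto simp: bsols_def supported_def unit_def)
    ultimately show "?y \<in> bsols Z (as1 @ Per i us b # as2)"
      unfolding bsols_def mem_Collect_eq exs_simps 1 2 3 sval_simps by simp
  qed
qed

end

lemma exs_res: "set (vars as) \<subseteq> set xs \<Longrightarrow> exs (res xs s) as = exs s as"
  by (rule exs_cong) auto

lemma eval_res: "set (evars es) \<subseteq> set xs \<Longrightarrow> eval (res xs s) es = eval s es"
  by (rule eval_cong) auto

lemma exs_upd: "i \<notin> set (vars as) \<Longrightarrow> exs (s(i := l)) as = exs s as"
  by (rule exs_cong) auto

section \<open>The induction on the weight\<close>

text \<open>\<open>N\<close> bounds the size of an atom, \<open>Wt\<close> the weight of an equation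
  and \<open>n\<close> the size of a block, which has few members because each uses up weight.
  \<open>P\<close> is the magnitude allowed for a block, \<open>L\<close> bounds a common period of
  two periodic atoms, and by \<open>slack\<close> one \<open>C\<close> covers all of these.\<close>

locale free_core = free_pair I B1 B2 for I :: "('a \<times> 'a) set" and B1 B2 +
  fixes m :: "nat \<Rightarrow> nat" and N n P C Wt L :: nat
  assumes tame_factor: "(\<forall>e\<in>set es. iword e \<in> words t) \<Longrightarrow> distinct (evars es) \<Longrightarrow> esize es \<le> n \<Longrightarrow>
      y \<in> sols es \<Longrightarrow> good_at (\<lambda>_. 1) P (sols es) y"
    and size_bound: "N * (Wt + 2) \<le> n"
    and slack: "P + Wt + 1 + L \<le> C"
    and run_period: "m i * m j \<le> L"
begin

primrec ok :: "('a \<times> bool) atom \<Rightarrow> bool" where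
  "ok (At t e) \<longleftrightarrow> iword e \<in> words t \<and> length (iword e) + 1 \<le> N \<and> (\<forall>i\<in>set (ivars e). m i = 1)"
| "ok (Per i us a) \<longleftrightarrow> m i = length us \<and> cycred us \<and> (\<forall>x\<in>set us. length (snd x) + 1 \<le> N)"

text \<open>The truncated subtraction is harmless: a list of weight below 4 is empty or a single
  periodic atom, and only the zero vector solves it.\<close>

definition solved_upto :: "nat \<Rightarrow> bool" where
  "solved_upto w \<longleftrightarrow> (\<forall>as s. wt as \<le> w \<longrightarrow> (\<forall>A\<in>set as. ok A) \<longrightarrow> distinct (vars as) \<longrightarrow>
     s \<in> bsols [] as \<longrightarrow> good_at m (C * (wt as - 3)) (bsols [] as) s)"

lemma solved_uptoD:
  "solved_upto w \<Longrightarrow> wt as \<le> w \<Longrightarrow> \<forall>A\<in>set as. ok A \<Longrightarrow> distinct (vars as) \<Longrightarrow>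
     s \<in> bsols [] as \<Longrightarrow> good_at m (C * (wt as - 3)) (bsols [] as) s"
  by (simp add: solved_upto_def)

lemma solved_upto_mono: "solved_upto w \<Longrightarrow> w' \<le> w \<Longrightarrow> solved_upto w'"
  by (auto simp: solved_upto_def)

text \<open>\<open>Z\<close> collects the members of type \<open>t\<close> that a block has so far. The flag says that the last one
  was cut off the periodic atom at the head of \<open>as\<close>; then this atom cannot contribute again.\<close>

definition blk where
  "blk t k Z as s fl \<longleftrightarrow> triv (eval s Z @ k) \<and>
     (\<forall>e\<in>set Z. iword e \<in> words t \<and> (\<forall>i\<in>set (ivars e). m i = 1)) \<and> (\<forall>A\<in>set as. ok A) \<and>
     distinct (evars Z @ vars as) \<and> supported (evars Z @ vars as) s \<and>
     esize Z + N * (wt as + (if fl then 0 else 1)) \<le> n \<and>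
     (fl \<longrightarrow> (\<exists>i us b as'. as = Per i us b # as' \<and> fst (per us b) \<noteq> t))"

lemma ok_Per_per:
  assumes "ok (Per i us a)"
  shows "snd (per us l) \<in> words (fst (per us l))" "length (snd (per us l)) + 1 \<le> N"
    "\<not> triv (snd (per us l))" "fst (per us (l + 1)) \<noteq> fst (per us l)" "0 < m i" "m i = length us"
    "cycred us"
proof -
  have us: "us \<noteq> []" using assms unfolding ok.simps cycred_def by fastforce
  note in_us = per_in[OF us, of l]
  show "snd (per us l) \<in> words (fst (per us l))" "\<not> triv (snd (per us l))"
    using assms in_us unfolding ok.simps cycred_def syls_def by blast+
  show "length (snd (per us l)) + 1 \<le> N" "0 < m i" "m i = length us" "cycred us"
    using assms in_us us unfolding ok.simps by auto
  have "fst (per us l) \<noteq> fst (per us (Suc l))" using assms unfolding ok.simps cycred_def by blast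
  then show "fst (per us (l + 1)) \<noteq> fst (per us l)" by auto
qed

lemma blk_At:
  assumes "blk t (a @ k) Z (as1 @ At t e # as2) s fl" "a = ieval s e"
  shows "blk t k (Z @ [e]) as2 (res (evars Z @ ivars e @ vars as2) s) False"
proof -
  have *: "eval (res (evars Z @ ivars e @ vars as2) s) Z = eval s Z"
    "ieval (res (evars Z @ ivars e @ vars as2) s) e = ieval s e"
    by (auto intro: eval_res ieval_cong)
  have ok: "ok (At t e)" using assms(1) by (auto simp: blk_def)
  have "esize Z + N * (wt (as1 @ At t e # as2) + (if fl then 0 else 1)) \<le> n"
    using assms(1) by (simp add: blk_def)
  moreover have "N * (2 + wt as2) \<le> N * (wt (as1 @ At t e # as2) + (if fl then 0 else 1))"
    by (rule mult_le_mono2) simp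
  ultimately have "esize (Z @ [e]) + N * (wt as2 + 1) \<le> n" using ok by simp
  moreover have "supported (evars (Z @ [e]) @ vars as2) (res (evars Z @ ivars e @ vars as2) s)"
    by (auto simp: supported_def)
  ultimately show ?thesis
    using assms ok unfolding blk_def by (simp add: *) blast
qed

lemma blk_Per:
  assumes "blk t (a @ k) Z (as1 @ Per i us b # as2) s fl" "(t, a) = per us (b + l)" "fl \<longrightarrow> as1 \<noteq> []"
  shows "blk t k (Z @ [Con a]) (Per i us (b + l + 1) # as2)
    ((res (evars Z @ vars as2) s)(i := s i - l - 1)) True"
proof -
  let ?s = "(res (evars Z @ vars as2) s)(i := s i - l - 1)"
  have ok: "ok (Per i us b)" and i: "i \<notin> set (evars Z)" using assms(1) by (auto simp: blk_def)
  have *: "eval ((res (evars Z @ vars as2) s)(i := c)) Z = eval s Z" for c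
    using i by (auto intro: eval_cong)
  have "esize Z + N * (wt (as1 @ Per i us b # as2) + (if fl then 0 else 1)) \<le> n"
    using assms(1) by (simp add: blk_def)
  moreover have "N * (wt as2 + 3) \<le> N * (wt (as1 @ Per i us b # as2) + (if fl then 0 else 1))"
    by (rule mult_le_mono2) (use assms(3) wt_ge_2[of as1] in auto)
  moreover have "length a + 1 \<le> N" "a \<in> words t"
    using ok_Per_per(1,2)[OF ok, of "b + l"] unfolding assms(2)[symmetric] by auto
  moreover have "fst (per us (b + l + 1)) \<noteq> t"
    using ok_Per_per(4)[OF ok, of "b + l"] unfolding assms(2)[symmetric] by simp
  moreover have "supported (evars Z @ vars (Per i us (b + l + 1) # as2)) ?s"
    by (auto simp: supported_def)
  ultimately show ?thesis
    using assms(1) ok unfolding blk_def by (auto simp: * simp del: ok.simps) (auto simp: algebra_simps)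
qed

text \<open>If the head atom contributed again, the stretch before its new member would be a trivial
  infix of a periodic word, hence empty; but the syllable at the head has the wrong type.\<close>

lemma Per_prefix_nonempty:
  assumes "as1 @ Per i us b # as2 = Per j vs c # as'" "fst (per vs c) \<noteq> t" "ok (Per i us b)"
    and "(t, a) = per us (b + l)" "triv (sval (exs s as1 @ map (per us) [b..<b + l]))"
  shows "as1 \<noteq> []"
proof
  assume "as1 = []"
  then have eq: "us = vs" "b = c" using assms(1) by auto
  have "triv (sval (map (per us) [b..<b + l]))" using assms(5) \<open>as1 = []\<close> by simp
  then have "b + l \<le> b" by (rule cycred_triv[OF ok_Per_per(7)[OF assms(3)]])
  then have "l = 0" by simp
  then have "per us b = (t, a)" using assms(4) by simp
  then show False using assms(2) unfolding eq by simp
qed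

lemma bsols_res:
  assumes "triv (sval (exs s as))"
  shows "res (vars as) s \<in> bsols [] as"
  using assms by (simp add: bsols_def exs_res)

lemma bsols_res_Per:
  assumes "triv (sval (exs s as @ map (per us) [b..<b + l]))" "i \<notin> set (vars as)"
  shows "(res (vars as) s)(i := l) \<in> bsols [] (as @ [Per i us b])"
  using assms by (auto simp: bsols_def exs_upd exs_res supported_def)

text \<open>\<open>P\<close> pays for the equation of the block, the middle summand for one unit per
  member cut off a periodic atom, and the multiple of \<open>C\<close> for the stretches between
  members. With the flag set the next cut is not at the head atom, and the offset 3 can be
  kept.\<close>

lemma block_good:
  assumes "seg t k W" "W = exs s as" "blk t k Z as s fl" "solved_upto (wt as)"
  shows "good_at m (P + (wt as + (if fl then 0 else 1)) + C * (if fl then wt as - 3 else wt as)) (bsols Z as) s"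
  using assms
proof (induction arbitrary: Z as s fl rule: seg.induct)
  case (seg_end V)
  note b = seg_end.prems(2)[unfolded blk_def]
  let ?s1 = "res (evars Z) s" and ?s2 = "res (vars as) s"
  have Z1: "\<forall>e\<in>set Z. \<forall>i\<in>set (ivars e). m i = 1" using b by auto
  have "?s1 \<in> sols Z" using b by (simp add: sols_def eval_res)
  then have "good_at (\<lambda>_. 1) P (sols Z) ?s1"
    using b by (intro tame_factor[where t = t]) (auto intro: le_trans[OF le_add1])
  \<comment> \<open>Variables inside \<open>Z\<close> come from ordinary atoms, where
    \<open>m\<close> is 1; all other coordinates vanish on \<open>sols Z\<close>.\<close>
  then have 1: "good_at m P (sols Z) ?s1"
  proof (rule good_at_change_modulus)
    fix y i assume "y \<in> sols Z" "m i \<noteq> 1"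
    moreover from this(2) have "i \<notin> set (evars Z)" using Z1 by (auto simp: evars_def)
    ultimately show "y i = 0" by (simp add: sols_def supported_def)
  qed
  have "?s2 \<in> bsols [] as" using seg_end.hyps seg_end.prems(1) by (intro bsols_res) simp
  then have 2: "good_at m (C * (wt as - 3)) (bsols [] as) ?s2"
    using b seg_end.prems(3) by (intro solved_uptoD[OF seg_end.prems(3)]) auto
  show ?case
  proof (rule good_at_plus[OF 1 2])
    show "s = ?s1 + ?s2" using b by (auto simp: supported_def res_def fun_eq_iff)
    show "P + C * (wt as - 3) \<le> P + (wt as + (if fl then 0 else 1)) + C * (if fl then wt as - 3 else wt as)"
      by (simp add: trans_le_add2)
    fix y1 y2 assume y: "y1 \<in> sols Z" "y2 \<in> bsols [] as"
    have "eval (y1 + y2) Z = eval y1 Z"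
      using y b by (intro eval_cong) (auto simp: bsols_def supported_def)
    moreover have "exs (y1 + y2) as = exs y2 as"
      using y b by (intro exs_cong) (auto simp: sols_def supported_def)
    moreover have "supported (evars Z @ vars as) (y1 + y2)"
      using y by (intro supported_plus) (auto simp: sols_def bsols_def)
    ultimately show "y1 + y2 \<in> bsols Z as"
      using y by (simp add: sols_def bsols_def triv_append_left)
  qed
next
  case (seg_step V k W a)
  note b = seg_step.prems(2)[unfolded blk_def]
  from exs_split[OF seg_step.prems(1)[symmetric]] show ?case
  proof (elim disjE exE conjE)
    fix as1 e as2
    assume as: "as = as1 @ At t e # as2" and a: "a = ieval s e" and V: "V = exs s as1" and W: "W = exs s as2"
    let ?s2 = "res (evars Z @ ivars e @ vars as2) s"
    have "good_at m (C * (wt as1 - 3)) (bsols [] as1) (res (vars as1) s)"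
      using seg_step.hyps(1) b as V
      by (intro solved_uptoD[OF seg_step.prems(3)] bsols_res) auto
    moreover have "exs ?s2 as2 = exs s as2" by (rule exs_res) auto
    then have "good_at m (P + (wt as2 + 1) + C * wt as2) (bsols (Z @ [e]) as2) ?s2"
      using seg_step.IH[of ?s2 as2 "Z @ [e]" False] blk_At[OF seg_step.prems(2)[unfolded as] a]
        solved_upto_mono[OF seg_step.prems(3)]
      by (simp add: W as)
    moreover have "C * (wt as1 - 3) + (P + (wt as2 + 1) + C * wt as2)
        \<le> P + (wt as + (if fl then 0 else 1)) + C * (if fl then wt as - 3 else wt as)"
    proof -
      have "fl \<longrightarrow> as1 \<noteq> []" using b as by (cases as1) auto
      \<comment> \<open>The ordinary atom takes its weight 4 out of the list, which outweighs the
        offset 3 even if \<open>wt as1 - 3\<close> is truncated.\<close>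
      then have "C * (wt as1 - 3 + wt as2) \<le> C * (if fl then wt as - 3 else wt as)"
        using wt_ge_2[of as1] as by (intro mult_le_mono2) auto
      then show ?thesis using as by (simp add: distrib_left)
    qed
    ultimately show ?case unfolding as using b as by (intro good_at_At) auto
  next
    fix as1 i us c as2 l
    assume as: "as = as1 @ Per i us c # as2" and l: "l < s i" and a: "(t, a) = per us (c + l)"
      and V: "V = exs s as1 @ map (per us) [c..<c + l]"
      and W: "W = map (per us) [c + l + 1..<c + s i] @ exs s as2"
    let ?s2 = "(res (evars Z @ vars as2) s)(i := s i - l - 1)"
    have i: "i \<notin> set (vars as1)" "i \<notin> set (vars as2)" and ok: "ok (Per i us c)" using b as by auto
    have ne: "fl \<longrightarrow> as1 \<noteq> []"
      using b as Per_prefix_nonempty[OF _ _ ok a] seg_step.hyps(1) V by metis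
    have g1: "good_at m (C * (wt (as1 @ [Per i us c]) - 3)) (bsols [] (as1 @ [Per i us c])) ((res (vars as1) s)(i := l))"
      using seg_step.hyps(1) b as V i
      by (intro solved_uptoD[OF seg_step.prems(3)] bsols_res_Per) auto
    have g2: "good_at m (P + (2 + wt as2) + C * (2 + wt as2 - 3))
        (bsols (Z @ [Con a]) (Per i us (c + l + 1) # as2)) ?s2"
    proof -
      have "c + l + 1 + (s i - l - 1) = c + s i" using l by simp
      then have W': "W = exs ?s2 (Per i us (c + l + 1) # as2)"
        using i by (simp add: W exs_res exs_upd del: upt_Suc)
      have "solved_upto (wt (Per i us (c + l + 1) # as2))"
        by (rule solved_upto_mono[OF seg_step.prems(3)]) (simp add: as)
      from seg_step.IH[OF W' blk_Per[OF seg_step.prems(2)[unfolded as] a ne] this]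
      show ?thesis by (simp only: if_True add_0_right wt_simps awt.simps)
    qed
    have le: "C * (wt (as1 @ [Per i us c]) - 3) + (P + (2 + wt as2) + C * (2 + wt as2 - 3)) + 1
        \<le> P + (wt as + (if fl then 0 else 1)) + C * (if fl then wt as - 3 else wt as)"
    proof -
      \<comment> \<open>The weights of the pieces add up to \<open>wt as + 2\<close>. With the flag
        set \<open>as1\<close> weighs at least 2; if \<open>as2\<close> is empty, the right piece is
        a single periodic atom and costs nothing.\<close>
      have "C * ((wt (as1 @ [Per i us c]) - 3) + (2 + wt as2 - 3)) \<le> C * (if fl then wt as - 3 else wt as)"
      proof (rule mult_le_mono2)
        have "wt as = wt as1 + 2 + wt as2" "wt (as1 @ [Per i us c]) = wt as1 + 2" using as by auto
        moreover have "fl \<longrightarrow> 2 \<le> wt as1" using wt_ge_2[of as1] ne by blast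
        moreover have "wt as2 = 0 \<or> 2 \<le> wt as2" using wt_ge_2[of as2] by (cases "as2 = []") auto
        moreover have "wt as1 = 0 \<or> 2 \<le> wt as1" using wt_ge_2[of as1] by (cases "as1 = []") auto
        ultimately show "(wt (as1 @ [Per i us c]) - 3) + (2 + wt as2 - 3) \<le> (if fl then wt as - 3 else wt as)"
          by (cases fl) auto
      qed
      moreover have "wt as2 + 3 \<le> wt as + (if fl then 0 else 1)"
        using wt_ge_2[of as1] ne as by auto
      ultimately show ?thesis by (simp add: distrib_left)
    qed
    have dist: "distinct (evars Z @ vars (as1 @ Per i us c # as2))"
      and sup: "supported (evars Z @ vars (as1 @ Per i us c # as2)) s"
      using b as by simp_all
    show ?case
      using good_at_Per[OF g1 g2 le dist sup l a ok_Per_per(6)[OF ok]] by (simp only: as)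
  qed
qed

end

section \<open>Runs of cancelling syllables\<close>

lemma nested_cancel:
  assumes "\<And>l. l < c \<Longrightarrow> graph.eqv I (X l @ Y l) []" "graph.eqv I v []"
  shows "graph.eqv I (concat (map X [0..<c]) @ v @ concat (map (\<lambda>l. Y (c - 1 - l)) [0..<c])) []"
  using assms
proof (induction c arbitrary: v)
  case (Suc c)
  interpret graph I .
  have 1: "triv (X c @ v @ Y c)"
    using Suc.prems(1)[of c] Suc.prems(2) by (simp add: triv_insert)
  have "triv (concat (map X [0..<c]) @ (X c @ v @ Y c) @ concat (map (\<lambda>l. Y (c - 1 - l)) [0..<c]))"
    using Suc.prems(1) 1 by (intro Suc.IH) auto
  moreover have "map (\<lambda>l. Y (Suc c - 1 - l)) [0..<Suc c] = Y c # map (\<lambda>l. Y (c - 1 - l)) [0..<c]"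
    by (rule nth_equalityI) (auto simp: nth_Cons' simp del: upt_Suc)
  ultimately show ?case by simp
qed simp

lemma mod_add_right_cancel_nat:
  fixes x y p q n :: nat
  assumes "(x + p) mod n = (y + q) mod n" "p mod n = q mod n"
  shows "x mod n = y mod n"
proof -
  have "(int x + int p) mod int n = (int y + int q) mod int n" "int p mod int n = int q mod int n"
    using assms by (metis of_nat_add of_nat_mod)+
  then have "(int x + int p - int p) mod int n = (int y + int q - int q) mod int n"
    by (rule mod_diff_cong)
  then show ?thesis by (simp flip: of_nat_mod)
qed

lemma diff_add_scale: "4 \<le> (x :: nat) \<Longrightarrow> C * (x - 4) + C = C * (x - 3)"
  by (auto simp: le_iff_add distrib_left)

context free_core
begin

lemma ok_syls:
  assumes "\<forall>A\<in>set as. ok A"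
  shows "set (exs y as) \<subseteq> syls"
proof -
  have "set (ex y A) \<subseteq> syls" if "A \<in> set as" for A
  proof (cases A)
    case (At t e)
    then have "iword e \<in> words t" using assms that by auto
    then have "ieval y e \<in> words t" using set_wpow by (cases e) (fastforce simp: words_def)+
    then show ?thesis by (simp add: At syls_def)
  next
    case (Per i us a)
    then have "ok (Per i us a)" using assms that by blast
    from ok_Per_per(1)[OF this] show ?thesis by (simp add: Per syls_def image_subset_iff)
  qed
  then show ?thesis by (auto simp: exs_def)
qed

text \<open>The second alternative is the one case in which the pieces do not get smaller: the block of the
  first syllable consists of the first and the last syllable.\<close>

lemma first_block:
  assumes ok: "\<forall>A\<in>set (Per i us b # as'). ok A" and dist: "distinct (vars (Per i us b # as'))"
    and s: "s \<in> bsols [] (Per i us b # as')" and pos: "0 < s i"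
    and w: "wt (Per i us b # as') \<le> Wt" and IH: "solved_upto (wt (Per i us b # as') - 1)"
  shows "good_at m (C * (wt (Per i us b # as') - 3) - L) (bsols [] (Per i us b # as')) s \<or>
    (\<exists>mid j vs c. as' = mid @ [Per j vs c] \<and> 0 < s j \<and>
       triv (snd (per us b) @ snd (per vs (c + s j - 1))) \<and>
       s(i := s i - 1, j := s j - 1) \<in> bsols [] (Per i us (b + 1) # mid @ [Per j vs c]))"
    (is "?good \<or> ?run")
proof -
  let ?as = "Per i us b # as'"
  let ?as2 = "Per i us (b + 1) # as'"
  obtain t a where ta: "(t, a) = per us b" by (metis surj_pair)
  let ?s2 = "(res (vars as') s)(i := s i - 1)"
  have oki: "ok (Per i us b)" and ok2: "\<forall>A\<in>set ?as2. ok A" using ok by auto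
  have i: "i \<notin> set (vars as')" using dist by auto
  have sup: "supported (vars ?as) s" and tr: "triv (sval (exs s ?as))" using s by (auto simp: bsols_def)
  have s2_upd: "?s2 = s(i := s i - 1)" using sup by (auto simp: supported_def res_def fun_eq_iff)
  have sup2: "supported (vars ?as2) ?s2" by (auto simp: supported_def)
  have "[b..<b + s i] = b # [b + 1..<b + 1 + (s i - 1)]" using pos by (simp add: upt_conv_Cons)
  then have exs_s: "exs s ?as = (t, a) # exs ?s2 ?as2"
    using i ta by (simp add: exs_upd exs_res del: upt_Suc)
  have a: "a \<in> words t" "length a + 1 \<le> N" "\<not> triv a"
    using ok_Per_per(1-3)[OF oki, of b] unfolding ta[symmetric] by auto
  have "triv (a @ sval (exs ?s2 ?as2))"
    using tr unfolding exs_s sval_simps snd_conv .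
  from triv_Cons_seg[OF ok_syls[OF ok2] a(1) this]
  obtain k where k: "seg t k (exs ?s2 ?as2)" "triv (a @ k)" by blast
  have "N * (1 + wt ?as2) \<le> N * (Wt + 2)" using w by (intro mult_le_mono2) simp
  moreover have "N * (1 + wt ?as2) = N + N * wt ?as2" by (simp add: distrib_left)
  ultimately have N_n: "N + N * wt ?as2 \<le> n" using size_bound by linarith
  have ne_t: "fst (per us (b + 1)) \<noteq> t"
    using ok_Per_per(4)[OF oki, of b] unfolding ta[symmetric] by simp
  have blk: "blk t k [Con a] ?as2 ?s2 True"
    using ok2 dist a k(2) sup2 N_n ne_t unfolding blk_def by auto
  \<comment> \<open>Reattaches the first syllable: a cut at offset 0, with an empty stretch on its
    left. The one \<open>C\<close> between \<open>wt ?as - 4\<close> and \<open>wt ?as - 3\<close>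
    pays for \<open>P\<close>, for the cut syllables and for the \<open>L\<close> that is held back
    for a run.\<close>
  have reduce: ?good
    if g: "good_at m (P + wt ?as + C * (wt ?as - 4)) (bsols [Con a] ?as2) ?s2" and w4: "4 \<le> wt ?as"
  proof -
    have g0: "good_at m 0 (bsols [] ([] @ [Per i us b])) ((res (vars []) s)(i := 0))"
      by (intro good_at_const) (auto simp: bsols_def res_def supported_def)
    have "C * (wt ?as - 4) + C = C * (wt ?as - 3)"
      using diff_add_scale[OF w4] .
    then have le: "0 + (P + wt ?as + C * (wt ?as - 4)) + 1 \<le> C * (wt ?as - 3) - L"
      using slack w by simp
    have g': "good_at m (P + wt ?as + C * (wt ?as - 4)) (bsols ([] @ [Con a]) (Per i us (b + 0 + 1) # as'))
        ((res (evars [] @ vars as') s)(i := s i - 0 - 1))"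
      using g by (simp only: append_Nil add_0_right evars_simps diff_zero)
    have "distinct (evars [] @ vars ([] @ Per i us b # as'))"
      and "supported (evars [] @ vars ([] @ Per i us b # as')) s" and "(t, a) = per us (b + 0)"
      using dist sup ta by simp_all
    from good_at_Per[OF g0 g' le this(1,2) pos this(3) ok_Per_per(6)[OF oki]]
    have "good_at m (C * (wt ?as - 3) - L) (bsols [] ([] @ Per i us b # as')) s" .
    then show ?thesis by simp
  qed
  \<comment> \<open>The first syllable is nontrivial, so the block has a second member. It is an
    ordinary atom, or lies in a periodic atom that is followed by others, or lies in the last
    atom.\<close>
  from k(1) show ?thesis
  proof cases
    case seg_end
    then show ?thesis using k(2) a(3) by simp
  next
    case (seg_step V k' W a')
    have blk': "blk t (a' @ k') [Con a] ?as2 ?s2 True" using blk seg_step(1) by simp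
    from exs_split[OF seg_step(2)] show ?thesis
    proof (elim disjE exE conjE)
      fix as1 e as3
      assume as: "?as2 = as1 @ At t e # as3" and a': "a' = ieval ?s2 e" and V: "V = exs ?s2 as1"
        and W: "W = exs ?s2 as3"
      let ?s3 = "res (evars [Con a] @ ivars e @ vars as3) ?s2"
      have ne: "as1 \<noteq> []" using as by (cases as1) auto
      have wt: "wt ?as = wt as1 + 4 + wt as3" using arg_cong[OF as, of wt] by simp
      have ok1: "\<forall>A\<in>set (as1 @ At t e # as3). ok A" and d1: "distinct (vars (as1 @ At t e # as3))"
        using ok2 dist unfolding as[symmetric] by auto
      have "good_at m (C * (wt as1 - 3)) (bsols [] as1) (res (vars as1) ?s2)"
        using seg_step(3) V ok1 d1 wt by (intro solved_uptoD[OF IH] bsols_res) auto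
      moreover have "exs ?s3 as3 = exs ?s2 as3" by (rule exs_res) auto
      then have "good_at m (P + (wt as3 + 1) + C * wt as3) (bsols ([Con a] @ [e]) as3) ?s3"
        using block_good[OF seg_step(4), of ?s3 as3 "[Con a] @ [e]" False]
          blk_At[OF blk'[unfolded as] a'] solved_upto_mono[OF IH, of "wt as3"] wt
        by (simp add: W)
      moreover have "C * (wt as1 - 3) + (P + (wt as3 + 1) + C * wt as3) \<le> P + wt ?as + C * (wt ?as - 4)"
      proof -
        have "C * (wt as1 - 3 + wt as3) \<le> C * (wt ?as - 4)"
          using wt_ge_2[OF ne] wt by (intro mult_le_mono2) auto
        then have "C * (wt as1 - 3) + C * wt as3 \<le> C * (wt ?as - 4)" by (simp only: distrib_left)
        moreover have "wt as3 + 1 \<le> wt ?as" using wt by simp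
        ultimately show ?thesis by linarith
      qed
      ultimately have "good_at m (P + wt ?as + C * (wt ?as - 4)) (bsols [Con a] ?as2) ?s2"
        using d1 sup2 unfolding as by (intro good_at_At) auto
      then show ?thesis using reduce wt by simp
    next
      fix as1 j vs c as3 l
      assume as: "?as2 = as1 @ Per j vs c # as3" and l: "l < ?s2 j" and a': "(t, a') = per vs (c + l)"
        and V: "V = exs ?s2 as1 @ map (per vs) [c..<c + l]"
        and W: "W = map (per vs) [c + l + 1..<c + ?s2 j] @ exs ?s2 as3"
      have ok1: "\<forall>A\<in>set (as1 @ Per j vs c # as3). ok A" and d1: "distinct (vars (as1 @ Per j vs c # as3))"
        using ok2 dist unfolding as[symmetric] by auto
      have okj: "ok (Per j vs c)" using ok1 by auto
      have j: "j \<notin> set (vars as1)" "j \<notin> set (vars as3)" using d1 by auto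
      \<comment> \<open>The second member does not come from the atom of the first one.\<close>
      have ne: "as1 \<noteq> []"
        using ne_t Per_prefix_nonempty[OF as[symmetric] _ okj a'] seg_step(3) V
        by auto
      have wt: "wt ?as = wt as1 + 2 + wt as3" using arg_cong[OF as, of wt] by simp
      show ?thesis
      proof (cases "as3 = []")
        case False
        let ?s3 = "(res (evars [Con a] @ vars as3) ?s2)(j := ?s2 j - l - 1)"
        have g1: "good_at m (C * (wt (as1 @ [Per j vs c]) - 3)) (bsols [] (as1 @ [Per j vs c]))
            ((res (vars as1) ?s2)(j := l))"
          using seg_step(3) ok1 d1 V j wt wt_ge_2[OF False]
          by (intro solved_uptoD[OF IH] bsols_res_Per) auto
        have g2: "good_at m (P + (2 + wt as3) + C * (2 + wt as3 - 3))
            (bsols ([Con a] @ [Con a']) (Per j vs (c + l + 1) # as3)) ?s3"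
        proof -
          have "c + l + 1 + (?s2 j - l - 1) = c + ?s2 j" using l by simp
          moreover have "exs ?s3 as3 = exs ?s2 as3" using j(2) by (intro exs_cong) auto
          ultimately have W': "W = exs ?s3 (Per j vs (c + l + 1) # as3)"
            by (simp add: W del: upt_Suc)
          have "solved_upto (wt (Per j vs (c + l + 1) # as3))"
            using wt wt_ge_2[OF ne] by (intro solved_upto_mono[OF IH]) simp
          moreover have "True \<longrightarrow> as1 \<noteq> []" using ne by simp
          note blk_Per[OF blk'[unfolded as] a' this]
          ultimately show ?thesis
            using block_good[OF seg_step(4) W', of "[Con a] @ [Con a']" True]
            by (simp only: if_True add_0_right wt_simps awt.simps)
        qed
        have le: "C * (wt (as1 @ [Per j vs c]) - 3) + (P + (2 + wt as3) + C * (2 + wt as3 - 3)) + 1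
            \<le> P + wt ?as + C * (wt ?as - 4)"
        proof -
          \<comment> \<open>Both pieces weigh at least 4, so nothing is truncated, and the two
            offsets give exactly \<open>wt ?as - 4\<close>.\<close>
          have "C * ((wt (as1 @ [Per j vs c]) - 3) + (2 + wt as3 - 3)) \<le> C * (wt ?as - 4)"
            using wt_ge_2[OF ne] wt_ge_2[OF False] wt by (intro mult_le_mono2) simp
          then have "C * (wt (as1 @ [Per j vs c]) - 3) + C * (2 + wt as3 - 3) \<le> C * (wt ?as - 4)"
            by (simp only: distrib_left)
          moreover have "2 + wt as3 + 1 \<le> wt ?as" using wt wt_ge_2[OF ne] by linarith
          ultimately show ?thesis by linarith
        qed
        have "distinct (evars [Con a] @ vars (as1 @ Per j vs c # as3))"
          and "supported (evars [Con a] @ vars (as1 @ Per j vs c # as3)) ?s2"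
          using d1 sup2 unfolding as by simp_all
        from good_at_Per[OF g1 g2 le this l a' ok_Per_per(6)[OF okj]]
        have "good_at m (P + wt ?as + C * (wt ?as - 4)) (bsols [Con a] ?as2) ?s2"
          by (simp only: as)
        then show ?thesis using reduce wt wt_ge_2[OF ne] by simp
      next
        case True
        obtain mid where as1: "as1 = Per i us (b + 1) # mid" "as' = mid @ [Per j vs c]"
          using as ne True by (cases as1) auto
        have ij: "j \<noteq> i" "?s2 j = s j" using d1 j by (auto simp: as1)
        \<comment> \<open>Behind the cut only an infix of the periodic word of \<open>vs\<close> is
          left. If the block is complete, this infix is trivial, hence empty; a third member would
          have to follow directly, but the next syllable has the other type.\<close>
        from seg_step(4) have "k' = [] \<and> l = s j - 1"
        proof cases
          case seg_end
          then have "c + s j \<le> c + l + 1"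
            using W True ij(2) ok_Per_per(7)[OF okj] by (intro cycred_triv) auto
          then show ?thesis using seg_end l ij by simp
        next
          case (seg_step V2 k2 W2 a2)
          let ?q = "length V2"
          have eq: "map (per vs) [c + l + 1..<c + s j] = V2 @ (t, a2) # W2"
            using seg_step(2) W True ij(2) by simp
          have q: "c + l + 1 + ?q < c + s j" using arg_cong[OF eq, of length] by simp
          have "V2 = map (per vs) [c + l + 1..<c + l + 1 + ?q]"
            using arg_cong[OF eq, of "take ?q"] q by (simp add: take_map)
          then have "triv (sval (map (per vs) [c + l + 1..<c + l + 1 + ?q]))" using seg_step(3) by simp
          then have "c + l + 1 + ?q \<le> c + l + 1" by (rule cycred_triv[OF ok_Per_per(7)[OF okj]])
          then have "V2 = []" by simp
          then have "per vs (c + l + 1) = (t, a2)"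
            using arg_cong[OF eq, of "\<lambda>x. x ! 0"] q by (simp del: upt_Suc)
          then show ?thesis
            using ok_Per_per(4)[OF okj, of "c + l"] a' by (metis fst_conv)
        qed
        then have k': "k' = []" and l: "l = s j - 1" by auto
        have sj: "0 < s j" using \<open>l < ?s2 j\<close> ij by simp
        then have "triv (snd (per us b) @ snd (per vs (c + s j - 1)))"
          using k(2) seg_step(1) k' ta a' l by (metis append_Nil2 add_diff_assoc less_eq_Suc_le One_nat_def snd_conv)
        moreover have "s(i := s i - 1, j := s j - 1) \<in> bsols [] (Per i us (b + 1) # mid @ [Per j vs c])"
        proof -
          have "supported (vars ?as2) (s(i := s i - 1, j := s j - 1))"
            using sup by (auto simp: supported_def as1)
          moreover have "exs (s(i := s i - 1, j := s j - 1)) as1 = exs ?s2 as1"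
            unfolding s2_upd using j(1) by (rule exs_upd)
          then have "exs (s(i := s i - 1, j := s j - 1)) (as1 @ [Per j vs c]) = V"
            using V l ij(1) by simp
          moreover have "Per i us (b + 1) # mid @ [Per j vs c] = as1 @ [Per j vs c]" "?as2 = as1 @ [Per j vs c]"
            using as1 by simp_all
          ultimately show ?thesis
            using seg_step(3) unfolding bsols_def mem_Collect_eq by (simp only: evars_simps eval_simps append_Nil)
        qed
        ultimately show ?thesis using as1(2) sj by blast
      qed
    qed
  qed
qed

text \<open>Strips outermost pairs as long as \<open>first_block\<close> yields its second
  alternative; each pair lowers \<open>s i\<close>. The final equation is solved with
  \<open>L\<close> to spare, which \<open>run_good\<close> spends on the run.\<close>

lemma run_exists:
  assumes "\<forall>A\<in>set (Per i us b # mid @ [Per j vs c]). ok A" "distinct (vars (Per i us b # mid @ [Per j vs c]))"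
    and "s \<in> bsols [] (Per i us b # mid @ [Per j vs c])"
    and "wt (Per i us b # mid @ [Per j vs c]) \<le> Wt" "solved_upto (wt (Per i us b # mid @ [Per j vs c]) - 1)"
  shows "\<exists>r. r \<le> s i \<and> r \<le> s j \<and> (\<forall>l<r. triv (snd (per us (b + l)) @ snd (per vs (c + s j - 1 - l)))) \<and>
    good_at m (C * (wt (Per i us b # mid @ [Per j vs c]) - 3) - L)
      (bsols [] (Per i us (b + r) # mid @ [Per j vs c])) (s(i := s i - r, j := s j - r))"
  using assms
proof (induction "s i" arbitrary: s b)
  case 0
  let ?w = "wt (Per i us b # mid @ [Per j vs c])"
  have "s q = 0" if "q \<notin> set (vars (mid @ [Per j vs c]))" for q
    using 0(1,4) that by (cases "q = i") (auto simp: bsols_def supported_def)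
  then have "s \<in> bsols [] (mid @ [Per j vs c])"
    using 0(1,4) by (simp add: bsols_def supported_def)
  then have "good_at m (C * (wt (mid @ [Per j vs c]) - 3)) (bsols [] (mid @ [Per j vs c])) s"
    using 0 by (intro solved_uptoD[OF 0(6)]) auto
  \<comment> \<open>Dropping the exhausted first atom frees at least one \<open>C\<close>, which
    exceeds \<open>L\<close>.\<close>
  moreover have "C * (wt (mid @ [Per j vs c]) - 3) \<le> C * (?w - 3) - L"
  proof -
    have "C * (wt (mid @ [Per j vs c]) - 3 + 1) \<le> C * (?w - 3)"
      by (intro mult_le_mono2) simp
    then have "C * (wt (mid @ [Per j vs c]) - 3) + C \<le> C * (?w - 3)"
      by (simp only: distrib_left mult_1_right)
    then show ?thesis using slack by linarith
  qed
  moreover have "bsols [] (mid @ [Per j vs c]) \<subseteq> bsols [] (Per i us b # mid @ [Per j vs c])"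
  proof
    fix y assume y: "y \<in> bsols [] (mid @ [Per j vs c])"
    then have "y i = 0" using 0(3) by (auto simp: bsols_def supported_def)
    then show "y \<in> bsols [] (Per i us b # mid @ [Per j vs c])"
      using y by (auto simp: bsols_def supported_def)
  qed
  ultimately have "good_at m (C * (?w - 3) - L) (bsols [] (Per i us b # mid @ [Per j vs c])) s"
    by (rule good_at_mono)
  then show ?case by (intro exI[of _ 0]) simp
next
  case (Suc x)
  have pos: "0 < s i" using Suc.hyps(2) by simp
  have ij: "i \<noteq> j" using Suc.prems(2) by auto
  from first_block[OF Suc.prems(1,2,3) pos Suc.prems(4,5)] show ?case
  proof (elim disjE exE conjE)
    assume "good_at m (C * (wt (Per i us b # mid @ [Per j vs c]) - 3) - L)
      (bsols [] (Per i us b # mid @ [Per j vs c])) s"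
    then show ?case by (intro exI[of _ 0]) simp
  next
    fix mid' j' vs' c'
    assume eq: "mid @ [Per j vs c] = mid' @ [Per j' vs' c']" and "0 < s j'"
      and "triv (snd (per us b) @ snd (per vs' (c' + s j' - 1)))"
      and "s(i := s i - 1, j' := s j' - 1) \<in> bsols [] (Per i us (b + 1) # mid' @ [Per j' vs' c'])"
    then have sj: "0 < s j" and tr: "triv (snd (per us b) @ snd (per vs (c + s j - 1)))"
      and mem: "s(i := s i - 1, j := s j - 1) \<in> bsols [] (Per i us (b + 1) # mid @ [Per j vs c])"
      by auto
    let ?s = "s(i := s i - 1, j := s j - 1)"
    have s': "?s i = s i - 1" "?s j = s j - 1" using ij by auto
    have "\<exists>r. r \<le> ?s i \<and> r \<le> ?s j \<and> (\<forall>l<r. triv (snd (per us (b + 1 + l)) @ snd (per vs (c + ?s j - 1 - l)))) \<and>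
      good_at m (C * (wt (Per i us (b + 1) # mid @ [Per j vs c]) - 3) - L)
        (bsols [] (Per i us (b + 1 + r) # mid @ [Per j vs c])) (?s(i := ?s i - r, j := ?s j - r))"
    proof (rule Suc.hyps(1))
      show "x = ?s i" using Suc.hyps(2) s'(1) by simp
      show "\<forall>A\<in>set (Per i us (b + 1) # mid @ [Per j vs c]). ok A" using Suc.prems(1) by simp
      show "distinct (vars (Per i us (b + 1) # mid @ [Per j vs c]))" using Suc.prems(2) by simp
      show "?s \<in> bsols [] (Per i us (b + 1) # mid @ [Per j vs c])" by (rule mem)
      show "wt (Per i us (b + 1) # mid @ [Per j vs c]) \<le> Wt" using Suc.prems(4) by simp
      show "solved_upto (wt (Per i us (b + 1) # mid @ [Per j vs c]) - 1)" using Suc.prems(5) by simp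
    qed
    then obtain r where r: "r \<le> s i - 1" "r \<le> s j - 1"
      "\<And>l. l < r \<Longrightarrow> triv (snd (per us (b + 1 + l)) @ snd (per vs (c + (s j - 1) - 1 - l)))"
      "good_at m (C * (wt (Per i us b # mid @ [Per j vs c]) - 3) - L)
        (bsols [] (Per i us (b + 1 + r) # mid @ [Per j vs c])) (?s(i := s i - 1 - r, j := s j - 1 - r))"
      unfolding s' by auto
    have "triv (snd (per us (b + l)) @ snd (per vs (c + s j - 1 - l)))" if "l < Suc r" for l
    proof (cases l)
      case 0
      then show ?thesis using tr by simp
    next
      case (Suc l')
      have "c + (s j - 1) - 1 - l' = c + s j - 1 - l" using Suc sj by simp
      then show ?thesis using r(3)[of l'] that Suc by simp
    qed
    moreover have "?s(i := s i - 1 - r, j := s j - 1 - r) = s(i := s i - Suc r, j := s j - Suc r)"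
      using ij by (auto simp: fun_eq_iff)
    moreover have "Suc r \<le> s i" "Suc r \<le> s j" using r pos sj by auto
    ultimately show ?case using r(4) by (intro exI[of _ "Suc r"]) auto
  qed
qed

text \<open>Whether the pair at depth \<open>l\<close> cancels depends only on \<open>l\<close>
  modulo the common multiple \<open>K\<close> of the two lengths. So a run that contains a full
  period can be lengthened by multiples of \<open>K\<close>, increasing both variables equally; a
  shorter run goes into the base.\<close>

lemma run_good:
  assumes ok: "\<forall>A\<in>set (Per i us b # mid @ [Per j vs c]). ok A"
    and dist: "distinct (vars (Per i us b # mid @ [Per j vs c]))"
    and r: "r \<le> s i" "r \<le> s j"
    and match: "\<And>l. l < r \<Longrightarrow> triv (snd (per us (b + l)) @ snd (per vs (c + s j - 1 - l)))"
    and good: "good_at m M (bsols [] (Per i us (b + r) # mid @ [Per j vs c])) (s(i := s i - r, j := s j - r))"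
  shows "good_at m (M + L) (bsols [] (Per i us b # mid @ [Per j vs c])) s"
proof -
  let ?as = "Per i us b # mid @ [Per j vs c]" and ?as' = "Per i us (b + r) # mid @ [Per j vs c]"
  let ?s = "s(i := s i - r, j := s j - r)"
  define u where "u = unit i + unit j"
  define K where "K = m i * m j"
  \<comment> \<open>The run lengths that may replace \<open>r\<close>: in its residue class modulo
    \<open>K\<close>, and beyond \<open>r\<close> only if the known run covers a full
    period.\<close>
  define T where "T = {(\<lambda>q. d * u q) | d. d mod K = r mod K \<and> (d \<le> r \<or> K \<le> r)}"
  have oki: "ok (Per i us b)" and okj: "ok (Per j vs c)" using ok by auto
  have ij: "i \<noteq> j" and mid: "i \<notin> set (vars mid)" "j \<notin> set (vars mid)" using dist by auto
  have u: "u i = 1" "u j = 1" "\<And>q. q \<noteq> i \<Longrightarrow> q \<noteq> j \<Longrightarrow> u q = 0" "\<And>q. u q \<le> 1"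
    using ij by (auto simp: u_def unit_def)
  have K: "0 < K" "length us dvd K" "length vs dvd K" "K \<le> L" "\<And>q. m q dvd K * u q"
    using ok_Per_per(5,6)[OF oki] ok_Per_per(5,6)[OF okj] run_period[of i j] u(3)
    by (auto simp: K_def) (metis dvd_0_right dvd_mult2 dvd_refl dvd_triv_left dvd_triv_right mult_0_right)
  have uq: "x * u q \<le> x" for x q using u(4)[of q] by (cases "u q") auto
  have goodT: "good_at m L T (\<lambda>q. r * u q)"
  proof (cases "r < K")
    case True
    have "r * u q \<le> L" for q by (rule le_trans[OF uq]) (use True K(4) in simp)
    then show ?thesis by (intro good_at_const) (auto simp: T_def)
  next
    case False
    let ?f = "\<lambda>q. K * u q" and ?x = "\<lambda>q. (r mod K) * u q"
    have lin: "sum_list fs = (\<lambda>q. (length fs * K) * u q)" if "set fs \<subseteq> {?f}" for fs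
      using that by (induction fs) (auto simp: fun_eq_iff distrib_right)
    have "r mod K * u q \<le> L" "K * u q \<le> L" for q
      using K(4) uq[of K q] uq[of "r mod K" q] mod_less_divisor[OF K(1), of r] by linarith+
    moreover have "(\<lambda>q. r * u q) \<in> linear_set ?x {?f}"
    proof -
      have "r * u q = r mod K * u q + (length (replicate (r div K) ?f) * K) * u q" for q
        by (simp flip: distrib_right)
      then have "(\<lambda>q. r * u q) = ?x + sum_list (replicate (r div K) ?f)"
        using lin[of "replicate (r div K) ?f"] by (auto simp: fun_eq_iff set_replicate_conv_if)
      then show ?thesis unfolding linear_set_iff by (intro exI[of _ "replicate (r div K) ?f"]) auto
    qed
    moreover have "linear_set ?x {?f} \<subseteq> T"
    proof
      fix y assume "y \<in> linear_set ?x {?f}"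
      then obtain fs where fs: "set fs \<subseteq> {?f}" "y = ?x + sum_list fs" unfolding linear_set_iff by blast
      then have "y = (\<lambda>q. (r mod K + length fs * K) * u q)"
        using lin[OF fs(1)] by (auto simp: fun_eq_iff distrib_right)
      moreover have "(r mod K + length fs * K) mod K = r mod K" by simp
      ultimately show "y \<in> T" unfolding T_def using False by (auto simp: not_less)
    qed
    ultimately show ?thesis unfolding good_at_def using K(5)
      by (intro exI[of _ ?x] exI[of _ "{?f}"]) auto
  qed
  show ?thesis
  proof (rule good_at_plus[OF good goodT])
    show "M + L \<le> M + L" ..
    show "s = ?s + (\<lambda>q. r * u q)" using r u(1-3) ij by (auto simp: fun_eq_iff)
    fix y z assume y: "y \<in> bsols [] ?as'" and "z \<in> T"
      and "\<forall>q. y q mod m q = ?s q mod m q"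
    then have yj: "y j mod length vs = (s j - r) mod length vs"
      using ij ok_Per_per(6)[OF okj] by (auto dest: spec[of _ j])
    from \<open>z \<in> T\<close> obtain d where z: "z = (\<lambda>q. d * u q)" and dK: "d mod K = r mod K" and d: "d \<le> r \<or> K \<le> r"
      unfolding T_def by blast
    have d_us: "d mod length us = r mod length us" and d_vs: "d mod length vs = r mod length vs"
      using dK K(2,3) by (metis mod_mod_cancel)+
    let ?y = "y + z"
    let ?X = "\<lambda>l. snd (per us (b + l))" and ?Y = "\<lambda>l. snd (per vs (c + y j + (d - 1 - l)))"
    have match': "triv (?X l @ ?Y l)" if "l < d" for l
    proof -
      \<comment> \<open>A depth outside the known run is reduced modulo \<open>K\<close>; it then
        lies below \<open>K\<close>, hence inside the run.\<close>
      define l' where "l' = (if d \<le> r then l else l mod K)"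
      have l': "l' < r" "l' mod K = l mod K" using that d K(1) mod_less_divisor[OF K(1), of l]
        by (auto simp: l'_def)
      have "l' mod length us = l mod length us" and l'_vs: "l' mod length vs = l mod length vs"
        using l'(2) K(2,3) by (metis mod_mod_cancel)+
      then have 1: "per us (b + l') = per us (b + l)"
        using mod_add_cong[of b "length us" b l' l] by (simp add: per_def)
      \<comment> \<open>The right syllables are counted from the end of their stretch. Adding the
        depths back removes the truncated subtractions and leaves the two ends, congruent because
        \<open>y j + d\<close> and \<open>s j\<close> are.\<close>
      have "(c + s j - 1 - l' + (l' + 1)) mod length vs = (c + y j + (d - 1 - l) + (l + 1)) mod length vs"
      proof -
        have "c + s j - 1 - l' + (l' + 1) = c + ((s j - r) + r)" using l'(1) r(2) by simp
        moreover have "c + y j + (d - 1 - l) + (l + 1) = c + (y j + d)" using that by simp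
        ultimately show ?thesis using mod_add_cong[OF yj d_vs] by (metis mod_add_right_eq)
      qed
      then have "(c + s j - 1 - l') mod length vs = (c + y j + (d - 1 - l)) mod length vs"
        using mod_add_cong[OF l'_vs HOL.refl] by (rule mod_add_right_cancel_nat)
      then have 2: "per vs (c + s j - 1 - l') = per vs (c + y j + (d - 1 - l))"
        by (simp add: per_def)
      show ?thesis using match[OF l'(1)] unfolding 1 2 .
    qed
    have y_mid: "exs ?y mid = exs y mid"
      using mid u(3) by (intro exs_cong) (metis add_cancel_left_right mult_0_right plus_fun_apply z)
    have yi: "?y i = d + y i" "?y j = y j + d" using u by (auto simp: z)
    have exi: "ex ?y (Per i us b) = map (\<lambda>l. per us (b + l)) [0..<d] @ ex y (Per i us (b + r))"
    proof -
      have 1: "map (per us) [b + d..<b + d + y i] = map (per us) [b + r..<b + r + y i]"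
        using d_us by (intro per_shift mod_add_cong) auto
      have 2: "[b..<b + (d + y i)] = [b..<b + d] @ [b + d..<b + d + y i]"
        using upt_add_eq_append[of b "b + d" "y i"] by (simp only: add.assoc le_add1)
      have "map (\<lambda>l. b + l) [0..<d] = [b..<b + d]"
        using map_add_upt[of b d] by (simp add: add.commute)
      then have "map (\<lambda>l. per us (b + l)) [0..<d] = map (per us) [b..<b + d]"
        by (metis (no_types, lifting) map_map comp_apply map_eq_conv)
      then show ?thesis unfolding ex.simps yi(1) 2 map_append 1 by (simp only:)
    qed
    have exj: "ex ?y (Per j vs c) = ex y (Per j vs c) @ map (\<lambda>l. per vs (c + y j + l)) [0..<d]"
    proof -
      have "[c..<c + (y j + d)] = [c..<c + y j] @ [c + y j..<c + y j + d]"
        using upt_add_eq_append[of c "c + y j" d] by (simp only: add.assoc le_add1)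
      moreover have "map (\<lambda>l. c + y j + l) [0..<d] = [c + y j..<c + y j + d]"
        using map_add_upt[of "c + y j" d] by (simp add: add.commute)
      then have "map (\<lambda>l. per vs (c + y j + l)) [0..<d] = map (per vs) [c + y j..<c + y j + d]"
        by (metis (no_types, lifting) map_map comp_apply map_eq_conv)
      ultimately show ?thesis using yi by simp
    qed
    have rev: "map (\<lambda>l. ?Y (d - 1 - l)) [0..<d] = map (\<lambda>l. snd (per vs (c + y j + l))) [0..<d]"
      by (rule nth_equalityI) (auto simp: add.assoc)
    have "triv (sval (exs y ?as'))" using y by (simp add: bsols_def)
    from nested_cancel[where X = ?X and Y = ?Y and c = d, OF match' this]
    have "triv (concat (map ?X [0..<d]) @ sval (exs y ?as') @ concat (map (\<lambda>l. snd (per vs (c + y j + l))) [0..<d]))"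
      unfolding rev by simp
    then have "triv (sval (exs ?y ?as))"
      unfolding exs_simps exi exj y_mid by (simp add: sval_def comp_def)
    moreover have "supported (vars ?as) ?y"
      using y u(3) by (auto simp: bsols_def supported_def z)
    ultimately show "?y \<in> bsols [] ?as" by (simp add: bsols_def)
  qed
qed

theorem solved_all: "solved_upto Wt"
proof -
  have "w \<le> Wt \<Longrightarrow> solved_upto w" for w
  proof (induction w rule: less_induct)
    case (less w)
    show ?case
      unfolding solved_upto_def
    proof (intro allI impI)
      fix as s
      assume as: "wt as \<le> w" "\<forall>A\<in>set as. ok A" "distinct (vars as)" "s \<in> bsols [] as"
      show "good_at m (C * (wt as - 3)) (bsols [] as) s"
      proof (cases as)
        case Nil
        then have "s = (\<lambda>_. 0)" using as(4) by (auto simp: bsols_def supported_def)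
        then show ?thesis using as(4) by (intro good_at_const) auto
      next
        case (Cons A as')
        have IH: "solved_upto (wt as - 1)"
          using less as(1) wt_ge_2[of as] Cons by (metis diff_less le_neq_implies_less le_trans less_imp_le_nat
              less_le_trans list.distinct(1) pos2 zero_less_one)
        have w: "wt as \<le> Wt" using as(1) less.prems by simp
        show ?thesis
        proof (cases A)
          case (At t e)
          have "triv (ieval s e @ sval (exs s as'))" and iw: "iword e \<in> words t"
            using as(2,4) by (auto simp: Cons At bsols_def)
          moreover have "ieval s e \<in> words t"
            using iw set_wpow by (cases e) (fastforce simp: words_def)+
          ultimately obtain k where k: "seg t k (exs s as')" "triv (ieval s e @ k)"
            using triv_Cons_seg[OF ok_syls] as(2) Cons by (metis list.set_intros(2))
          have "N * (wt as' + 2) \<le> N * (Wt + 2)"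
            using w by (intro mult_le_mono2) (simp add: Cons At)
          moreover have "N * (wt as' + 2) = N + N * (wt as' + 1)" by simp
          ultimately have "N + N * (wt as' + 1) \<le> n" using size_bound by linarith
          then have "blk t k [e] as' s False"
            using as(2,3,4) k(2) by (auto simp: blk_def Cons At bsols_def)
          then have "good_at m (P + (wt as' + 1) + C * wt as') (bsols [e] as') s"
            using block_good[OF k(1) HOL.refl, of "[e]" False] solved_upto_mono[OF IH, of "wt as'"]
            by (simp add: Cons At)
          \<comment> \<open>With a first atom of weight 4, \<open>wt as - 3\<close> is
            \<open>wt as' + 1\<close>: one \<open>C\<close> more than the stretches of the block
            use.\<close>
          moreover have "P + (wt as' + 1) + C * wt as' \<le> C * (wt as - 3)"
            using slack w by (simp add: Cons At)
          moreover have "bsols [e] as' \<subseteq> bsols [] as" by (auto simp: Cons At bsols_def)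
          ultimately show ?thesis by (rule good_at_mono)
        next
          case (Per i us b)
          show ?thesis
          \<comment> \<open>If the first stretch is empty at \<open>s\<close>, a linear set inside
            the solutions with \<open>y i = 0\<close> is enough, since only \<open>s\<close> has to
            be covered.\<close>
          proof (cases "s i = 0")
            case True
            have "s q = 0" if "q \<notin> set (vars as')" for q
              using as(4) True that by (cases "q = i") (auto simp: Cons Per bsols_def supported_def)
            then have "good_at m (C * (wt as' - 3)) (bsols [] as') s"
              using as True by (intro solved_uptoD[OF IH]) (auto simp: Cons Per bsols_def supported_def)
            moreover have "bsols [] as' \<subseteq> bsols [] as"
            proof
              fix y assume y: "y \<in> bsols [] as'"
              then have "y i = 0" using as(3) by (auto simp: bsols_def supported_def Cons Per)
              then show "y \<in> bsols [] as" using y by (auto simp: bsols_def supported_def Cons Per)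
            qed
            ultimately show ?thesis by (elim good_at_mono) (auto simp: Cons Per)
          next
            case False
            note as_eq = Cons[unfolded Per]
            show ?thesis
            proof (cases "\<exists>mid j vs c. as' = mid @ [Per j vs c]")
              case True
              then obtain mid j vs c where as': "as' = mid @ [Per j vs c]" by blast
              note eq = as_eq[unfolded as']
              obtain r where "r \<le> s i" "r \<le> s j"
                "\<And>l. l < r \<Longrightarrow> triv (snd (per us (b + l)) @ snd (per vs (c + s j - 1 - l)))"
                "good_at m (C * (wt as - 3) - L) (bsols [] (Per i us (b + r) # mid @ [Per j vs c]))
                  (s(i := s i - r, j := s j - r))"
                using run_exists[of i us b mid j vs c s] as IH w unfolding eq by blast
              from run_good[OF _ _ this] have "good_at m (C * (wt as - 3) - L + L) (bsols [] as) s"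
                using as unfolding eq by blast
              \<comment> \<open>Two periodic atoms weigh at least 4, so at least one
                \<open>C\<close> is present and subtracting \<open>L\<close> is exact.\<close>
              moreover have "C * 1 \<le> C * (wt as - 3)"
                unfolding eq by (intro mult_le_mono2) simp
              then have "C * (wt as - 3) - L + L = C * (wt as - 3)" using slack by linarith
              ultimately show ?thesis by simp
            next
              case no_run: False
              have "good_at m (C * (wt as - 3) - L) (bsols [] as) s"
                using first_block[of i us b as' s] as IH w False no_run unfolding as_eq by blast
              then show ?thesis by (rule good_at_mono) auto
            qed
          qed
        qed
      qed
    qed
  qed
  then show ?thesis by blast
qed

end

section \<open>Tameness of free products\<close>

lemma poly_nat_mono:
  fixes p :: "nat poly"
  shows "x \<le> y \<Longrightarrow> poly p x \<le> poly p y"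
  by (induction p) (auto intro: add_mono mult_mono)

lemma distinct_evars_unique:
  "distinct (evars es) \<Longrightarrow> Var i w \<in> set es \<Longrightarrow> Var i w' \<in> set es \<Longrightarrow> w = w'"
proof (induction es)
  case (Cons e es)
  have "i \<in> set (evars es)" if "Var i v \<in> set es" for v
    using that by (force simp: evars_def)
  then show ?case using Cons by auto
qed simp

lemma esize_mem: "e \<in> set es \<Longrightarrow> length (iword e) + 1 \<le> esize es"
  by (induction es) auto

lemma sval_per: "sval (map (per us) [0..<length us * k]) = wpow (sval us) k"
proof (induction k)
  case (Suc k)
  have "[0..<length us * Suc k] = [0..<length us] @ [length us..<length us + length us * k]"
    using upt_add_eq_append[of 0 "length us" "length us * k"] by simp
  moreover have "map (per us) [length us..<length us + length us * k] = map (per us) [0..<0 + length us * k]"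
    by (rule per_shift) simp
  moreover have "map (per us) [0..<length us] = us"
    by (rule nth_equalityI) (auto simp: per_def)
  ultimately show ?case using Suc.IH by simp
qed simp

lemma sum_list_fun_scale:
  fixes m :: "nat \<Rightarrow> nat"
  shows "m i * sum_list fs i = sum_list (map (\<lambda>f i. m i * f i) fs) i"
  by (induction fs) (auto simp: distrib_left)

text \<open>Returns from counts of syllables to exponents by dividing base and periods by
  \<open>m\<close>.\<close>

lemma good_at_unscale:
  assumes good: "good_at m M S' (\<lambda>i. m i * y i)" and pos: "\<And>i. 0 < m i"
    and S: "\<And>z. (\<lambda>i. m i * z i) \<in> S' \<Longrightarrow> z \<in> S"
  shows "good_at (\<lambda>_. 1) M S y"
proof -
  obtain x F where F: "finite F" "\<forall>i. x i \<le> M" "\<forall>f\<in>F. \<forall>i. f i \<le> M \<and> m i dvd f i"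
      "(\<lambda>i. m i * y i) \<in> linear_set x F" "linear_set x F \<subseteq> S'"
    using good by (auto simp: good_at_def)
  define dv where "dv f = (\<lambda>i. f i div m i :: nat)" for f
  \<comment> \<open>The base is congruent to the given multiple of \<open>m i\<close>, as the
    periods are divisible by \<open>m i\<close>.\<close>
  have "x i mod m i = 0" for i
    using linear_set_cong[OF linear_set_base F(4), of m i] F(3) by simp
  then have "m i dvd x i" for i by (rule mod_0_imp_dvd)
  then have x: "m i * dv x i = x i" for i by (simp add: dv_def)
  have f: "(\<lambda>i. m i * dv f i) = f" if "f \<in> F" for f using F(3) that by (auto simp: dv_def)
  have le: "dv g i \<le> g i" for g i by (simp add: dv_def)
  have "dv x i \<le> M" for i using le[of x i] F(2) by (metis le_trans)
  moreover have "dv f i \<le> M" if "f \<in> F" for f i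
    using le[of f i] F(3) that by (metis le_trans)
  moreover have "y \<in> linear_set (dv x) (dv ` F)"
  proof -
    obtain fs where fs: "set fs \<subseteq> F" "(\<lambda>i. m i * y i) = x + sum_list fs"
      using F(4) unfolding linear_set_iff by blast
    have "map (\<lambda>f i. m i * f i) (map dv fs) = fs"
      using fs(1) f by (auto intro!: map_idI)
    then have "m i * y i = m i * (dv x + sum_list (map dv fs)) i" for i
      using fun_cong[OF fs(2), of i] x[of i] sum_list_fun_scale[of m i "map dv fs"]
      by (simp add: distrib_left)
    moreover have "m i \<noteq> 0" for i using pos[of i] by simp
    ultimately have "y = dv x + sum_list (map dv fs)" by (simp add: fun_eq_iff)
    then show ?thesis unfolding linear_set_iff using fs(1) by (intro exI[of _ "map dv fs"]) auto
  qed
  moreover have "linear_set (dv x) (dv ` F) \<subseteq> S"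
  proof
    fix z assume "z \<in> linear_set (dv x) (dv ` F)"
    then obtain gs where gs: "set gs \<subseteq> dv ` F" "z = dv x + sum_list gs"
      unfolding linear_set_iff by blast
    have "set (map (\<lambda>f i. m i * f i) gs) \<subseteq> F" using gs(1) f by auto
    moreover have "(\<lambda>i. m i * z i) = x + sum_list (map (\<lambda>f i. m i * f i) gs)"
      using x by (simp add: gs(2) fun_eq_iff distrib_left sum_list_fun_scale)
    ultimately have "(\<lambda>i. m i * z i) \<in> linear_set x F" unfolding linear_set_iff by blast
    then show "z \<in> S" using F(5) S by blast
  qed
  ultimately show ?thesis unfolding good_at_def using F(1)
    by (intro exI[of _ "dv x"] exI[of _ "dv ` F"]) auto
qed

section \<open>Cyclic reduction and the translation into atoms\<close>

context free_pair
begin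

text \<open>Each step drops a trivial syllable, merges two neighbours, or conjugates the first
  syllable to the end and merges there. It shortens the list, never lengthens the word, and extends
  the conjugator by at most the length of the word; hence the product in the bound for
  \<open>c\<close>.\<close>

lemma cyclic_reduction:
  assumes "set us \<subseteq> syls"
  shows "\<exists>c u. set c \<subseteq> (B1 \<union> B2) \<times> UNIV \<and> sval us \<approx> c @ sval u @ winv c \<and>
    length c \<le> length us * length (sval us) \<and> length (sval u) \<le> length (sval us) \<and>
    set u \<subseteq> syls \<and> length u \<le> max 1 (length us) \<and> (length u = 1 \<or> cycred u)"
  using assms
proof (induction "length us" arbitrary: us rule: less_induct)
  case less
  have words_sub: "set a \<subseteq> (B1 \<union> B2) \<times> UNIV" if "a \<in> words t" for a t
    using that by (auto simp: words_def split: if_splits)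
  have lift: ?case
    if e: "sval us \<approx> a @ sval vs @ winv a" and lt: "length vs < length us" and vs: "set vs \<subseteq> syls"
      and le: "length (sval vs) \<le> length (sval us)" "length a \<le> length (sval us)"
      and a: "set a \<subseteq> (B1 \<union> B2) \<times> UNIV" for a vs
  proof -
    obtain c u where c: "set c \<subseteq> (B1 \<union> B2) \<times> UNIV" "sval vs \<approx> c @ sval u @ winv c"
      "length c \<le> length vs * length (sval vs)" "length (sval u) \<le> length (sval vs)"
      "set u \<subseteq> syls" "length u \<le> max 1 (length vs)" "length u = 1 \<or> cycred u"
      using less.hyps[OF lt vs] by blast
    have "a @ sval vs @ winv a \<approx> a @ (c @ sval u @ winv c) @ winv a"
      by (intro eqv_append c eqv_refl)
    with e have "sval us \<approx> a @ (c @ sval u @ winv c) @ winv a" by (rule eqv_trans)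
    then have "sval us \<approx> (a @ c) @ sval u @ winv (a @ c)" by simp
    moreover have "length vs * length (sval vs) \<le> length vs * length (sval us)"
      using le(1) by (rule mult_le_mono2)
    then have "length (a @ c) \<le> Suc (length vs) * length (sval us)"
      using le(2) c(3) unfolding length_append mult_Suc by linarith
    then have "length (a @ c) \<le> length us * length (sval us)"
      using mult_le_mono1[of "Suc (length vs)" "length us"] lt by (meson Suc_leI le_trans)
    ultimately show ?thesis using c a le lt by (intro exI[of _ "a @ c"] exI[of _ u]) auto
  qed
  consider "us = []" | "length us = 1" | "cycred us" | x where "2 \<le> length us" "x \<in> set us" "triv (snd x)"
    | l where "2 \<le> length us" "fst (per us l) = fst (per us (Suc l))"
  proof (cases "us = [] \<or> length us = 1 \<or> cycred us")
    case False
    then have "length us \<noteq> 0" "length us \<noteq> 1" by simp_all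
    then have len: "2 \<le> length us" by linarith
    then have "(\<exists>x\<in>set us. triv (snd x)) \<or> (\<exists>l. fst (per us l) = fst (per us (Suc l)))"
      using False less.prems unfolding cycred_def by blast
    then show ?thesis using len that(4,5) by blast
  qed (use that(1-3) in blast)
  then show ?case
  proof cases
    case 1
    \<comment> \<open>The empty word becomes one trivial syllable, so that it falls under
      \<open>length u = 1\<close>; this is the reason for \<open>max 1\<close> in the claim.\<close>
    then show ?thesis by (intro exI[of _ "[]"] exI[of _ "[(True, [])]"]) (auto simp: syls_def)
  next
    case 2
    then show ?thesis using less.prems by (intro exI[of _ "[]"] exI[of _ us]) auto
  next
    case 3
    then show ?thesis using less.prems by (intro exI[of _ "[]"] exI[of _ us]) auto
  next
    case 4
    then obtain xs ys where us: "us = xs @ x # ys" by (meson split_list)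
    have "sval us \<approx> sval (xs @ ys)" using eqv_insert[OF 4(3)] by (simp add: us)
    then show ?thesis using less.prems us by (intro lift[of "[]" "xs @ ys"]) auto
  next
    case 5
    let ?n = "length us" and ?l = "l mod length us"
    have ln: "?l < ?n" using 5(1) by (intro mod_less_divisor) linarith
    show ?thesis
    proof (cases "Suc ?l < ?n")
      case True
      then have "per us (Suc l) = us ! Suc ?l" by (simp add: per_def mod_Suc)
      then obtain t a b where ab: "us ! ?l = (t, a)" "us ! Suc ?l = (t, b)"
        using 5(2) by (cases "us ! ?l"; cases "us ! Suc ?l") (auto simp: per_def)
      have us: "us = take ?l us @ (t, a) # (t, b) # drop (Suc (Suc ?l)) us"
        using ln True ab by (metis id_take_nth_drop Cons_nth_drop_Suc)
      have "a \<in> words t" "b \<in> words t"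
        using less.prems ab ln True nth_mem[of ?l us] nth_mem[of "Suc ?l" us] by (force simp: syls_def)+
      moreover have "set (take ?l us) \<subseteq> syls" "set (drop (Suc (Suc ?l)) us) \<subseteq> syls"
        using less.prems set_take_subset set_drop_subset by fast+
      ultimately have s: "set (take ?l us @ (t, a @ b) # drop (Suc (Suc ?l)) us) \<subseteq> syls"
        by (auto simp: syls_def)
      have sv: "sval (take ?l us @ (t, a @ b) # drop (Suc (Suc ?l)) us) = sval us"
        by (subst (3) us) simp
      show ?thesis
        using s sv True by (intro lift[of "[]" "take ?l us @ (t, a @ b) # drop (Suc (Suc ?l)) us"]) auto
    next
      case False
      then have last: "Suc ?l = ?n" using ln by simp
      then have "Suc l mod ?n = 0" by (simp add: mod_Suc)
      then have "fst (us ! ?l) = fst (us ! 0)" using 5(2) by (simp add: per_def)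
      moreover obtain x mid y where us: "us = x # mid @ [y]"
        using 5(1) by (metis One_nat_def Suc_1 append_butlast_last_id length_Cons list.exhaust list.size(3)
            not_less_eq_eq le_zero_eq nat.distinct(1))
      ultimately obtain t a b where ab: "x = (t, a)" "y = (t, b)"
        using last by (cases x; cases y) (auto simp: nth_append)
      have words: "a \<in> words t" "b \<in> words t" "set mid \<subseteq> syls"
        using less.prems by (auto simp: us ab syls_def)
      \<comment> \<open>The first and the last syllable have the same type: a mid b is the conjugate
        of mid (b a) by \<open>a\<close>.\<close>
      have "sval us \<approx> a @ (sval mid @ b) @ a @ winv a"
        using eqv_insert[of "a @ winv a" "a @ sval mid @ b" "[]"] by (simp add: us ab eqv_sym)
      then show ?thesis using words words_sub[OF words(1)]
        by (intro lift[of a "mid @ [(t, b @ a)]"]) (auto simp: us ab syls_def)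
    qed
  qed
qed

lemma cyclic_reduction_word:
  assumes "set w \<subseteq> (B1 \<union> B2) \<times> UNIV"
  shows "\<exists>c u. set c \<subseteq> (B1 \<union> B2) \<times> UNIV \<and> w \<approx> c @ sval u @ winv c \<and>
    length c \<le> length w * length w \<and> length (sval u) \<le> length w \<and>
    set u \<subseteq> syls \<and> length u \<le> max 1 (length w) \<and> (length u = 1 \<or> cycred u)"
proof -
  let ?us = "map (\<lambda>l. (fst l \<in> B1, [l])) w"
  have "sval ?us = w" by (induction w) auto
  moreover have "set ?us \<subseteq> syls" using assms by (auto simp: syls_def words_def)
  ultimately show ?thesis using cyclic_reduction[of ?us] by simp
qed

definition letter_atoms :: "('a \<times> bool) list \<Rightarrow> ('a \<times> bool) atom list" where
  "letter_atoms w = map (\<lambda>l. At (fst l \<in> B1) (Con [l])) w"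

lemma letter_atoms_simps [simp]:
  "sval (exs y (letter_atoms w)) = w" "vars (letter_atoms w) = []" "wt (letter_atoms w) = 4 * length w"
  by (induction w) (auto simp: letter_atoms_def)

theorem tame_on_free_product:
  assumes "tame_on B1" "tame_on B2"
  shows "tame_on (B1 \<union> B2)"
proof -
  obtain p1 :: "nat poly" where p1: "\<And>es y. (\<forall>e\<in>set es. set (iword e) \<subseteq> B1 \<times> UNIV) \<Longrightarrow> distinct (evars es) \<Longrightarrow>
      y \<in> sols es \<Longrightarrow> good_at (\<lambda>_. 1) (poly p1 (esize es)) (sols es) y"
    using assms(1) unfolding tame_on_def by blast
  obtain p2 :: "nat poly" where p2: "\<And>es y. (\<forall>e\<in>set es. set (iword e) \<subseteq> B2 \<times> UNIV) \<Longrightarrow> distinct (evars es) \<Longrightarrow>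
      y \<in> sols es \<Longrightarrow> good_at (\<lambda>_. 1) (poly p2 (esize es)) (sols es) y"
    using assms(2) unfolding tame_on_def by blast
  obtain cf uf where cu: "\<And>w. set w \<subseteq> (B1 \<union> B2) \<times> UNIV \<Longrightarrow>
    set (cf w) \<subseteq> (B1 \<union> B2) \<times> UNIV \<and> w \<approx> cf w @ sval (uf w) @ winv (cf w) \<and>
    length (cf w) \<le> length w * length w \<and> length (sval (uf w)) \<le> length w \<and>
    set (uf w) \<subseteq> syls \<and> length (uf w) \<le> max 1 (length w) \<and> (length (uf w) = 1 \<or> cycred (uf w))"
    using cyclic_reduction_word by metis
  \<comment> \<open>\<open>pW\<close> bounds the weight: a power of \<open>w\<close> has two
    conjugators with at most the square of \<open>length w\<close> letters of weight 4 each, and a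
    core of weight at most 4. \<open>pn\<close> is \<open>N * (Wt + 2)\<close> with
    \<open>N = S + 2\<close>, and \<open>p\<close> is \<open>C * Wt\<close>.\<close>
  define pW :: "nat poly" where "pW = [:8:] * [:0, 1:] ^ 2"
  define pn :: "nat poly" where "pn = [:2, 1:] * (pW + [:2:])"
  define p :: "nat poly" where "p = (pcompose (p1 + p2) pn + pW + 1 + [:1, 1:] ^ 2) * pW"
  have "good_at (\<lambda>_. 1) (poly p (esize es)) (sols es) y"
    if es: "\<forall>e\<in>set es. set (iword e) \<subseteq> (B1 \<union> B2) \<times> UNIV" and dist: "distinct (evars es)"
      and y: "y \<in> sols es" for es y
  proof -
    define S where "S = esize es"
    \<comment> \<open>The number of syllables in the core of the unique power with variable
      \<open>i\<close>, and 1 for a variable that does not occur.\<close>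
    define m where "m i = (if \<exists>w. Var i w \<in> set es then length (uf (SOME w. Var i w \<in> set es)) else 1)" for i
    define core where "core i w = (if length (uf w) = 1 then At (fst (hd (uf w))) (Var i (snd (hd (uf w))))
      else Per i (uf w) 0)" for i w
    define conv where "conv e = (case e of Con w \<Rightarrow> letter_atoms w
      | Var i w \<Rightarrow> letter_atoms (cf w) @ [core i w] @ letter_atoms (winv (cf w)))" for e
    define as where "as = concat (map conv es)"
    have m_eq: "m i = length (uf w)" if "Var i w \<in> set es" for i w
    proof -
      have "Var i (SOME w. Var i w \<in> set es) \<in> set es" using that by (rule someI)
      then have "(SOME w. Var i w \<in> set es) = w" using that by (rule distinct_evars_unique[OF dist])
      then show ?thesis using that unfolding m_def by auto
    qed
    have m_bounds: "0 < m i" "m i \<le> S + 1" for i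
    proof -
      have "0 < m i \<and> m i \<le> S + 1"
      proof (cases "\<exists>w. Var i w \<in> set es")
        case True
        then obtain w where w: "Var i w \<in> set es" by blast
        have "length w + 1 \<le> S" using esize_mem[OF w] by (simp add: S_def)
        moreover have ww: "set w \<subseteq> (B1 \<union> B2) \<times> UNIV" using es w by force
        have "length (uf w) \<le> max 1 (length w)" "0 < length (uf w)"
          using cu[OF ww] unfolding cycred_def by linarith+
        ultimately show ?thesis using m_eq[OF w] by simp
      qed (simp add: m_def)
      then show "0 < m i" "m i \<le> S + 1" by auto
    qed
    have vars_conv: "vars (conv e) = ivars e" for e
      by (auto simp: conv_def core_def split: item.splits)
    have vars_as: "vars as = evars es"
      unfolding as_def by (induction es) (auto simp: vars_conv)
    have exs_conv: "sval (exs (\<lambda>i. m i * z i) (conv e)) \<approx> ieval z e" if "e \<in> set es" for z e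
    proof (cases e)
      case (Con w)
      then show ?thesis by (simp add: conv_def)
    next
      case (Var i w)
      have w: "set w \<subseteq> (B1 \<union> B2) \<times> UNIV" using es that Var by force
      have mi: "m i = length (uf w)" using m_eq that Var by simp
      have "sval (ex (\<lambda>i. m i * z i) (core i w)) = wpow (sval (uf w)) (z i)"
      proof (cases "length (uf w) = 1")
        case True
        then obtain t v where "uf w = [(t, v)]" by (metis One_nat_def length_0_conv length_Suc_conv surj_pair)
        then show ?thesis by (simp add: core_def mi)
      next
        case False
        then show ?thesis using sval_per[of "uf w" "z i"] by (simp add: core_def mi)
      qed
      then have "sval (exs (\<lambda>i. m i * z i) (conv e)) = cf w @ wpow (sval (uf w)) (z i) @ winv (cf w)"
        by (simp add: Var conv_def)
      also have "\<dots> \<approx> wpow (cf w @ sval (uf w) @ winv (cf w)) (z i)"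
        by (rule eqv_sym, rule wpow_conj)
      also have "\<dots> \<approx> wpow w (z i)" using cu[OF w] by (intro eqv_wpow) (simp add: eqv_sym)
      finally show ?thesis by (simp add: Var)
    qed
    have exs_as: "sval (exs (\<lambda>i. m i * z i) as) \<approx> eval z es" for z
    proof -
      have "set fs \<subseteq> set es \<Longrightarrow> sval (exs (\<lambda>i. m i * z i) (concat (map conv fs))) \<approx> eval z fs" for fs
        by (induction fs) (auto intro: eqv_append exs_conv)
      then show ?thesis by (auto simp: as_def)
    qed
    \<comment> \<open>An exponent \<open>z i\<close> corresponds to \<open>m i * z i\<close>
      syllables, a whole number of periods. This is also right for single-syllable cores, where
      \<open>m i\<close> is 1.\<close>
    have mem_iff: "(\<lambda>i. m i * z i) \<in> bsols [] as \<longleftrightarrow> z \<in> sols es" for z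
    proof -
      have "m i * z i = 0 \<longleftrightarrow> z i = 0" for i using m_bounds(1)[of i] by simp
      then have "supported (evars es) (\<lambda>i. m i * z i) \<longleftrightarrow> supported (evars es) z"
        by (simp only: supported_def)
      then show ?thesis
        using eqv_triv[OF exs_as[of z]] by (simp add: bsols_def sols_def vars_as)
    qed
    have wt_conv: "wt (conv e) \<le> 8 * (length (iword e) + 1)\<^sup>2" if "e \<in> set es" for e
    proof (cases e)
      case (Con w)
      then show ?thesis by (simp add: conv_def power2_eq_square)
    next
      case (Var i w)
      have "set w \<subseteq> (B1 \<union> B2) \<times> UNIV" using es that Var by force
      then have "length (cf w) \<le> length w * length w" using cu by blast
      moreover have "wt [core i w] \<le> 4" by (simp add: core_def)
      ultimately show ?thesis by (simp add: Var conv_def power2_eq_square)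
    qed
    have wt_as: "wt as \<le> 8 * S\<^sup>2"
    proof -
      have "set fs \<subseteq> set es \<Longrightarrow> wt (concat (map conv fs)) \<le> 8 * (esize fs)\<^sup>2" for fs
      proof (induction fs)
        case (Cons e fs)
        then have "wt (conv e) \<le> 8 * (length (iword e) + 1)\<^sup>2" "wt (concat (map conv fs)) \<le> 8 * (esize fs)\<^sup>2"
          using wt_conv by auto
        moreover have "(length (iword e) + 1)\<^sup>2 + (esize fs)\<^sup>2 \<le> (esize (e # fs))\<^sup>2"
          by (simp add: power2_eq_square algebra_simps)
        ultimately show ?case by simp
      qed simp
      then show ?thesis by (auto simp: as_def S_def)
    qed
    define n where "n = (S + 2) * (8 * S\<^sup>2 + 2)"
    define P where "P = poly (p1 + p2) n"
    define C where "C = P + 8 * S\<^sup>2 + 1 + (S + 1)\<^sup>2"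
    define N where "N = S + 2"
    have N_ge: "2 \<le> N" by (simp add: N_def)
    interpret core: free_core I B1 B2 m N n P C "8 * S\<^sup>2" "(S + 1)\<^sup>2"
    proof
      fix es' t y' assume h: "\<forall>e\<in>set es'. iword e \<in> words t" "distinct (evars es')" "esize es' \<le> n" "y' \<in> sols es'"
      let ?q = "if t then p1 else p2"
      have "good_at (\<lambda>_. 1) (poly ?q (esize es')) (sols es') y'"
        using h p1[of es' y'] p2[of es' y'] by (auto simp: words_def)
      moreover have "poly ?q (esize es') \<le> poly ?q n" using h(3) by (rule poly_nat_mono)
      then have "poly ?q (esize es') \<le> P" by (auto simp: P_def)
      ultimately show "good_at (\<lambda>_. 1) P (sols es') y'" by (rule good_at_mono) simp
    next
      show "m i * m j \<le> (S + 1)\<^sup>2" for i j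
        using m_bounds(2)[of i] m_bounds(2)[of j] by (simp add: power2_eq_square mult_le_mono del: add_Suc_right)
    qed (simp_all add: n_def C_def N_def)
    have ok_letter: "\<forall>A\<in>set (letter_atoms w). core.ok A" if "set w \<subseteq> (B1 \<union> B2) \<times> UNIV" for w
      using that N_ge by (auto simp: letter_atoms_def words_def)
    have ok_conv: "\<forall>A\<in>set (conv e). core.ok A" if "e \<in> set es" for e
    proof (cases e)
      case (Con w)
      then show ?thesis using ok_letter es that by (force simp: conv_def)
    next
      case (Var i w)
      have w: "set w \<subseteq> (B1 \<union> B2) \<times> UNIV" using es that Var by force
      note cu = cu[OF w]
      have mi: "m i = length (uf w)" using m_eq that Var by simp
      have "length w + 1 \<le> S" using esize_mem[OF that] Var by (simp add: S_def)
      then have syl: "length (snd x) + 1 \<le> N" if "x \<in> set (uf w)" for x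
      proof -
        have "length (snd x) \<le> length (sval (uf w))" using that by (induction "uf w") (auto simp: sval_def member_le_sum_list length_concat)
        then show ?thesis using cu \<open>length w + 1 \<le> S\<close> unfolding N_def by linarith
      qed
      have "core.ok (core i w)"
      proof (cases "length (uf w) = 1")
        case True
        then have "hd (uf w) \<in> set (uf w)" by (cases "uf w") auto
        then show ?thesis using True cu syl[of "hd (uf w)"] mi by (auto simp: core_def syls_def)
      next
        case False
        then have "cycred (uf w)" using cu by blast
        then show ?thesis using False syl mi unfolding core_def by simp
      qed
      then show ?thesis
        using ok_letter[of "cf w"] ok_letter[OF set_winv_subset, of "cf w"] cu
        by (auto simp: Var conv_def)
    qed
    have "good_at m (C * (wt as - 3)) (bsols [] as) (\<lambda>i. m i * y i)"
    proof (rule core.solved_uptoD[OF core.solved_all wt_as])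
      show "\<forall>A\<in>set as. core.ok A" using ok_conv by (auto simp: as_def)
      show "distinct (vars as)" using dist vars_as by simp
      show "(\<lambda>i. m i * y i) \<in> bsols [] as" using y mem_iff by blast
    qed
    then have "good_at (\<lambda>_. 1) (C * (wt as - 3)) (sols es) y"
      by (rule good_at_unscale) (use m_bounds(1) mem_iff in blast)+
    moreover have "C * (wt as - 3) \<le> C * (8 * S\<^sup>2)" using wt_as by (intro mult_le_mono2) simp
    then have "C * (wt as - 3) \<le> poly p (esize es)"
      by (simp add: p_def C_def P_def n_def pn_def pW_def poly_pcompose S_def power2_eq_square algebra_simps)
    ultimately show ?thesis by (rule good_at_mono) simp
  qed
  then show ?thesis unfolding tame_on_def by blast
qed

end

section \<open>Tameness with a universal vertex\<close>

lemma submset_of_size: "n \<le> size X \<Longrightarrow> \<exists>Y. Y \<subseteq># X \<and> size Y = n"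
proof (induction n)
  case 0
  then show ?case by (intro exI[of _ "{#}"]) auto
next
  case (Suc n)
  then obtain Y where Y: "Y \<subseteq># X" "size Y = n" by auto
  then have "X - Y \<noteq> {#}" using Suc.prems by (metis size_Diff_submset diff_is_0_eq not_less_eq_eq size_empty order_refl)
  then obtain a where "a \<in># X - Y" by blast
  then have "Y + {#a#} \<subseteq># X" using Y(1)
    by (metis mset_subset_eq_mono_add_right_cancel mset_subset_eq_single subset_mset.le_diff_conv2 add.commute)
  then show ?case using Y(2) by (intro exI[of _ "Y + {#a#}"]) auto
qed

lemma size_filter_partition:
  assumes "finite V"
  shows "size (filter_mset (\<lambda>f. a f \<in> V) X) = (\<Sum>v\<in>V. size (filter_mset (\<lambda>f. a f = v) X))"
proof (induction X)
  case (add x X)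
  have "(\<Sum>v\<in>V. size (filter_mset (\<lambda>f. a f = v) (add_mset x X)))
      = (\<Sum>v\<in>V. (if a x = v then 1 else 0) + size (filter_mset (\<lambda>f. a f = v) X))"
    by (rule sum.cong) auto
  also have "\<dots> = (if a x \<in> V then 1 else 0) + (\<Sum>v\<in>V. size (filter_mset (\<lambda>f. a f = v) X))"
    using assms by (simp add: sum.distrib)
  finally show ?case using add by simp
qed simp

lemma sum_mset_bounds:
  fixes a :: "'x \<Rightarrow> int"
  assumes "\<And>f. f \<in># X \<Longrightarrow> l \<le> a f" "\<And>f. f \<in># X \<Longrightarrow> a f \<le> u"
  shows "l * int (size X) \<le> (\<Sum>f\<in>#X. a f)" "(\<Sum>f\<in>#X. a f) \<le> u * int (size X)"
  using assms by (induction X) (auto simp: algebra_simps intro: add_mono)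

text \<open>There are at most \<open>K\<close> negative values, each taken fewer than
  \<open>K\<close> times, and together they contribute at least the negative of
  \<open>K ^ 3\<close>. So the positive part has sum at most \<open>D + K ^ 3\<close>, and each of
  its members contributes at least 1.\<close>

lemma few_negatives_size:
  fixes a :: "'x \<Rightarrow> int" and K :: nat
  assumes bound: "\<And>f. f \<in># X \<Longrightarrow> \<bar>a f\<bar> \<le> int K" and nz: "\<And>f. f \<in># X \<Longrightarrow> a f \<noteq> 0"
    and few: "\<And>v. v < 0 \<Longrightarrow> size (filter_mset (\<lambda>f. a f = v) X) < K"
    and sum: "(\<Sum>f\<in>#X. a f) \<le> int D"
  shows "size X \<le> D + K ^ 3 + K ^ 2"
proof -
  let ?N = "filter_mset (\<lambda>f. a f \<in> {- int K..-1}) X" and ?P = "filter_mset (\<lambda>f. \<not> a f \<in> {- int K..-1}) X"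
  have X: "X = ?N + ?P" by (rule multiset_partition)
  have "size ?N = (\<Sum>v\<in>{- int K..-1}. size (filter_mset (\<lambda>f. a f = v) X))"
    by (rule size_filter_partition) simp
  also have "\<dots> \<le> (\<Sum>v\<in>{- int K..-1}. K)"
    using few by (intro sum_mono) (auto simp: less_imp_le)
  also have "\<dots> = K ^ 2" by (simp add: power2_eq_square)
  finally have N: "size ?N \<le> K ^ 2" .
  have "- int K * int (size ?N) \<le> (\<Sum>f\<in>#?N. a f)"
    by (rule sum_mset_bounds(1)[where u = "-1"]) auto
  moreover have "1 * int (size ?P) \<le> (\<Sum>f\<in>#?P. a f)"
  proof (rule sum_mset_bounds(1)[where u = "int K"])
    fix f assume "f \<in># ?P"
    then show "1 \<le> a f" "a f \<le> int K" using bound[of f] nz[of f] by auto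
  qed
  moreover have "(\<Sum>f\<in>#X. a f) = (\<Sum>f\<in>#?N. a f) + (\<Sum>f\<in>#?P. a f)"
    by (subst X) (simp only: image_mset_union sum_mset.union)
  moreover have "int K * int (size ?N) \<le> int K * int (K ^ 2)"
    using N by (intro mult_left_mono) auto
  ultimately have "int (size ?P) \<le> int D + int K * int (K ^ 2)" using sum by linarith
  then have "int (size ?P) \<le> int (D + K ^ 3)" by (simp add: power3_eq_cube power2_eq_square)
  then have "size ?P \<le> D + K ^ 3" by linarith
  moreover have "size X = size ?N + size ?P" by (subst X) (rule size_union)
  ultimately show ?thesis using N by linarith
qed

lemma zero_sum_submset:
  fixes a :: "'x \<Rightarrow> int" and K :: nat
  assumes bound: "\<And>f. f \<in># X \<Longrightarrow> \<bar>a f\<bar> \<le> int K" and K: "1 \<le> K"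
    and sum: "\<bar>\<Sum>f\<in>#X. a f\<bar> \<le> int D" and big: "D + K ^ 3 + K ^ 2 < size X"
  shows "\<exists>H. H \<subseteq># X \<and> H \<noteq> {#} \<and> size H \<le> 2 * K \<and> (\<Sum>f\<in>#H. a f) = 0"
proof (cases "\<exists>f. f \<in># X \<and> a f = 0")
  case True
  then obtain f where "f \<in># X" "a f = 0" by blast
  then show ?thesis using K by (intro exI[of _ "{#f#}"]) auto
next
  case False
  then have nz: "\<And>f. f \<in># X \<Longrightarrow> a f \<noteq> 0" by blast
  have "\<exists>v<0. K \<le> size (filter_mset (\<lambda>f. a f = v) X)"
  proof (rule ccontr)
    assume "\<not> ?thesis"
    then have "size X \<le> D + K ^ 3 + K ^ 2"
      using sum by (intro few_negatives_size[of X a K D] bound nz) (auto simp: not_le)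
    then show False using big by simp
  qed
  then obtain v where v: "v < 0" "K \<le> size (filter_mset (\<lambda>f. a f = v) X)" by blast
  have "\<exists>u>0. K \<le> size (filter_mset (\<lambda>f. a f = u) X)"
  proof (rule ccontr)
    assume no: "\<not> ?thesis"
    have "(\<Sum>f\<in>#X. - a f) = - (\<Sum>f\<in>#X. a f)" by (induction X) auto
    then have s: "(\<Sum>f\<in>#X. - a f) \<le> int D" using sum by simp
    have "size (filter_mset (\<lambda>f. - a f = w) X) < K" if "w < 0" for w
    proof -
      have "(\<lambda>f. - a f = w) = (\<lambda>f. a f = - w)" by auto
      then show ?thesis using no that by (metis neg_0_less_iff_less not_le)
    qed
    then have "size X \<le> D + K ^ 3 + K ^ 2"
      using s bound nz by (intro few_negatives_size[of X "\<lambda>f. - a f" K D]) auto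
    then show False using big by simp
  qed
  then obtain u where u: "0 < u" "K \<le> size (filter_mset (\<lambda>f. a f = u) X)" by blast
  let ?V = "filter_mset (\<lambda>f. a f = v) X" and ?U = "filter_mset (\<lambda>f. a f = u) X"
  have le: "w \<le> int K \<and> - w \<le> int K" if K_le: "K \<le> size (filter_mset (\<lambda>f. a f = w) X)" for w
  proof -
    have "size (filter_mset (\<lambda>f. a f = w) X) \<noteq> 0" using K_le K by linarith
    then have "filter_mset (\<lambda>f. a f = w) X \<noteq> {#}" by (simp only: size_eq_0_iff_empty not_False_eq_True)
    then obtain f where "f \<in># filter_mset (\<lambda>f. a f = w) X" by (meson multiset_nonemptyE)
    then have "f \<in># X" "a f = w" by auto
    then show ?thesis using bound[of f] by auto
  qed
  \<comment> \<open>Both values are at most \<open>K\<close> in absolute value and occur at least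
    \<open>K\<close> times, so enough copies are available.\<close>
  have "nat u \<le> size ?V" "nat (- v) \<le> size ?U" using u v le[OF u(2)] le[OF v(2)] by linarith+
  then obtain Y Z where YZ: "Y \<subseteq># ?V" "size Y = nat u" "Z \<subseteq># ?U" "size Z = nat (- v)"
    using submset_of_size by metis
  have const: "(\<Sum>f\<in>#W. a f) = w * int (size W)" if "W \<subseteq># filter_mset (\<lambda>f. a f = w) X" for W w
  proof -
    have "a f = w" if "f \<in># W" for f
      using mset_subset_eqD[OF \<open>W \<subseteq># _\<close> that] by simp
    then show ?thesis using sum_mset_bounds[of W w a w] by (simp add: order_antisym)
  qed
  have "?V + ?U \<subseteq># X"
    using u(1) v(1) by (auto simp: subseteq_mset_def)
  then have "Y + Z \<subseteq># X" using YZ(1,3) by (meson subset_mset.add_mono subset_mset.order_trans)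
  moreover have "(\<Sum>f\<in>#Y + Z. a f) = 0"
    using const[OF YZ(1)] const[OF YZ(3)] u(1) v(1) by (simp add: YZ(2,4))
  moreover have "size (Y + Z) \<le> 2 * K" unfolding size_union YZ(2,4) using le[OF u(2)] le[OF v(2)] by linarith
  moreover have "Y + Z \<noteq> {#}" using YZ(2) u(1) by auto
  ultimately show ?thesis by blast
qed

text \<open>Removing a zero-sum block leaves the total unchanged, so \<open>zero_sum_submset\<close>
  applies again with the same \<open>D\<close> until few elements remain.\<close>

lemma zero_sum_decomposition:
  fixes a :: "'x \<Rightarrow> int" and K :: nat
  assumes "\<And>f. f \<in># X \<Longrightarrow> \<bar>a f\<bar> \<le> int K" "1 \<le> K" "\<bar>\<Sum>f\<in>#X. a f\<bar> \<le> int D"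
  shows "\<exists>G Hs. X = G + sum_list Hs \<and> size G \<le> D + K ^ 3 + K ^ 2 \<and>
    (\<forall>H\<in>set Hs. size H \<le> 2 * K \<and> (\<Sum>f\<in>#H. a f) = 0)"
  using assms
proof (induction "size X" arbitrary: X rule: less_induct)
  case less
  show ?case
  proof (cases "size X \<le> D + K ^ 3 + K ^ 2")
    case True
    then show ?thesis by (intro exI[of _ X] exI[of _ "[]"]) auto
  next
    case False
    then obtain H where H: "H \<subseteq># X" "H \<noteq> {#}" "size H \<le> 2 * K" "(\<Sum>f\<in>#H. a f) = 0"
      using zero_sum_submset[of X a K D] less.prems by auto
    then obtain Y where Y: "X = H + Y" by (metis subset_mset.le_iff_add)
    have "\<exists>G Hs. Y = G + sum_list Hs \<and> size G \<le> D + K ^ 3 + K ^ 2 \<and>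
        (\<forall>H\<in>set Hs. size H \<le> 2 * K \<and> (\<Sum>f\<in>#H. a f) = 0)"
    proof (rule less.hyps)
      show "size Y < size X" using H(2) by (simp add: Y nonempty_has_size)
      show "\<bar>\<Sum>f\<in>#Y. a f\<bar> \<le> int D" using less.prems(3) H(4) by (simp add: Y)
    qed (use less.prems in \<open>auto simp: Y\<close>)
    then obtain G Hs where "Y = G + sum_list Hs" "size G \<le> D + K ^ 3 + K ^ 2"
        "\<forall>H\<in>set Hs. size H \<le> 2 * K \<and> (\<Sum>f\<in>#H. a f) = 0" by blast
    then show ?thesis using H by (intro exI[of _ G] exI[of _ "H # Hs"]) (auto simp: Y ac_simps)
  qed
qed

section \<open>The exponent sum of the universal vertex\<close>

definition esum :: "'a \<Rightarrow> ('a \<times> bool) list \<Rightarrow> int" where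
  "esum r w = (\<Sum>l\<leftarrow>w. if fst l = r then (if snd l then 1 else - 1) else 0)"

lemma esum_simps [simp]:
  "esum r [] = 0" "esum r (l # w) = (if fst l = r then (if snd l then 1 else - 1) else 0) + esum r w"
  "esum r (u @ v) = esum r u + esum r v"
  by (simp_all add: esum_def)

lemma esum_wpow: "esum r (wpow w n) = int n * esum r w"
  by (induction n) (auto simp: algebra_simps)

lemma esum_bound: "\<bar>esum r w\<bar> \<le> int (length w)"
  by (induction w) auto

lemma filter_wpow: "filter P (wpow w n) = wpow (filter P w) n"
  by (induction n) auto

context graph
begin

text \<open>Deleting letters is a retraction: a defining relation stays a relation or turns into an
  equality of words.\<close>

lemma eqv_filter:
  assumes "u \<approx> v"
  shows "filter (\<lambda>l. fst l \<in> D) u \<approx> filter (\<lambda>l. fst l \<in> D) v"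
  using assms unfolding eqv_def
proof (induction rule: pres_cong.induct)
  case (rel u v)
  then obtain a b where "u = [(a, True), (b, True)]" "v = [(b, True), (a, True)]" by (auto simp: comm_rels_def)
  then show ?case using rel by (auto intro: pres_cong.intros)
next
  case (trans u v w)
  then show ?case by (blast intro: pres_cong.trans)
qed (auto intro: pres_cong.intros)

lemma eqv_esum: "u \<approx> v \<Longrightarrow> esum r u = esum r v"
  unfolding eqv_def by (induction rule: pres_cong.induct) (auto simp: comm_rels_def)

lemma comm_winv:
  assumes "x @ y \<approx> y @ x"
  shows "winv x @ y \<approx> y @ winv x"
proof -
  have "winv x @ y \<approx> winv x @ (y @ x) @ winv x"
    using eqv_insert[of "x @ winv x" "winv x @ y" "[]"] by (simp add: eqv_sym)
  also have "\<dots> \<approx> winv x @ (x @ y) @ winv x"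
    by (rule eqv_append[OF eqv_refl eqv_append[OF eqv_sym[OF assms] eqv_refl]])
  also have "\<dots> \<approx> y @ winv x"
    using eqv_insert[of "winv x @ x" "[]" "y @ winv x"] by simp
  finally show ?thesis .
qed

lemma comm_letters:
  assumes "(r, c) \<in> I"
  shows "[(r, s)] @ [(c, t)] \<approx> [(c, t)] @ [(r, s)]"
proof -
  have inv: "winv [(x, True)] = [(x, False)]" for x :: 'a by (simp add: winv_def)
  have "[(r, True)] @ [(c, True)] \<approx> [(c, True)] @ [(r, True)]"
    unfolding eqv_def using assms by (intro pres_cong.rel) (auto simp: comm_rels_def)
  then have c: "[(r, s)] @ [(c, True)] \<approx> [(c, True)] @ [(r, s)]"
    using comm_winv[of "[(r, True)]" "[(c, True)]"] by (cases s) (auto simp: inv)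
  show ?thesis
  proof (cases t)
    case False
    have "[(c, False)] @ [(r, s)] \<approx> [(r, s)] @ [(c, False)]"
      using comm_winv[OF eqv_sym[OF c]] by (simp add: inv)
    then show ?thesis using False by (auto intro: eqv_sym)
  qed (use c in auto)
qed

lemma comm_word:
  assumes "\<And>l. l \<in> set w \<Longrightarrow> (r, fst l) \<in> I"
  shows "[(r, s)] @ w \<approx> w @ [(r, s)]"
  using assms
proof (induction w)
  case (Cons l w)
  have "[(r, s)] @ [l] \<approx> [l] @ [(r, s)]"
    using comm_letters[of r "fst l" s "snd l"] Cons.prems by simp
  then have "([(r, s)] @ [l]) @ w \<approx> ([l] @ [(r, s)]) @ w"
    by (rule eqv_append[OF _ eqv_refl])
  also have "([l] @ [(r, s)]) @ w = [l] @ ([(r, s)] @ w)" by simp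
  also have "\<dots> \<approx> [l] @ (w @ [(r, s)])"
    using Cons by (intro eqv_append[OF eqv_refl]) auto
  finally show ?case by simp
qed simp

lemma split_universal:
  assumes "set w \<subseteq> insert r C \<times> UNIV" "r \<notin> C" "\<And>c. c \<in> C \<Longrightarrow> (r, c) \<in> I"
  shows "w \<approx> filter (\<lambda>l. fst l \<in> C) w @ filter (\<lambda>l. fst l \<in> {r}) w"
  using assms(1)
proof (induction w)
  case (Cons l w)
  let ?fC = "filter (\<lambda>l. fst l \<in> C)" and ?fr = "filter (\<lambda>l. fst l \<in> {r})"
  have e: "[l] @ w \<approx> [l] @ ?fC w @ ?fr w" using Cons by (intro eqv_append) auto
  show ?case
  proof (cases "fst l = r")
    case True
    have "[l] @ ?fC w \<approx> ?fC w @ [l]"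
      using comm_word[of "?fC w" r "snd l"] assms(3) True by (cases l) auto
    then have "([l] @ ?fC w) @ ?fr w \<approx> (?fC w @ [l]) @ ?fr w"
      by (rule eqv_append[OF _ eqv_refl])
    with e have "[l] @ w \<approx> (?fC w @ [l]) @ ?fr w" by (auto intro: eqv_trans)
    then show ?thesis using True assms(2) by simp
  next
    case False
    then have "fst l \<in> C" using Cons.prems by auto
    then show ?thesis using e False by simp
  qed
qed simp

lemma single_letter_word:
  assumes "set w \<subseteq> {r} \<times> UNIV"
  shows "w \<approx> (if 0 \<le> esum r w then wpow [(r, True)] (nat (esum r w)) else wpow [(r, False)] (nat (- esum r w)))"
    (is "w \<approx> ?p (esum r w)")
  using assms
proof (induction w)
  case (Cons l w)
  have tr: "triv [(r, s), (r, \<not> s)]" for s unfolding eqv_def by (rule pres_cong.cancel) simp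
  obtain s where l: "l = (r, s)" using Cons.prems by auto
  have "[l] @ w \<approx> [l] @ ?p (esum r w)" using Cons by (intro eqv_append) auto
  also have "[l] @ ?p z \<approx> ?p ((if s then 1 else - 1) + z)" for z
  proof -
    consider "s" "0 \<le> z" | "s" "z < 0" | "\<not> s" "0 < z" | "\<not> s" "z \<le> 0" by linarith
    then show ?thesis
    proof cases
      case 1
      then have "nat (1 + z) = Suc (nat z)" by simp
      then show ?thesis using 1 by (simp add: l)
    next
      case 2
      then have n: "nat (- z) = Suc (nat (- (1 + z)))" by simp
      have "[(r, True), (r, False)] @ wpow [(r, False)] (nat (- (1 + z))) \<approx> wpow [(r, False)] (nat (- (1 + z)))"
        using eqv_insert[OF tr[of True], of "[]"] by simp
      moreover have "?p (1 + z) = wpow [(r, False)] (nat (- (1 + z)))" using 2 by auto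
      ultimately show ?thesis using 2 tr[of True] by (simp add: l n)
    next
      case 3
      then have n: "nat z = Suc (nat (- 1 + z))" by simp
      have "[(r, False), (r, True)] @ wpow [(r, True)] (nat (- 1 + z)) \<approx> wpow [(r, True)] (nat (- 1 + z))"
        using eqv_insert[OF tr[of False], of "[]"] by simp
      then show ?thesis using 3 by (simp add: l n)
    next
      case 4
      then have "nat (- (- 1 + z)) = Suc (nat (- z))" by simp
      moreover have "?p z = wpow [(r, False)] (nat (- z))" using 4 by auto
      ultimately show ?thesis using 4 by (simp add: l)
    qed
  qed
  also have "(if s then 1 else - 1) + esum r w = esum r (l # w)" by (simp add: l)
  finally show ?case by (simp only: append_Cons append_Nil)
qed simp

text \<open>\<open>r\<close> is central on these words, so their group is the direct product of the
  group on \<open>C\<close> and the infinite cyclic group of \<open>r\<close>; the filter and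
  \<open>esum\<close> are the two projections.\<close>

theorem triv_universal:
  assumes "set w \<subseteq> insert r C \<times> UNIV" "r \<notin> C" "\<And>c. c \<in> C \<Longrightarrow> (r, c) \<in> I"
  shows "triv w \<longleftrightarrow> triv (filter (\<lambda>l. fst l \<in> C) w) \<and> esum r w = 0"
proof
  assume "triv w"
  then show "triv (filter (\<lambda>l. fst l \<in> C) w) \<and> esum r w = 0"
    using eqv_filter[of w "[]" C] eqv_esum[of w "[]" r] by simp
next
  assume h: "triv (filter (\<lambda>l. fst l \<in> C) w) \<and> esum r w = 0"
  have sub: "set (filter (\<lambda>l. fst l \<in> {r}) w) \<subseteq> {r} \<times> UNIV" by auto
  have "esum r (filter (\<lambda>l. fst l \<in> {r}) w) = esum r w" by (induction w) auto
  then have "triv (filter (\<lambda>l. fst l \<in> {r}) w)"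
    using single_letter_word[OF sub] h by simp
  then have "triv (filter (\<lambda>l. fst l \<in> C) w @ filter (\<lambda>l. fst l \<in> {r}) w)"
    using h triv_append_left by blast
  then show "triv w" using eqv_triv[OF split_universal[OF assms]] by blast
qed

end

primrec item_apply :: "('l list \<Rightarrow> 'k list) \<Rightarrow> 'l item \<Rightarrow> 'k item" where
  "item_apply f (Con w) = Con (f w)"
| "item_apply f (Var i w) = Var i (f w)"

lemma evars_item_apply [simp]: "evars (map (item_apply f) es) = evars es"
proof -
  have "ivars (item_apply f e) = ivars e" for e by (cases e) auto
  then show ?thesis by (simp add: evars_def comp_def)
qed

lemma eval_map_filter: "eval y (map (item_apply (filter Q)) es) = filter Q (eval y es)"
proof -
  have "ieval y (item_apply (filter Q) e) = filter Q (ieval y e)" for e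
    by (cases e) (auto simp: filter_wpow)
  then show ?thesis by (induction es) auto
qed

lemma esize_map_filter: "esize (map (item_apply (filter Q)) es) \<le> esize es"
proof -
  have "length (iword (item_apply (filter Q) e)) \<le> length (iword e)" for e by (cases e) auto
  then show ?thesis by (induction es) (auto intro: add_mono)
qed

text \<open>The part of the exponent sum that is linear in the exponents; the constant part is that
  of \<open>eval 0 es\<close>, where all powers vanish.\<close>

definition lin :: "'a \<Rightarrow> ('a \<times> bool) item list \<Rightarrow> (nat \<Rightarrow> nat) \<Rightarrow> int" where
  "lin r es y = (\<Sum>e\<leftarrow>es. case e of Con w \<Rightarrow> 0 | Var i w \<Rightarrow> int (y i) * esum r w)"

lemma lin_Cons: "lin r (e # es) y = (case e of Con w \<Rightarrow> 0 | Var i w \<Rightarrow> int (y i) * esum r w) + lin r es y"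
  by (simp add: lin_def)

lemma lin_zero [simp]: "lin r es 0 = 0"
  by (induction es) (auto simp: lin_Cons lin_def split: item.splits)

lemma lin_plus: "lin r es (y + z) = lin r es y + lin r es z"
  by (induction es) (auto simp: lin_Cons lin_def distrib_right split: item.splits)

lemma lin_sum_list: "lin r es (sum_list fs) = (\<Sum>f\<leftarrow>fs. lin r es f)"
  by (induction fs) (simp_all only: sum_list.Nil sum_list.Cons list.map lin_plus lin_zero)

lemma esum_eval: "esum r (eval y es) = esum r (eval 0 es) + lin r es y"
  by (induction es) (auto simp: lin_Cons lin_def esum_wpow split: item.splits)

lemma lin_bound:
  assumes "\<forall>i. y i \<le> M"
  shows "\<bar>lin r es y\<bar> \<le> int (M * esize es)"
proof (induction es)
  case (Cons e es)
  have "\<bar>case e of Con w \<Rightarrow> 0 | Var i w \<Rightarrow> int (y i) * esum r w\<bar> \<le> int (M * (length (iword e) + 1))"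
  proof (cases e)
    case (Var i w)
    have "int (y i) * \<bar>esum r w\<bar> \<le> int M * int (length w + 1)"
      using assms esum_bound[of r w] by (intro mult_mono) auto
    then show ?thesis by (simp only: Var item.case item.sel abs_mult abs_of_nat of_nat_mult)
  qed simp
  then show ?case using Cons by (simp add: lin_Cons algebra_simps)
qed (simp add: lin_def)

lemma esum_const_bound: "\<bar>esum r (eval 0 es)\<bar> \<le> int (esize es)"
proof (induction es)
  case (Cons e es)
  have "\<bar>esum r (ieval 0 e)\<bar> \<le> int (length (iword e) + 1)"
    using esum_bound[of r "iword e"] by (cases e) auto
  then show ?case using Cons unfolding eval_simps esum_simps esize_simps by linarith
qed simp

lemma sum_list_le_bound:
  fixes fs :: "(nat \<Rightarrow> nat) list"
  assumes "\<forall>f\<in>set fs. f i \<le> M"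
  shows "sum_list fs i \<le> length fs * M"
  using assms by (induction fs) auto

context graph
begin

text \<open>The solution is a base plus a list of periods for the equation over \<open>C\<close>.
  Since base and solution are bounded or fixed in the remaining linear condition, the values of
  \<open>lin\<close> on these periods have a small sum, to which
  \<open>zero_sum_decomposition\<close> applies.\<close>

theorem tame_on_universal:
  assumes "tame_on C" "r \<notin> C" "\<And>c. c \<in> C \<Longrightarrow> (r, c) \<in> I"
  shows "tame_on (insert r C)"
proof -
  obtain p :: "nat poly" where p: "\<And>es y. (\<forall>e\<in>set es. set (iword e) \<subseteq> C \<times> UNIV) \<Longrightarrow> distinct (evars es) \<Longrightarrow>
      y \<in> sols es \<Longrightarrow> good_at (\<lambda>_. 1) (poly p (esize es)) (sols es) y"
    using assms(1) unfolding tame_on_def by blast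
  define pK where "pK = p * [:0, 1:] + 1"
  define pN where "pN = [:0, 1:] + p * [:0, 1:] + pK ^ 3 + pK ^ 2"
  define q where "q = p * (1 + pN + 2 * pK)"
  have "good_at (\<lambda>_. 1) (poly q (esize es)) (sols es) y"
    if es: "\<forall>e\<in>set es. set (iword e) \<subseteq> insert r C \<times> UNIV" and dist: "distinct (evars es)"
      and y: "y \<in> sols es" for es y
  proof -
    let ?Q = "\<lambda>l :: 'a \<times> bool. fst l \<in> C"
    let ?es = "map (item_apply (filter ?Q)) es"
    define S where "S = esize es"
    define M where "M = poly p S"
    \<comment> \<open>\<open>M * S\<close> bounds \<open>lin\<close> on vectors with entries at most
      \<open>M\<close>; adding 1 makes \<open>K\<close> positive. \<open>D\<close> bounds the
      constant term together with the value at the base \<open>x\<close>.\<close>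
    define K where "K = M * S + 1"
    define D where "D = S + M * S"
    define N where "N = D + K ^ 3 + K ^ 2"
    have word: "set (eval z es) \<subseteq> insert r C \<times> UNIV" for z
    proof -
      have "set (ieval z e) \<subseteq> insert r C \<times> UNIV" if "e \<in> set es" for e
        using es that set_wpow by (cases e) fastforce+
      then show ?thesis by (auto simp: eval_def)
    qed
    have sols: "z \<in> sols es \<longleftrightarrow> z \<in> sols ?es \<and> esum r (eval 0 es) + lin r es z = 0" for z
      using triv_universal[OF word assms(2,3)] esum_eval[of r z es]
      by (auto simp: sols_def eval_map_filter)
    have "\<forall>e\<in>set ?es. set (iword e) \<subseteq> C \<times> UNIV"
    proof -
      have "set (iword (item_apply (filter ?Q) e)) \<subseteq> C \<times> UNIV" for e :: "('a \<times> bool) item"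
        by (cases e) auto
      then show ?thesis by simp
    qed
    then have "good_at (\<lambda>_. 1) (poly p (esize ?es)) (sols ?es) y"
      using p[of ?es y] dist y sols by simp
    then have "good_at (\<lambda>_. 1) M (sols ?es) y"
      by (rule good_at_mono) (auto simp: M_def S_def intro: poly_nat_mono esize_map_filter)
    then obtain x F where F: "finite F" "\<forall>i. x i \<le> M" "\<forall>f\<in>F. \<forall>i. f i \<le> M"
        "y \<in> linear_set x F" "linear_set x F \<subseteq> sols ?es"
      unfolding good_at_def by blast
    obtain fs where fs: "set fs \<subseteq> F" "y = x + sum_list fs" using F(4) unfolding linear_set_iff by blast
    let ?a = "lin r es"
    have a_bound: "\<bar>?a f\<bar> \<le> int K" if "f \<in> F" for f
      using lin_bound[of f M r es] F(3) that by (simp add: K_def S_def)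
    have tot: "esum r (eval 0 es) + ?a x + (\<Sum>f\<in>#mset fs. ?a f) = 0"
      using y sols[of y] by (simp add: fs(2) lin_plus lin_sum_list sum_mset_sum_list flip: mset_map)
    have "\<bar>?a x\<bar> \<le> int (M * S)" "\<bar>esum r (eval 0 es)\<bar> \<le> int S"
      using lin_bound[of x M r es] F(2) esum_const_bound by (simp_all add: S_def)
    then have D: "\<bar>\<Sum>f\<in>#mset fs. ?a f\<bar> \<le> int D" using tot unfolding D_def by linarith
    have "\<exists>G Hs. mset fs = G + sum_list Hs \<and> size G \<le> D + K ^ 3 + K ^ 2 \<and>
        (\<forall>H\<in>set Hs. size H \<le> 2 * K \<and> (\<Sum>f\<in>#H. ?a f) = 0)"
      using a_bound fs(1) D by (intro zero_sum_decomposition) (auto simp: K_def)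
    then obtain G Hs where GH: "mset fs = G + sum_list Hs" "size G \<le> N"
        "\<forall>H\<in>set Hs. size H \<le> 2 * K \<and> (\<Sum>f\<in>#H. ?a f) = 0"
      unfolding N_def by blast
    obtain g where g: "mset g = G" using ex_mset by blast
    have gF: "set g \<subseteq> F"
    proof -
      have "set_mset G \<subseteq> set_mset (mset fs)" unfolding GH(1) by simp
      then show ?thesis using fs(1) unfolding g[symmetric] by simp
    qed
    define blocks where "blocks = {hs. set hs \<subseteq> F \<and> length hs \<le> 2 * K \<and> (\<Sum>f\<leftarrow>hs. ?a f) = 0}"
    define F' where "F' = sum_list ` blocks"
    define x' where "x' = x + sum_list g"
    have "finite blocks"
      unfolding blocks_def by (rule finite_subset[OF _ finite_lists_length_le[OF F(1), of "2 * K"]]) auto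
    then have "finite F'" by (simp add: F'_def)
    moreover have "x' i \<le> M * (1 + N + 2 * K)" for i
    proof -
      have "sum_list g i \<le> length g * M" using gF F(3) by (intro sum_list_le_bound) auto
      also have "\<dots> \<le> N * M" using GH(2) g by (intro mult_le_mono1) (metis size_mset)
      finally show ?thesis using F(2)[rule_format, of i] by (simp add: x'_def algebra_simps)
    qed
    moreover have "f i \<le> M * (1 + N + 2 * K)" if "f \<in> F'" for f i
    proof -
      obtain hs where hs: "hs \<in> blocks" "f = sum_list hs" using \<open>f \<in> F'\<close> by (auto simp: F'_def)
      then have "f i \<le> length hs * M" using F(3) by (auto simp: blocks_def intro!: sum_list_le_bound)
      also have "\<dots> \<le> 2 * K * M" using hs(1) by (intro mult_le_mono1) (auto simp: blocks_def)
      finally show ?thesis by (simp add: algebra_simps)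
    qed
    moreover have "y \<in> linear_set x' F'"
    proof -
      have Hs: "\<exists>hs. hs \<in> blocks \<and> sum_list hs = sum_mset H" if "H \<in> set Hs" for H
      proof -
        obtain hs where hs: "mset hs = H" using ex_mset by blast
        have "H \<subseteq># sum_list Hs" using \<open>H \<in> set Hs\<close> by (induction Hs) (auto intro: subset_mset.order_trans)
        then have "set_mset H \<subseteq> set_mset (mset fs)" unfolding GH(1) by (auto dest: mset_subset_eqD)
        then have "set hs \<subseteq> F" using fs(1) hs by auto
        moreover have "length hs \<le> 2 * K" using GH(3) \<open>H \<in> set Hs\<close> hs by (metis size_mset)
        moreover have "(\<Sum>f\<leftarrow>hs. ?a f) = 0"
          using GH(3) \<open>H \<in> set Hs\<close> hs by (metis mset_map sum_mset_sum_list)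
        ultimately show ?thesis using hs by (intro exI[of _ hs]) (auto simp: blocks_def sum_mset_sum_list)
      qed
      have "set (map sum_mset Hs) \<subseteq> F'" using Hs unfolding F'_def by force
      moreover have "sum_mset (sum_list Hs) = sum_list (map sum_mset Hs)" by (induction Hs) auto
      then have "sum_list fs = sum_list g + sum_list (map sum_mset Hs)"
        using arg_cong[OF GH(1), of sum_mset] by (simp add: sum_mset_sum_list flip: g)
      then have "y = x' + sum_list (map sum_mset Hs)" by (simp add: fs(2) x'_def add.assoc)
      ultimately show ?thesis unfolding linear_set_iff by blast
    qed
    moreover have "linear_set x' F' \<subseteq> sols es"
    proof
      fix z assume "z \<in> linear_set x' F'"
      then obtain zs where zs: "set zs \<subseteq> sum_list ` blocks" "z = x' + sum_list zs"
        unfolding linear_set_iff F'_def by blast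
      \<comment> \<open>Any choice of new periods flattens to a list of old periods on which
        \<open>lin\<close> sums to 0, so the linear condition keeps holding.\<close>
      have "\<exists>hs. set hs \<subseteq> F \<and> (\<Sum>f\<leftarrow>hs. ?a f) = 0 \<and> sum_list hs = sum_list zs"
        using zs(1)
      proof (induction zs)
        case Nil
        then show ?case by (intro exI[of _ "[]"]) auto
      next
        case (Cons h zs)
        then obtain hs where hs: "set hs \<subseteq> F" "(\<Sum>f\<leftarrow>hs. ?a f) = 0" "sum_list hs = sum_list zs" by auto
        obtain ks where "ks \<in> blocks" "h = sum_list ks" using Cons.prems by auto
        then show ?case using hs by (intro exI[of _ "ks @ hs"]) (auto simp: blocks_def)
      qed
      then obtain hs where hs: "set hs \<subseteq> F" "(\<Sum>f\<leftarrow>hs. ?a f) = 0" "sum_list hs = sum_list zs" by blast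
      have z: "z = x + sum_list (g @ hs)" by (simp add: zs(2) x'_def hs(3) add.assoc)
      then have "z \<in> linear_set x F" using gF hs(1) unfolding linear_set_iff by (metis set_append Un_least)
      then have "z \<in> sols ?es" using F(5) by blast
      moreover have "(\<Sum>f\<in>#mset fs. ?a f) = (\<Sum>f\<leftarrow>g. ?a f)"
      proof -
        have "(\<Sum>f\<in>#sum_list Hs. ?a f) = 0" using GH(3) by (induction Hs) auto
        then show ?thesis unfolding GH(1) by (simp add: sum_mset_sum_list flip: g mset_map)
      qed
      then have "esum r (eval 0 es) + ?a z = 0"
        using tot hs(2) by (simp add: z lin_plus lin_sum_list)
      ultimately show "z \<in> sols es" using sols by blast
    qed
    ultimately have "good_at (\<lambda>_. 1) (M * (1 + N + 2 * K)) (sols es) y"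
      unfolding good_at_def by (intro exI[of _ x'] exI[of _ F']) auto
    moreover have "M * (1 + N + 2 * K) = poly q (esize es)"
      by (simp add: q_def pN_def pK_def N_def D_def K_def M_def S_def mult_2 mult.commute distrib_left)
    ultimately show ?thesis by simp
  qed
  then show ?thesis unfolding tame_on_def by blast
qed

end

section \<open>Transitive forests\<close>

lemma sum_list_replicate_unit: "sum_list (replicate n (unit i)) = (\<lambda>j. if j = i then n else 0)"
  by (induction n) (auto simp: unit_def fun_eq_iff)

lemma sum_of_units:
  "distinct xs \<Longrightarrow> supported xs y \<Longrightarrow> \<exists>fs. set fs \<subseteq> unit ` set xs \<and> y = sum_list fs"
proof (induction xs arbitrary: y)
  case Nil
  then show ?case by (intro exI[of _ "[]"]) (auto simp: supported_def fun_eq_iff)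
next
  case (Cons i xs)
  have "supported xs (y(i := 0))" using Cons.prems by (auto simp: supported_def)
  with Cons obtain fs where fs: "set fs \<subseteq> unit ` set xs" "y(i := 0) = sum_list fs" by (metis distinct.simps(2))
  have "sum_list (replicate (y i) (unit i) @ fs) = (\<lambda>j. if j = i then y i else 0) + y(i := 0)"
    by (simp only: sum_list.append sum_list_replicate_unit fs(2))
  also have "\<dots> = y" by (auto simp: fun_eq_iff)
  finally show ?case using fs(1) by (intro exI[of _ "replicate (y i) (unit i) @ fs"]) auto
qed

text \<open>Serves the variables whose base is the empty word: they are unconstrained, and the unit
  vectors are their periods.\<close>

lemma good_at_free:
  assumes "supported xs y"
  shows "good_at (\<lambda>_. 1) 1 {y. supported xs y} y"
proof -
  have "supported (remdups xs) y" using assms by (simp add: supported_def)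
  then obtain fs where fs: "set fs \<subseteq> unit ` set xs" "y = sum_list fs"
    using sum_of_units[of "remdups xs" y] by auto
  have "y = 0 + sum_list fs" using fs(2) by simp
  then have "y \<in> linear_set 0 (unit ` set xs)" unfolding linear_set_iff using fs(1) by blast
  moreover have "supported xs (sum_list gs)" if "set gs \<subseteq> unit ` set xs" for gs
    using that by (induction gs) (auto simp: supported_def unit_def)
  then have "linear_set 0 (unit ` set xs) \<subseteq> {y. supported xs y}"
    by (auto simp: linear_set_iff)
  ultimately show ?thesis unfolding good_at_def
    by (intro exI[of _ 0] exI[of _ "unit ` set xs"]) (auto simp: unit_def)
qed

context graph
begin

lemma tame_on_empty: "tame_on {}"
proof -
  have "good_at (\<lambda>_. 1) (poly 1 (esize es)) (sols es) y"
    if es: "\<forall>e\<in>set es. set (iword e) \<subseteq> {} \<times> UNIV" and y: "y \<in> sols es" for es :: "('a \<times> bool) item list" and y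
  proof -
    have "ieval z e = []" if "e \<in> set es" for z e using es that by (cases e) auto
    then have "eval z es = []" for z by (auto simp: eval_def)
    then have "sols es = {y. supported (evars es) y}" by (simp add: sols_def)
    then show ?thesis using good_at_free y by simp
  qed
  then show ?thesis unfolding tame_on_def by blast
qed

text \<open>\<open>lt\<close> is a strict order in which the elements below a given one form a
  chain. A minimal \<open>r\<close> with all elements above it either fills \<open>B\<close>, and
  then \<open>r\<close> is a universal vertex, or it has no edge to the rest, and \<open>B\<close>
  splits as a free product.\<close>

lemma tame_on_forest:
  assumes edge: "\<And>a b. (a, b) \<in> I \<longleftrightarrow> lt a b \<or> lt b a"
    and irrefl: "\<And>a. \<not> lt a a" and trans: "\<And>a b c. lt a b \<Longrightarrow> lt b c \<Longrightarrow> lt a c"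
    and chain: "\<And>a b c. lt a c \<Longrightarrow> lt b c \<Longrightarrow> a = b \<or> lt a b \<or> lt b a"
    and "finite B"
  shows "tame_on B"
  using \<open>finite B\<close>
proof (induction B rule: finite_psubset_induct)
  case (psubset B)
  show ?case
  proof (cases "B = {}")
    case True
    then show ?thesis using tame_on_empty by simp
  next
    case False
    have "asymp_on B lt" by (rule asymp_onI) (use irrefl trans in blast)
    moreover have "transp_on B lt" by (rule transp_onI) (use trans in blast)
    ultimately obtain r where r: "r \<in> B" "\<forall>x\<in>B. x \<noteq> r \<longrightarrow> \<not> lt x r"
      using Finite_Set.bex_min_element[OF psubset.hyps _ _ False] by blast
    define D where "D = {b \<in> B. lt r b}"
    have rD: "r \<notin> D" using irrefl by (auto simp: D_def)
    show ?thesis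
    proof (cases "B = insert r D")
      case True
      then have "tame_on D" using rD by (intro psubset.IH) auto
      then have "tame_on (insert r D)"
        using rD edge by (intro tame_on_universal) (auto simp: D_def)
      then show ?thesis using True by simp
    next
      case False
      let ?B1 = "insert r D" and ?B2 = "B - insert r D"
      have "?B1 \<subset> B" "?B2 \<subset> B" using False r(1) by (auto simp: D_def)
      then have "tame_on ?B1" "tame_on ?B2" using psubset.IH by blast+
      moreover have no: "\<not> lt a b \<and> \<not> lt b a" if a: "a \<in> ?B1" and b: "b \<in> ?B2" for a b
      proof -
        have nb: "\<not> lt r b" "b \<noteq> r" "\<not> lt b r" using b r(2) by (auto simp: D_def)
        have "a = r \<or> lt r a" using a by (auto simp: D_def)
        \<comment> \<open>\<open>lt a b\<close> would put \<open>b\<close> above \<open>r\<close> by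
          transitivity; \<open>lt b a\<close> would make \<open>b\<close> and \<open>r\<close>
          comparable, both being below \<open>a\<close> or \<open>a\<close> being
          \<open>r\<close>.\<close>
        then show ?thesis using nb trans chain by blast
      qed
      interpret fp: free_pair I ?B1 ?B2
      proof
        show "\<not> (a \<in> ?B1 \<and> b \<in> ?B2) \<and> \<not> (a \<in> ?B2 \<and> b \<in> ?B1)" if "(a, b) \<in> I" for a b
          using no[of a b] no[of b a] that edge by blast
      qed blast
      have "tame_on (?B1 \<union> ?B2)" using fp.tame_on_free_product calculation by blast
      moreover have "?B1 \<union> ?B2 = B" using r(1) by (auto simp: D_def)
      ultimately show ?thesis by simp
    qed
  qed
qed

end

lemma rooted_tree_parent_unique:
  assumes "rooted_tree V E"
  shows "single_valued (E\<inverse>)"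
  using assms unfolding rooted_tree_def single_valued_def by (metis DiffI SigmaD2 converse_iff singletonD subset_iff)

lemma tame_on_transitive_forest:
  assumes "finite_simple_graph A I" "transitive_forest A I"
  shows "graph.tame_on I A"
proof -
  obtain T where T: "\<And>V E. (V, E) \<in> T \<Longrightarrow> rooted_tree V E" "disjoint_family_on fst T"
      "I = (\<Union>(V, E)\<in>T. comparability_edges E)"
    using assms(2) unfolding transitive_forest_def by blast
  define lt where "lt a b \<longleftrightarrow> (\<exists>V E. (V, E) \<in> T \<and> (a, b) \<in> E\<^sup>+)" for a b
  have edge: "(a, b) \<in> I \<longleftrightarrow> lt a b \<or> lt b a" for a b
    unfolding T(3) lt_def comparability_edges_def by blast
  have same: "(V, E) = (V', E')" if "(V, E) \<in> T" "(V', E') \<in> T" "x \<in> V" "x \<in> V'" for V E V' E' x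
    using T(2) that unfolding disjoint_family_on_def by (metis IntI empty_iff fst_conv)
  have inV: "a \<in> V \<and> b \<in> V" if "(V, E) \<in> T" "(a, b) \<in> E\<^sup>+" for V E a b
    using T(1)[OF that(1)] trancl_subset_Sigma[of E V] that(2) unfolding rooted_tree_def by blast
  show ?thesis
  proof (rule graph.tame_on_forest[of I lt])
    show "(a, b) \<in> I \<longleftrightarrow> lt a b \<or> lt b a" for a b by (rule edge)
    show "\<not> lt a a" for a
      using edge[of a a] assms(1) unfolding finite_simple_graph_def irrefl_def by blast
    show "lt a c" if ab: "lt a b" and bc: "lt b c" for a b c
    proof -
      obtain V E V' E' where *: "(V, E) \<in> T" "(a, b) \<in> E\<^sup>+" "(V', E') \<in> T" "(b, c) \<in> E'\<^sup>+"
        using ab bc unfolding lt_def by blast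
      have "(V, E) = (V', E')" using same[OF *(1,3)] inV[OF *(1,2)] inV[OF *(3,4)] by blast
      then show ?thesis using * unfolding lt_def by (auto intro: trancl_trans)
    qed
    show "a = b \<or> lt a b \<or> lt b a" if ac: "lt a c" and bc: "lt b c" for a b c
    proof -
      obtain V E V' E' where *: "(V, E) \<in> T" "(a, c) \<in> E\<^sup>+" "(V', E') \<in> T" "(b, c) \<in> E'\<^sup>+"
        using ac bc unfolding lt_def by blast
      have eq: "(V, E) = (V', E')" using same[OF *(1,3)] inV[OF *(1,2)] inV[OF *(3,4)] by blast
      \<comment> \<open>\<open>a\<close> and \<open>b\<close> are both reached from \<open>c\<close>
        along parent edges; parents are unique, so one of the two paths continues the other.\<close>
      have "(c, a) \<in> (E\<inverse>)\<^sup>*" "(c, b) \<in> (E\<inverse>)\<^sup>*"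
        using * eq by (auto simp: rtrancl_converse intro: trancl_into_rtrancl)
      then have "(a, b) \<in> (E\<inverse>)\<^sup>* \<or> (b, a) \<in> (E\<inverse>)\<^sup>*"
        by (rule single_valued_confluent[OF rooted_tree_parent_unique[OF T(1)[OF *(1)]]])
      then have "(b, a) \<in> E\<^sup>* \<or> (a, b) \<in> E\<^sup>*" by (simp add: rtrancl_converse)
      then show ?thesis using *(1) unfolding lt_def by (auto simp: rtrancl_eq_or_trancl)
    qed
    show "finite A" using assms(1) by (simp add: finite_simple_graph_def)
  qed
qed

section \<open>From pointwise bounds to semilinear representations\<close>

lemma max_norm_le_iff: "max_norm k x \<le> M \<longleftrightarrow> (\<forall>i\<in>{1..k}. x i \<le> M)"
  unfolding max_norm_def by auto

text \<open>Only finitely many pairs of a base and a period set have entries at most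
  \<open>M\<close>. All those whose linear set lies inside \<open>S\<close> are listed, and the
  hypothesis says that they cover \<open>S\<close>.\<close>

lemma good_semilinear:
  assumes "S \<subseteq> nat_vectors k" "\<And>s. s \<in> S \<Longrightarrow> good_at (\<lambda>_. 1) M S s"
  shows "semilinear k S \<and> magnitude k S \<le> M"
proof -
  define V where "V = {v \<in> nat_vectors k. \<forall>i. v i \<le> M}"
  define Q where "Q = {(x, F). x \<in> V \<and> F \<subseteq> V \<and> linear_set x F \<subseteq> S}"
  have "V \<subseteq> {v. \<forall>i. (i \<in> {1..k} \<longrightarrow> v i \<in> {..M}) \<and> (i \<notin> {1..k} \<longrightarrow> v i = 0)}"
    by (auto simp: V_def nat_vectors_def)
  then have finV: "finite V"
    by (rule finite_subset) (intro finite_set_of_finite_funs, auto)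
  have "Q \<subseteq> V \<times> Pow V" by (auto simp: Q_def)
  then have "finite Q" using finV by (meson finite_SigmaI finite_Pow_iff finite_subset)
  then obtain \<rho> where \<rho>: "set \<rho> = Q" using finite_list by blast
  have rep: "semilinear_representation k S \<rho>"
    unfolding semilinear_representation_def
  proof
    show "\<forall>(x, F)\<in>set \<rho>. x \<in> nat_vectors k \<and> finite F \<and> F \<subseteq> nat_vectors k"
    proof (clarify)
      fix x F assume "(x, F) \<in> set \<rho>"
      then have xF: "x \<in> V" "F \<subseteq> V" unfolding \<rho> Q_def by auto
      moreover have "V \<subseteq> nat_vectors k" unfolding V_def by blast
      moreover have "finite F" using xF(2) finV by (rule finite_subset)
      ultimately show "x \<in> nat_vectors k \<and> finite F \<and> F \<subseteq> nat_vectors k" by blast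
    qed
    show "S = (\<Union>(x, F)\<in>set \<rho>. linear_set x F)"
    proof
      show "(\<Union>(x, F)\<in>set \<rho>. linear_set x F) \<subseteq> S" unfolding \<rho> Q_def by blast
      show "S \<subseteq> (\<Union>(x, F)\<in>set \<rho>. linear_set x F)"
      proof
        fix s assume "s \<in> S"
        then obtain x F where F: "\<forall>i. x i \<le> M" "\<forall>f\<in>F. \<forall>i. f i \<le> M" "s \<in> linear_set x F"
            "linear_set x F \<subseteq> S"
          using assms(2)[OF \<open>s \<in> S\<close>] by (auto simp: good_at_def)
        have x: "x \<in> nat_vectors k" using F(4) linear_set_base assms(1) by blast
        have "f \<in> nat_vectors k" if "f \<in> F" for f
        proof -
          have "x + f \<in> nat_vectors k"
            using linear_set_add_period[OF linear_set_base that] F(4) assms(1) by blast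
          then show ?thesis by (auto simp: nat_vectors_def)
        qed
        then have "(x, F) \<in> Q" using F x by (auto simp: Q_def V_def)
        then show "s \<in> (\<Union>(x, F)\<in>set \<rho>. linear_set x F)" using F(3) unfolding \<rho> by blast
      qed
    qed
  qed
  have sub: "(\<Union>(x, F)\<in>set \<rho>. insert x F) \<subseteq> V" unfolding \<rho> Q_def by blast
  have "rep_magnitude k \<rho> \<le> M"
    unfolding rep_magnitude_def
  proof (rule Max.boundedI)
    show "finite (insert 0 (max_norm k ` (\<Union>(x, F)\<in>set \<rho>. insert x F)))"
      by (intro finite.insertI finite_imageI finite_subset[OF sub finV])
    fix n assume "n \<in> insert 0 (max_norm k ` (\<Union>(x, F)\<in>set \<rho>. insert x F))"
    then consider "n = 0" | v where "v \<in> V" "n = max_norm k v" using sub by blast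
    then show "n \<le> M" by cases (auto simp: max_norm_le_iff V_def)
  qed simp
  moreover have "magnitude k S \<le> rep_magnitude k \<rho>"
    unfolding magnitude_def using rep by (intro Least_le) blast
  ultimately show ?thesis using rep unfolding semilinear_def by auto
qed

section \<open>Passage to the graph group and its generating sets\<close>

text \<open>Deleting the letters outside \<open>A\<close> turns a derivation over all letters into
  one over \<open>A\<close>, so words over \<open>A\<close> are identified in the large group only
  if they are in the small one.\<close>

lemma pres_cong_restrict:
  assumes "(u, v) \<in> pres_cong UNIV (comm_rels I)" "I \<subseteq> A \<times> A"
  shows "(filter (\<lambda>l. fst l \<in> A) u, filter (\<lambda>l. fst l \<in> A) v) \<in> pres_cong A (comm_rels I)"
  using assms(1)
proof (induction rule: pres_cong.induct)
  case (refl w)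
  have "filter (\<lambda>l. fst l \<in> A) w \<in> signed_words A" by auto
  then show ?case by (rule pres_cong.refl)
next
  case (trans u v w)
  then show ?case by (blast intro: pres_cong.trans)
next
  case (rel u v)
  then obtain a b where ab: "u = [(a, True), (b, True)]" "v = [(b, True), (a, True)]" "(a, b) \<in> I"
    by (auto simp: comm_rels_def)
  then have "a \<in> A" "b \<in> A" using assms(2) by auto
  then show ?case using rel ab by (auto intro: pres_cong.rel)
next
  case (cancel a b)
  then show ?case by (auto intro: pres_cong.cancel pres_cong.refl)
qed (auto intro: pres_cong.sym pres_cong.mult)

lemma pres_cong_mono: "(u, v) \<in> pres_cong A R \<Longrightarrow> (u, v) \<in> pres_cong UNIV R"
  by (induction rule: pres_cong.induct) (auto intro: pres_cong.intros)

text \<open>Makes the set behind the \<open>LEAST\<close> in \<open>word_length\<close> nonempty, so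
  that shortest words exist.\<close>

lemma foldr_generate:
  assumes "group G" "g \<in> generate G X" "X \<subseteq> carrier G"
  shows "\<exists>w. set w \<subseteq> X \<union> m_inv G ` X \<and> foldr (\<otimes>\<^bsub>G\<^esub>) w \<one>\<^bsub>G\<^esub> = g"
  using assms(2)
proof (induction rule: generate.induct)
  case one
  then show ?case by (intro exI[of _ "[]"]) auto
next
  case (incl h)
  then show ?case using assms(1,3) by (intro exI[of _ "[h]"]) (auto simp: group.is_monoid monoid.r_one)
next
  case (inv h)
  then show ?case using assms(1,3) by (intro exI[of _ "[inv\<^bsub>G\<^esub> h]"]) (auto simp: group.is_monoid monoid.r_one group.inv_closed)
next
  case (eng h1 h2)
  interpret group G by fact
  obtain v w where vw: "set v \<subseteq> X \<union> m_inv G ` X" "foldr (\<otimes>\<^bsub>G\<^esub>) v \<one>\<^bsub>G\<^esub> = h1"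
      "set w \<subseteq> X \<union> m_inv G ` X" "foldr (\<otimes>\<^bsub>G\<^esub>) w \<one>\<^bsub>G\<^esub> = h2" using eng.IH by blast
  have X: "X \<union> m_inv G ` X \<subseteq> carrier G" using assms(3) by auto
  have closed: "set u \<subseteq> X \<union> m_inv G ` X \<Longrightarrow> foldr (\<otimes>\<^bsub>G\<^esub>) u \<one>\<^bsub>G\<^esub> \<in> carrier G" for u
    using X by (induction u) auto
  have "set u \<subseteq> X \<union> m_inv G ` X \<Longrightarrow>
      foldr (\<otimes>\<^bsub>G\<^esub>) (u @ w) \<one>\<^bsub>G\<^esub> = foldr (\<otimes>\<^bsub>G\<^esub>) u \<one>\<^bsub>G\<^esub> \<otimes>\<^bsub>G\<^esub> foldr (\<otimes>\<^bsub>G\<^esub>) w \<one>\<^bsub>G\<^esub>" for u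
  proof (induction u)
    case Nil
    then show ?case using closed[OF vw(3)] by simp
  next
    case (Cons x u)
    then show ?case using X closed[of u] closed[OF vw(3)] by (auto simp: m_assoc subset_iff)
  qed
  then show ?case using vw by (intro exI[of _ "v @ w"]) auto
qed

text \<open>The identity has length 0, so an equation of given size can have arbitrarily many
  trivial coefficients and powers. Dropping empty words bounds the number of items; a variable that
  disappears with its base is unconstrained.\<close>

definition clean :: "'l item \<Rightarrow> 'l item list" where
  "clean e = (if iword e = [] then [] else [e])"

primrec items :: "(nat \<Rightarrow> 'l list) \<Rightarrow> (nat \<Rightarrow> 'l list) \<Rightarrow> nat \<Rightarrow> 'l item list" where
  "items H W 0 = clean (Con (H 0))"
| "items H W (Suc k) = items H W k @ clean (Var (Suc k) (W (Suc k))) @ clean (Con (H (Suc k)))"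

lemma eval_clean [simp]: "eval y (clean e) = ieval y e"
  by (cases e) (auto simp: clean_def)

lemma evars_items: "set (evars (items H W k)) \<subseteq> {1..k} \<and> distinct (evars (items H W k))"
  by (induction k) (auto simp: clean_def)

text \<open>A word that survives \<open>clean\<close> is nonempty, so its length plus 1 is at most
  twice its length.\<close>

lemma esize_items:
  "esize (items H W k) \<le> 2 * ((\<Sum>i=0..k. length (H i)) + (\<Sum>i=1..k. length (W i)))"
proof -
  have clean: "esize (clean e) \<le> 2 * length (iword e)" for e :: "'a item"
    by (cases "iword e") (auto simp: clean_def)
  show ?thesis
  proof (induction k)
    case 0
    then show ?case using clean[of "Con (H 0)"] by simp
  next
    case (Suc k)
    then show ?case using clean[of "Con (H (Suc k))"] clean[of "Var (Suc k) (W (Suc k))"] by simp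
  qed
qed

lemma items_words: "(\<And>i. i \<le> k \<Longrightarrow> set (H i) \<subseteq> D) \<Longrightarrow> (\<And>i. 1 \<le> i \<Longrightarrow> i \<le> k \<Longrightarrow> set (W i) \<subseteq> D) \<Longrightarrow>
    \<forall>e\<in>set (items H W k). set (iword e) \<subseteq> D"
  by (induction k) (auto simp: clean_def split: if_splits)

lemma signed_words_iff: "w \<in> signed_words A \<longleftrightarrow> set w \<subseteq> A \<times> UNIV"
  by (auto simp: lists_eq_set)

theorem theorem6p5:
  fixes A :: "'a set" and I :: "('a \<times> 'a) set"
  assumes "finite_simple_graph A I"
    and "transitive_forest A I"
  shows "knapsack_tame (graph_group A I)"
proof -
  interpret graph I .
  define G where "G = graph_group A I"
  define cls where "cls w = pres_cong A (comm_rels I) `` {w}" for w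
  have G: "G = presented_group A (comm_rels I)" by (simp add: G_def graph_group_def comm_rels_def)
  interpret G: group G unfolding G by (rule group_presented_group)
  have finA: "finite A" and IA: "I \<subseteq> A \<times> A" using assms(1) by (auto simp: finite_simple_graph_def)
  have car: "carrier G = cls ` signed_words A"
    by (auto simp: G presented_group_def quotient_def cls_def)
  have one: "\<one>\<^bsub>G\<^esub> = cls []" by (simp add: G presented_group_def cls_def)
  have mult: "cls u \<otimes>\<^bsub>G\<^esub> cls v = cls (u @ v)" if "u \<in> signed_words A" "v \<in> signed_words A" for u v
    unfolding G cls_def using that by (rule mult_presented_group)
  have power: "cls w [^]\<^bsub>G\<^esub> n = cls (wpow w n) \<and> wpow w n \<in> signed_words A"
    if w: "w \<in> signed_words A" for w and n :: nat
  proof (induction n)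
    case (Suc n)
    have "wpow w (Suc n) = wpow w n @ w" using wpow_add[of w n 1] by simp
    then show ?case using Suc w mult by simp
  qed (simp add: one)
  have triv_iff: "cls w = \<one>\<^bsub>G\<^esub> \<longleftrightarrow> triv w" if w: "w \<in> signed_words A" for w
  proof -
    have "cls w = \<one>\<^bsub>G\<^esub> \<longleftrightarrow> (w, []) \<in> pres_cong A (comm_rels I)"
      unfolding one cls_def using w by (intro eq_equiv_class_iff[OF equiv_pres_cong]) auto
    also have "\<dots> \<longleftrightarrow> triv w"
    proof
      assume "triv w"
      then have "(filter (\<lambda>l. fst l \<in> A) w, []) \<in> pres_cong A (comm_rels I)"
        using pres_cong_restrict[OF _ IA, of w "[]"] by (simp add: eqv_def)
      moreover have "filter (\<lambda>l. fst l \<in> A) w = w" using w by (induction w) auto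
      ultimately show "(w, []) \<in> pres_cong A (comm_rels I)" by simp
    qed (simp add: eqv_def pres_cong_mono)
    finally show ?thesis .
  qed
  obtain p :: "nat poly" where p: "\<And>es y. (\<forall>e\<in>set es. set (iword e) \<subseteq> A \<times> UNIV) \<Longrightarrow> distinct (evars es) \<Longrightarrow>
      y \<in> sols es \<Longrightarrow> good_at (\<lambda>_. 1) (poly p (esize es)) (sols es) y"
    using tame_on_transitive_forest[OF assms] unfolding tame_on_def by blast
  have "finite_generating_set G (carrier G \<inter> (\<lambda>l. cls [l]) ` (A \<times> UNIV))" (is "finite_generating_set G ?X")
    unfolding finite_generating_set_def
  proof (intro conjI)
    show "finite ?X" using finA by simp
    show "?X \<subseteq> carrier G" by blast
    have "cls w \<in> generate G ?X" if "w \<in> signed_words A" for w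
      using that
    proof (induction w)
      case Nil
      then show ?case using generate.one[of G ?X] by (simp add: one)
    next
      case (Cons l w)
      have "l \<in> A \<times> UNIV" "[l] \<in> signed_words A" using Cons(1) by auto
      then have "cls [l] \<in> cls ` signed_words A" "cls [l] \<in> (\<lambda>l. cls [l]) ` (A \<times> UNIV)" by blast+
      then have "cls [l] \<in> ?X" unfolding car by (rule IntI)
      then have "cls [l] \<otimes>\<^bsub>G\<^esub> cls w \<in> generate G ?X" using Cons(3) by (rule generate.eng[OF generate.incl])
      then show ?case using mult[of "[l]" w] Cons(1,2) by simp
    qed
    then have "carrier G \<subseteq> generate G ?X" using car by auto
    moreover have "generate G ?X \<subseteq> carrier G" by (rule G.generate_incl) blast
    ultimately show "generate G ?X = carrier G" by blast
  qed
  moreover have "knapsack_tame_wrt G X" if X: "finite_generating_set G X" for X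
  proof -
    let ?X = "X \<union> m_inv G ` X"
    have fX: "finite ?X" and XG: "X \<subseteq> carrier G" "?X \<subseteq> carrier G" and gen: "generate G X = carrier G"
      using X by (auto simp: finite_generating_set_def)
    obtain rp where rp: "\<And>x. x \<in> carrier G \<Longrightarrow> rp x \<in> signed_words A \<and> cls (rp x) = x"
    proof -
      have "\<forall>x\<in>carrier G. \<exists>w. w \<in> signed_words A \<and> cls w = x" unfolding car by blast
      from bchoice[OF this] show ?thesis using that by blast
    qed
    \<comment> \<open>The longest chosen word for a member of \<open>X\<close> or an inverse:
      rewriting words over \<open>X\<close> into letters of \<open>A\<close> costs this constant
      factor.\<close>
    define c where "c = Max (insert 0 ((length \<circ> rp) ` ?X))"
    have c: "length (rp x) \<le> c" if "x \<in> ?X" for x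
      unfolding c_def using fX that by (intro Max_ge) auto
    have short: "\<exists>w. w \<in> signed_words A \<and> cls w = g \<and> length w \<le> c * word_length G X g"
      if g: "g \<in> carrier G" for g
    proof -
      have "\<exists>n w. set w \<subseteq> ?X \<and> length w = n \<and> foldr (\<otimes>\<^bsub>G\<^esub>) w \<one>\<^bsub>G\<^esub> = g"
        using foldr_generate[OF G.is_group _ XG(1), of g] g gen by blast
      then have "\<exists>w. set w \<subseteq> ?X \<and> length w = word_length G X g \<and> foldr (\<otimes>\<^bsub>G\<^esub>) w \<one>\<^bsub>G\<^esub> = g"
        unfolding word_length_def by (rule LeastI_ex)
      then obtain w where w: "set w \<subseteq> ?X" "length w = word_length G X g" "foldr (\<otimes>\<^bsub>G\<^esub>) w \<one>\<^bsub>G\<^esub> = g"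
        by blast
      have "set v \<subseteq> ?X \<Longrightarrow> concat (map rp v) \<in> signed_words A \<and>
          cls (concat (map rp v)) = foldr (\<otimes>\<^bsub>G\<^esub>) v \<one>\<^bsub>G\<^esub> \<and> length (concat (map rp v)) \<le> c * length v" for v
      proof (induction v)
        case (Cons x v)
        then have "x \<in> ?X" "x \<in> carrier G" using XG(2) by auto
        with Cons rp[of x] c[of x] mult[of "rp x" "concat (map rp v)"] show ?case by auto
      qed (simp add: one)
      from this[OF w(1)] show ?thesis using w(2,3) by auto
    qed
    obtain sw where sw: "\<And>g. g \<in> carrier G \<Longrightarrow>
        sw g \<in> signed_words A \<and> cls (sw g) = g \<and> length (sw g) \<le> c * word_length G X g"
    proof -
      have "\<forall>g\<in>carrier G. \<exists>w. w \<in> signed_words A \<and> cls w = g \<and> length w \<le> c * word_length G X g"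
        by (intro ballI short)
      then obtain f where "\<forall>g\<in>carrier G. f g \<in> signed_words A \<and> cls (f g) = g \<and> length (f g) \<le> c * word_length G X g"
        by (rule bchoice[THEN exE])
      then show ?thesis by (intro that[of f]) (rule bspec)
    qed
    \<comment> \<open>\<open>2 * c\<close> combines the factor of \<open>esize_items\<close> with
      the change of generators; the summand 1 pays for the unit periods of unconstrained
      variables.\<close>
    define q where "q = pcompose p [:0, 2 * c:] + 1"
    have "semilinear k (exponent_solutions G k h g) \<and>
        magnitude k (exponent_solutions G k h g) \<le> poly q (equation_size G X k h g)"
      if h: "h ` {0..k} \<subseteq> carrier G" and g: "g ` {1..k} \<subseteq> carrier G" for k h g
    proof (rule good_semilinear)
      let ?S = "exponent_solutions G k h g"
      show "?S \<subseteq> nat_vectors k" by (auto simp: exponent_solutions_def)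
      define H where "H i = sw (h i)" for i
      define W where "W i = sw (g i)" for i
      define es where "es = items H W k"
      have hw: "H i \<in> signed_words A" "cls (H i) = h i" "length (H i) \<le> c * word_length G X (h i)"
        if "i \<le> k" for i
      proof -
        have "h i \<in> carrier G" using h that by force
        then show "H i \<in> signed_words A" "cls (H i) = h i"
          "length (H i) \<le> c * word_length G X (h i)" using sw unfolding H_def W_def by blast+
      qed
      have gw: "W i \<in> signed_words A" "cls (W i) = g i" "length (W i) \<le> c * word_length G X (g i)"
        if "1 \<le> i" "i \<le> k" for i
      proof -
        have "g i \<in> carrier G" using g that by force
        then show "W i \<in> signed_words A" "cls (W i) = g i"
          "length (W i) \<le> c * word_length G X (g i)" using sw unfolding H_def W_def by blast+
      qed
      have es_words: "\<forall>e\<in>set es. set (iword e) \<subseteq> A \<times> UNIV"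
        unfolding es_def using hw(1) gw(1) by (intro items_words) (auto simp: signed_words_iff)
      have dist: "distinct (evars es)" and vars: "set (evars es) \<subseteq> {1..k}"
        using evars_items[of H W k] by (auto simp: es_def)
      have size: "esize es \<le> 2 * c * equation_size G X k h g"
      proof -
        have "(\<Sum>i=0..k. length (H i)) \<le> (\<Sum>i=0..k. c * word_length G X (h i))"
          using hw(3) by (intro sum_mono) auto
        moreover have "(\<Sum>i=1..k. length (W i)) \<le> (\<Sum>i=1..k. c * word_length G X (g i))"
          using gw(3) by (intro sum_mono) auto
        ultimately have "(\<Sum>i=0..k. length (H i)) + (\<Sum>i=1..k. length (W i))
            \<le> c * equation_size G X k h g"
          unfolding equation_size_def distrib_left sum_distrib_left by (rule add_mono)
        then have "2 * ((\<Sum>i=0..k. length (H i)) + (\<Sum>i=1..k. length (W i)))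
            \<le> 2 * c * equation_size G X k h g"
          by simp
        then show ?thesis
          using esize_items[of H W k] unfolding es_def by (rule le_trans[rotated])
      qed
      have prod: "exponent_product G h g x j = cls (eval x (items H W j)) \<and>
          eval x (items H W j) \<in> signed_words A" if "j \<le> k" for x j
        using that
      proof (induction j)
        case 0
        then show ?case using hw[of 0] by simp
      next
        case (Suc j)
        let ?u = "eval x (items H W j)" and ?w = "wpow (W (Suc j)) (x (Suc j))"
        have IH: "exponent_product G h g x j = cls ?u" "?u \<in> signed_words A"
          using Suc.IH[OF Suc_leD[OF Suc.prems]] by blast+
        have w: "g (Suc j) [^]\<^bsub>G\<^esub> x (Suc j) = cls ?w" "?w \<in> signed_words A"
          using power[OF gw(1)[of "Suc j"], of "x (Suc j)"] gw(2)[of "Suc j"] Suc.prems by simp_all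
        have "?u @ ?w \<in> signed_words A" using IH(2) w(2) by (rule append_in_lists_conv[THEN iffD2, OF conjI])
        then show ?case
          using IH w hw[OF Suc.prems] mult[of ?u ?w] mult[of "?u @ ?w" "H (Suc j)"] by simp
      qed
      have sol_iff: "x \<in> ?S \<longleftrightarrow> x \<in> nat_vectors k \<and> triv (eval x es)" for x
        using prod[OF order_refl] triv_iff by (auto simp: exponent_solutions_def es_def)
      show "good_at (\<lambda>_. 1) (poly q (equation_size G X k h g)) ?S s" if s: "s \<in> ?S" for s
      proof -
        \<comment> \<open>The variables that were dropped together with an empty base.\<close>
        let ?fv = "filter (\<lambda>i. i \<notin> set (evars es)) [1..<Suc k]"
        have fv: "set ?fv = {1..k} - set (evars es)" by auto
        have "res (evars es) s \<in> sols es"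
          using s by (simp add: sols_def eval_res sol_iff)
        then have 1: "good_at (\<lambda>_. 1) (poly p (esize es)) (sols es) (res (evars es) s)"
          using p es_words dist by blast
        have 2: "good_at (\<lambda>_. 1) 1 {y. supported ?fv y} (res ?fv s)"
          by (rule good_at_free) simp
        show ?thesis
        proof (rule good_at_plus[OF 1 2])
          show "s = res (evars es) s + res ?fv s"
          proof
            fix i
            have "s i = 0" if "i \<notin> {1..k}" using s that by (auto simp: sol_iff nat_vectors_def)
            then show "s i = (res (evars es) s + res ?fv s) i" unfolding plus_fun_apply res_def fv by auto
          qed
          have "poly p (esize es) \<le> poly p (2 * c * equation_size G X k h g)"
            using size by (rule poly_nat_mono)
          then show "poly p (esize es) + 1 \<le> poly q (equation_size G X k h g)"
            by (simp add: q_def poly_pcompose mult.commute mult.left_commute)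
          fix y1 y2 assume y: "y1 \<in> sols es" "y2 \<in> {y. supported ?fv y}"
          have y2: "y2 i = 0" if "i \<notin> {1..k} \<or> i \<in> set (evars es)" for i
            using y(2) that fv unfolding supported_def mem_Collect_eq by blast
          have "eval (y1 + y2) es = eval y1 es"
            by (rule eval_cong) (simp add: y2)
          moreover have "y1 i = 0" if "i \<notin> {1..k}" for i
            using y(1) that vars unfolding sols_def supported_def by blast
          then have "y1 + y2 \<in> nat_vectors k" using y2 unfolding nat_vectors_def by simp
          ultimately show "y1 + y2 \<in> ?S" using y(1) by (simp add: sol_iff sols_def)
        qed
      qed
    qed
    then show ?thesis unfolding knapsack_tame_wrt_def by (intro exI[of _ q] allI impI)
  qed
  ultimately show ?thesis
    unfolding knapsack_tame_def G_def[symmetric] using G.is_group by blast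
qed

end
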